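(* Let $(X_i, i\in\mathbb{T}^* )$ be a super-critical spatially homogeneous $P^*$-bifurcating Markov chain on a Galton-Watson tree, and let $W=\lim_{q\to\infty} m^{-q}|\mathbb{G}_q^*|$ (limit a.s. and in $L^2$). Let $F$ be a vector space of measurable functions on $S$ satisfying properties (i)-(vi) listed in the context, with $\mu$ the probability measure of property (iv). Let $f$ be a real measurable function on $\bar S^3$ such that $P^*f$ and $P^*(f^2)$ exist and belong to $F$. Then the sequences $$\Big(\frac{1}{\mathbb{E}[|\mathbb{G}_q^*|]}\sum_{i\in\mathbb{G}_q^*}f(\Delta_i),\ q\in\mathbb{N}\Big)\quad\text{and}\quad\Big(\frac{1}{\mathbb{E}[|\mathbb{T}_r^*|]}\sum_{i\in\mathbb{T}_r^*}f(\Delta_i),\ r\in\mathbb{N}\Big)$$ converge to $\langle\mu,P^*f\rangle W$ in $L^2$; and the sequences $$\Big(\mathbf{1}_{\{|\mathbb{G}_q^*|>0\}}\frac{1}{|\mathbb{G}_q^*|}\sum_{i\in\mathbb{G}_q^*}f(\Delta_i),\ q\in\mathbb{N}\Big)\quad\text{and}\quad\Big(\mathbf{1}_{\{|\mathbb{G}_r^*|>0\}}\frac{1}{|\mathbb{T}_r^*|}\sum_{i\in\mathbb{T}_r^*}f(\Delta_i),\ r\in\mathbb{N}\Big)$$ converge to $\langle\mu,P^*f\rangle\mathbf{1}_{\{W\ne0\}}$ in probability.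
   Context: Tree: $\mathbb{G}_0=\{\emptyset\}$, $\mathbb{G}_k=\{0,1\}^k$ for $k\ge1$, $\mathbb{T}_r=\bigcup_{0\le k\le r}\mathbb{G}_k$, $\mathbb{T}=\bigcup_{k\ge0}\mathbb{G}_k$; the two daughters of $i\in\mathbb{T}$ are $i0$ and $i1$ (with $\emptyset0=0$, $\emptyset1=1$). State space: $S$ is a metric space with its Borel $\sigma$-field $\mathcal{S}$; $\bar S=S\cup\{\partial\}$, where $\partial$ is an added cemetery point, and $\bar{\mathcal S}$ is the $\sigma$-field generated by $\mathcal S$ and $\{\partial\}$. Kernel: $P^*$ is a probability kernel from $\bar S$ to $\bar S^2$ with $P^*(\partial,\{(\partial,\partial)\})=1$. For measurable $g$ on $\bar S^3$, $P^*g(x)=\int_{\bar S^2} g(x,y,z)\,P^*(x,dy,dz)$ when this exists. $P^*$-bifurcating Markov chain ($P^*$-BMC): a process $(X_i,i\in\mathbb{T})$ with values in $\bar S$ such that $X_\emptyset$ has law $\nu$ and, for all bounded measurable real $(g_i,i\in\mathbb{T})$ on $\bar S^3$ and all $k\ge0$, $\mathbb{E}[\prod_{i\in\mathbb{G}_k}g_i(X_i,X_{i0},X_{i1})\mid\sigma(X_j;j\in\mathbb{T}_k)]=\prod_{i\in\mathbb{G}_k}P^*g_i(X_i)$. The law $\nu$ is carried by $S$. Let $\mathbb{T}^*=\{i\in\mathbb{T}:X_i\ne\partial\}$ and $J^*=J\cap\mathbb{T}^*$ for $J\subset\mathbb{T}$; $(X_i,i\in\mathbb{T}^* )$ is called a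 $P^*$-BMC on a Galton-Watson tree. It is spatially homogeneous if $p_{1,0}=P^*(x,S\times S)$, $p_0=P^*(x,S\times\{\partial\})$, $p_1=P^*(x,\{\partial\}\times S)$ do not depend on $x\in S$, and then super-critical if $m:=2p_{1,0}+p_0+p_1>1$. $|J|$ is the cardinality of $J$. $\Delta_i=(X_i,X_{i0},X_{i1})$. Auxiliary chain: for $x\in S$, $A\in\mathcal S$, $B\in\mathcal S^{2}$ (product $\sigma$-field on $S^2$), $P(x,B)=P^*(x,B)$, $P_0^*(x,A)=P^*(x,A\times\bar S)$, $P_1^*(x,A)=P^*(x,\bar S\times A)$, $Q=\frac1m(P_0^*+P_1^* )$. $Y=(Y_n,n\in\mathbb{N})$ is a Markov chain on $S$ with transition kernel $Q$ and $Y_0$ distributed as $X_\emptyset$; $\mathbb{E}_x$ means the initial state is $x$. $F$ is a vector subspace of the space of measurable real functions on $S$ such that: (i) $F$ contains the constants; (ii) $f^2\in F$ for all $f\in F$; (iii) for all $f_0,f_1\in F$, $f_0\otimes f_1\in L^1(P(x,\cdot))$ for all $x\in S$ and $P(f_0\otimes f_1)\in F$, where $(f_0\otimes f_1)(y,z)=f_0(y)f_1(z)$; and for $\delta\in\{0,1\}$ and $f\in F$, $f\in L^1(P_\delta^*(x,\cdot))$ for all $x\in S$ and $P_\delta^*f\in F$; (iv) there is a probability measure $\mu$ on $S$ with $F\subset L^1(\mu)$ and $\lim_{n\to\infty}\mathbb{E}_x[f(Y_n)]=\langle\mu,f\rangle$ for all $x\in S$, $f\in F$; (v) for every $f\in F$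 there is $g\in F$ with $|Q^rf|\le g$ for all $r\in\mathbb{N}$; (vi) $F\subset L^1(\nu)$. A function on $\bar S$ is said to belong to $F$ if its restriction to $S$ does. $\langle\mu,h\rangle=\int_S h\,d\mu$. An expression multiplied by the indicator of an event is $0$ off that event. $\mathbb{E}[|\mathbb{G}_q^*|]=m^q$ and $\mathbb{E}[|\mathbb{T}_r^*|]=(m^{r+1}-1)/(m-1)$. *)

theory Defs
  imports "HOL-Probability.Probability"
begin

text \<open>Nodes of the binary tree are words over \<open>{False, True}\<close>: \<open>[]\<close> is the root, \<open>i @ [False]\<close> and \<open>i @ [True]\<close>
  are the daughters $i0$ and $i1$ of \<open>i\<close>.\<close>

type_synonym node = "bool list"

definition gen :: "nat \<Rightarrow> node set" where
  "gen k = {i. length i = k}"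

definition tree_upto :: "nat \<Rightarrow> node set" where
  "tree_upto r = (\<Union>k\<in>{0..r}. gen k)"

text \<open>\<open>'a option\<close> is the state space with the cemetery point \<open>None\<close> added.\<close>

definition bar :: "('a::topological_space) option measure" where
  "bar = sigma UNIV (insert {None} ((`) Some ` sets borel))"

text \<open>For a non-separable \<open>'a\<close>, the product \<open>\<sigma>\<close>-fields below may be strictly smaller than the
  Borel \<open>\<sigma>\<close>-fields of the product topologies.\<close>

abbreviation bar2 :: "('a::topological_space option \<times> 'a option) measure" where
  "bar2 \<equiv> bar \<Otimes>\<^sub>M bar"

abbreviation bar3 :: "('a::topological_space option \<times> 'a option \<times> 'a option) measure" where
  "bar3 \<equiv> bar \<Otimes>\<^sub>M bar \<Otimes>\<^sub>M bar"

type_synonym 'a bkernel = "'a option \<Rightarrow> ('a option \<times> 'a option) measure"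

definition cemetery_kernel :: "('a::metric_space) bkernel \<Rightarrow> bool" where
  "cemetery_kernel K \<longleftrightarrow>
     K \<in> bar \<rightarrow>\<^sub>M prob_algebra bar2 \<and> measure (K None) {(None, None)} = 1"

definition kapp_exists ::
    "'a bkernel \<Rightarrow> ('a option \<times> 'a option \<times> 'a option \<Rightarrow> real) \<Rightarrow> bool" where
  "kapp_exists K g \<longleftrightarrow> (\<forall>x. integrable (K x) (\<lambda>(y, z). g (x, y, z)))"

definition kapp ::
    "'a bkernel \<Rightarrow> ('a option \<times> 'a option \<times> 'a option \<Rightarrow> real) \<Rightarrow> 'a option \<Rightarrow> real" where
  "kapp K g x = (\<integral>(y, z). g (x, y, z) \<partial>K x)"

definition gen_sigma :: "'w measure \<Rightarrow> 'b measure \<Rightarrow> 'i set \<Rightarrow> ('i \<Rightarrow> 'w \<Rightarrow> 'b) \<Rightarrow> 'w measure" where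
  "gen_sigma M N J X = sigma (space M) {X j -` A \<inter> space M | j A. j \<in> J \<and> A \<in> sets N}"

definition triple :: "(node \<Rightarrow> 'w \<Rightarrow> 'a option) \<Rightarrow> node \<Rightarrow> 'w \<Rightarrow> 'a option \<times> 'a option \<times> 'a option"
  where "triple X i \<omega> = (X i \<omega>, X (i @ [False]) \<omega>, X (i @ [True]) \<omega>)"

text \<open>The initial law is carried by the state space, so it is given as a measure \<open>\<nu>\<close> on \<open>'a\<close>; as a
  law on \<open>'a option\<close> it is the image of \<open>\<nu>\<close> under \<open>Some\<close>.\<close>

definition BMC ::
    "'w measure \<Rightarrow> ('a::metric_space) bkernel \<Rightarrow> 'a measure \<Rightarrow> (node \<Rightarrow> 'w \<Rightarrow> 'a option) \<Rightarrow> bool"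
  where
  "BMC M K \<nu> X \<longleftrightarrow>
     prob_space M \<and> (\<forall>i. X i \<in> M \<rightarrow>\<^sub>M bar) \<and>
     prob_space \<nu> \<and> sets \<nu> = sets borel \<and> distr M bar (X []) = distr \<nu> bar Some \<and>
     (\<forall>g :: node \<Rightarrow> 'a option \<times> 'a option \<times> 'a option \<Rightarrow> real.
        (\<forall>i. g i \<in> borel_measurable bar3 \<and> bounded (range (g i))) \<longrightarrow>
        (\<forall>k. AE \<omega> in M.
           real_cond_exp M (gen_sigma M bar (tree_upto k) X)
             (\<lambda>\<omega>. \<Prod>i\<in>gen k. g i (triple X i \<omega>)) \<omega>
           = (\<Prod>i\<in>gen k. kapp K (g i) (X i \<omega>))))"

definition alive :: "(node \<Rightarrow> 'w \<Rightarrow> 'a option) \<Rightarrow> node set \<Rightarrow> 'w \<Rightarrow> node set" where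
  "alive X J \<omega> = {i \<in> J. X i \<omega> \<noteq> None}"

definition spatially_homogeneous :: "'a bkernel \<Rightarrow> real \<Rightarrow> real \<Rightarrow> real \<Rightarrow> bool" where
  "spatially_homogeneous K p10 p0 p1 \<longleftrightarrow>
     (\<forall>x. measure (K (Some x)) (range Some \<times> range Some) = p10 \<and>
          measure (K (Some x)) (range Some \<times> {None}) = p0 \<and>
          measure (K (Some x)) ({None} \<times> range Some) = p1)"

definition mean_daughters :: "real \<Rightarrow> real \<Rightarrow> real \<Rightarrow> real" where
  "mean_daughters p10 p0 p1 = 2 * p10 + p0 + p1"

definition pair_kernel :: "('a::metric_space) bkernel \<Rightarrow> 'a \<Rightarrow> ('a \<times> 'a) measure" where
  "pair_kernel K x = measure_of UNIV (sets (borel \<Otimes>\<^sub>M borel))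
     (\<lambda>B. emeasure (K (Some x)) (map_prod Some Some ` B))"

text \<open>\<open>marg_kernel K \<delta>\<close> is the sub-probability kernel $P^*_\delta$.\<close>

definition marg_kernel :: "('a::metric_space) bkernel \<Rightarrow> bool \<Rightarrow> 'a \<Rightarrow> 'a measure" where
  "marg_kernel K \<delta> x = measure_of UNIV (sets borel)
     (\<lambda>A. emeasure (K (Some x)) (if \<delta> then UNIV \<times> Some ` A else Some ` A \<times> UNIV))"

definition aux_kernel :: "('a::metric_space) bkernel \<Rightarrow> real \<Rightarrow> 'a \<Rightarrow> 'a measure" where
  "aux_kernel K m x = measure_of UNIV (sets borel)
     (\<lambda>A. ennreal (1 / m) * (emeasure (marg_kernel K False x) A + emeasure (marg_kernel K True x) A))"

definition apply_kernel :: "('a \<Rightarrow> 'b measure) \<Rightarrow> ('b \<Rightarrow> real) \<Rightarrow> 'a \<Rightarrow> real" where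
  "apply_kernel Q f x = (\<integral>y. f y \<partial>Q x)"

definition markov_chain ::
    "'c measure \<Rightarrow> ('a::metric_space \<Rightarrow> 'a measure) \<Rightarrow> 'a measure \<Rightarrow> (nat \<Rightarrow> 'c \<Rightarrow> 'a) \<Rightarrow> bool" where
  "markov_chain N Q \<rho> Y \<longleftrightarrow>
     prob_space N \<and> (\<forall>n. Y n \<in> N \<rightarrow>\<^sub>M borel) \<and> distr N borel (Y 0) = \<rho> \<and>
     (\<forall>g :: 'a \<Rightarrow> real. g \<in> borel_measurable borel \<longrightarrow> bounded (range g) \<longrightarrow>
        (\<forall>n. AE \<omega> in N.
           real_cond_exp N (gen_sigma N borel {0..n} Y) (\<lambda>\<omega>. g (Y (Suc n) \<omega>)) \<omega>
           = apply_kernel Q g (Y n \<omega>)))"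

text \<open>The conditions on the vector space \<open>F\<close> of test functions. \<open>N x\<close> is the probability under which the
  auxiliary chain \<open>Y\<close> starts from \<open>x\<close>.\<close>

definition admissible_class ::
    "('a::metric_space) bkernel \<Rightarrow> real \<Rightarrow> 'a measure \<Rightarrow> ('a \<Rightarrow> 'c measure) \<Rightarrow> (nat \<Rightarrow> 'c \<Rightarrow> 'a)
      \<Rightarrow> 'a measure \<Rightarrow> ('a \<Rightarrow> real) set \<Rightarrow> bool" where
  "admissible_class K m \<nu> N Y \<mu> F \<longleftrightarrow>
     F \<subseteq> borel_measurable borel \<and>
     (\<forall>f\<in>F. \<forall>g\<in>F. (\<lambda>x. f x + g x) \<in> F) \<and> (\<forall>c. \<forall>f\<in>F. (\<lambda>x. c * f x) \<in> F) \<and>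
     (\<forall>c. (\<lambda>x. c) \<in> F) \<and>
     (\<forall>f\<in>F. (\<lambda>x. (f x)\<^sup>2) \<in> F) \<and>
     (\<forall>f0\<in>F. \<forall>f1\<in>F. (\<forall>x. integrable (pair_kernel K x) (\<lambda>(y, z). f0 y * f1 z)) \<and>
        apply_kernel (pair_kernel K) (\<lambda>(y, z). f0 y * f1 z) \<in> F) \<and>
     (\<forall>\<delta>. \<forall>f\<in>F. (\<forall>x. integrable (marg_kernel K \<delta> x) f) \<and>
        apply_kernel (marg_kernel K \<delta>) f \<in> F) \<and>
     prob_space \<mu> \<and> sets \<mu> = sets borel \<and> (\<forall>f\<in>F. integrable \<mu> f) \<and>
     (\<forall>x. \<forall>f\<in>F. (\<lambda>n. \<integral>\<omega>. f (Y n \<omega>) \<partial>N x) \<longlonglongrightarrow> (\<integral>y. f y \<partial>\<mu>)) \<and>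
     (\<forall>f\<in>F. \<exists>g\<in>F. \<forall>r x. \<bar>(apply_kernel (aux_kernel K m) ^^ r) f x\<bar> \<le> g x) \<and>
     (\<forall>f\<in>F. integrable \<nu> f)"

definition in_class :: "('a option \<Rightarrow> real) \<Rightarrow> ('a \<Rightarrow> real) set \<Rightarrow> bool" where
  "in_class h F \<longleftrightarrow> h \<circ> Some \<in> F"

definition square_integrable :: "'w measure \<Rightarrow> ('w \<Rightarrow> real) \<Rightarrow> bool" where
  "square_integrable M U \<longleftrightarrow> U \<in> borel_measurable M \<and> integrable M (\<lambda>\<omega>. (U \<omega>)\<^sup>2)"

definition converges_L2 :: "'w measure \<Rightarrow> (nat \<Rightarrow> 'w \<Rightarrow> real) \<Rightarrow> ('w \<Rightarrow> real) \<Rightarrow> bool" where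
  "converges_L2 M U V \<longleftrightarrow>
     (\<forall>n. square_integrable M (U n)) \<and> square_integrable M V \<and>
     (\<lambda>n. \<integral>\<omega>. (U n \<omega> - V \<omega>)\<^sup>2 \<partial>M) \<longlonglongrightarrow> 0"

definition converges_prob :: "'w measure \<Rightarrow> (nat \<Rightarrow> 'w \<Rightarrow> real) \<Rightarrow> ('w \<Rightarrow> real) \<Rightarrow> bool" where
  "converges_prob M U V \<longleftrightarrow>
     (\<forall>n. U n \<in> borel_measurable M) \<and> V \<in> borel_measurable M \<and>
     (\<forall>\<epsilon>>0. (\<lambda>n. measure M {\<omega> \<in> space M. \<bar>U n \<omega> - V \<omega>\<bar> > \<epsilon>}) \<longlonglongrightarrow> 0)"

text \<open>The random variable $W$; on the event where the limit does not exist, \<open>lim\<close> is an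
  unspecified constant.\<close>

definition gw_limit :: "real \<Rightarrow> (node \<Rightarrow> 'w \<Rightarrow> 'a option) \<Rightarrow> 'w \<Rightarrow> real" where
  "gw_limit m X \<omega> = lim (\<lambda>q. real (card (alive X (gen q) \<omega>)) / m ^ q)"

text \<open>The three kernels obtained from \<^const>\<open>measure_of\<close> have the intended values: the set
  functions that define them are countably additive.\<close>

lemma Some_image_bar: "A \<in> sets borel \<Longrightarrow> Some ` A \<in> sets bar"
  unfolding bar_def by (subst sets_measure_of) auto

lemma space_bar [simp]: "space bar = UNIV"
  unfolding bar_def by (subst space_measure_of) auto

lemma the_measurable_bar: "the \<in> (bar :: 'a::metric_space option measure) \<rightarrow>\<^sub>M borel"
proof (rule measurableI)
  fix A :: "'a set" assume A: "A \<in> sets borel"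
  have N: "{None} \<in> sets (bar :: 'a option measure)"
    unfolding bar_def by (subst sets_measure_of) auto
  have "the -` A \<inter> space bar = Some ` A \<union> (if the None \<in> A then {None} else {})"
    by (auto simp: image_iff split: if_splits) (metis option.collapse)+
  then show "the -` A \<inter> space bar \<in> sets bar"
    using sets.Un[OF Some_image_bar[OF A], of "if the None \<in> A then {None} else {}"] N
    by (simp split: if_splits del: Un_insert_right Un_insert_left)
qed auto

lemma pair_image_bar2:
  fixes B :: "('a::metric_space \<times> 'a) set"
  assumes "B \<in> sets (borel \<Otimes>\<^sub>M borel)"
  shows "map_prod Some Some ` B \<in> sets bar2"
proof -
  have S: "range Some \<in> sets (bar :: 'a option measure)"
    using Some_image_bar[of UNIV] by simp
  have [measurable]: "the \<in> (bar :: 'a option measure) \<rightarrow>\<^sub>M borel" by (rule the_measurable_bar)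
  have "(\<lambda>(y, z). (the y, the z)) \<in> (bar2 :: ('a option \<times> 'a option) measure) \<rightarrow>\<^sub>M borel \<Otimes>\<^sub>M borel"
    by measurable
  from measurable_sets[OF this assms]
  have "(\<lambda>(y, z). (the y, the z)) -` B \<inter> space bar2 \<inter> (range Some \<times> range Some) \<in> sets bar2"
    by (rule sets.Int) (rule pair_measureI[OF S S])
  also have "(\<lambda>(y, z). (the y, the z)) -` B \<inter> space bar2 \<inter> (range Some \<times> range Some)
      = map_prod Some Some ` B"
    unfolding space_pair_measure space_bar
  proof (intro set_eqI iffI)
    fix u assume "u \<in> (\<lambda>(y, z). (the y, the z)) -` B \<inter> (UNIV \<times> UNIV) \<inter> (range Some \<times> range Some)"
    then obtain y z where "u = (Some y, Some z)" "(y, z) \<in> B" by auto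
    then show "u \<in> map_prod Some Some ` B" by (intro image_eqI[of _ _ "(y, z)"]) auto
  qed auto
  finally show ?thesis .
qed

lemma emeasure_measure_of_transport:
  assumes "\<And>A. A \<in> sets L \<Longrightarrow> h A \<in> sets N" "space L = UNIV" "h {} = {}"
    and "\<And>A::nat \<Rightarrow> _. h (\<Union>i. A i) = (\<Union>i. h (A i))"
    and "\<And>A B. A \<inter> B = {} \<Longrightarrow> h A \<inter> h B = {}" and "A \<in> sets L"
  shows "emeasure (measure_of UNIV (sets L) (\<lambda>B. emeasure N (h B))) A = emeasure N (h A)"
proof (rule emeasure_measure_of_sigma)
  show "sigma_algebra UNIV (sets L)"
    using sets.sigma_algebra_axioms[of L] assms(2) by simp
  show "positive (sets L) (\<lambda>B. emeasure N (h B))"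
    using assms(3) by (simp add: positive_def)
  show "countably_additive (sets L) (\<lambda>B. emeasure N (h B))"
  proof (rule countably_additiveI)
    fix A :: "nat \<Rightarrow> _" assume "range A \<subseteq> sets L" "disjoint_family A"
    then have "range (\<lambda>i. h (A i)) \<subseteq> sets N" "disjoint_family (\<lambda>i. h (A i))"
      using assms(1,5) by (auto simp: disjoint_family_on_def)
    then show "(\<Sum>i. emeasure N (h (A i))) = emeasure N (h (\<Union>i. A i))"
      by (simp add: suminf_emeasure assms(4))
  qed
qed fact

lemma sets_cemetery_kernel: "cemetery_kernel K \<Longrightarrow> sets (K x) = sets bar2"
  unfolding cemetery_kernel_def
  using measurable_space[of K bar "prob_algebra bar2" x] by (auto simp: space_prob_algebra)

lemma emeasure_pair_kernel:
  assumes "cemetery_kernel K" "B \<in> sets (borel \<Otimes>\<^sub>M borel)"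
  shows "emeasure (pair_kernel K x) B = emeasure (K (Some x)) (map_prod Some Some ` B)"
  unfolding pair_kernel_def
  by (rule emeasure_measure_of_transport)
     (use assms in \<open>auto simp: sets_cemetery_kernel pair_image_bar2 space_pair_measure\<close>)

lemma emeasure_marg_kernel:
  assumes "cemetery_kernel K" "A \<in> sets borel"
  shows "emeasure (marg_kernel K \<delta> x) A =
    emeasure (K (Some x)) (if \<delta> then UNIV \<times> Some ` A else Some ` A \<times> UNIV)"
  unfolding marg_kernel_def
proof (rule emeasure_measure_of_transport)
  have U: "UNIV \<in> sets (bar :: 'a option measure)"
    using sets.top[of "bar :: 'a option measure"] by simp
  show "(if \<delta> then UNIV \<times> Some ` A else Some ` A \<times> UNIV) \<in> sets (K (Some x))"
    if "A \<in> sets borel" for A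
    using Some_image_bar[OF that] U assms(1) by (auto simp: sets_cemetery_kernel)
qed (use assms in auto)

lemma emeasure_aux_kernel:
  assumes "A \<in> sets borel"
  shows "emeasure (aux_kernel K m x) A =
    ennreal (1 / m) * (emeasure (marg_kernel K False x) A + emeasure (marg_kernel K True x) A)"
  unfolding aux_kernel_def
proof (rule emeasure_measure_of_sigma)
  show "sigma_algebra UNIV (sets (borel :: 'a measure))"
    using sets.sigma_algebra_axioms[of "borel :: 'a measure"] by simp
  have "sets (marg_kernel K \<delta> x) = sets borel" for \<delta>
    unfolding marg_kernel_def using sets.sigma_sets_eq[of "borel :: 'a measure"] by simp
  then show "countably_additive (sets borel) (\<lambda>A. ennreal (1 / m) *
      (emeasure (marg_kernel K False x) A + emeasure (marg_kernel K True x) A))"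
    by (intro countably_additiveI)
       (simp add: ennreal_suminf_cmult suminf_add[symmetric] suminf_emeasure)
qed (use assms in \<open>auto simp: positive_def\<close>)

end

theory Submission
  imports Defs
begin

text \<open>Only expectations of products over one generation are used, never conditional laws. For \<open>g\<close> in \<open>F\<close> let
  \<open>M\<^sub>n g\<close> be the sum of \<open>g (X\<^sub>i)\<close> over the living individuals \<open>i\<close> of generation \<open>n\<close>. Distinct individuals of a
  generation reproduce independently given their types, so \<open>E[(M\<^sub>n\<^sub>+\<^sub>1 g)\<^sup>2]\<close> exceeds \<open>m\<^sup>2 E[(M\<^sub>n (Q g))\<^sup>2]\<close> by at most
  \<open>2 E[M\<^sub>n\<^sub>+\<^sub>1 g\<^sup>2] = O(m\<^sup>n)\<close>. Iterating, \<open>m\<^sup>-\<^sup>n M\<^sub>n g\<close> is as close in \<open>L\<^sup>2\<close> as one likes to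
  \<open>m\<^sup>-\<^sup>p M\<^sub>p (Q\<^sup>n\<^sup>-\<^sup>p g)\<close> for a large fixed \<open>p\<close>, which tends to 0 by dominated convergence when \<open>g\<close> is \<open>\<mu>\<close>-centred.
  The same orthogonality shows that \<open>f (\<Delta>\<^sub>i)\<close> may be replaced by \<open>P\<^sup>* f (X\<^sub>i)\<close> and that the increments of
  \<open>m\<^sup>-\<^sup>n |G\<^sub>n\<^sup>*|\<close> are geometrically small. Sums over the whole tree are geometric averages of those over
  generations. The quotients converge because \<open>W\<close> vanishes almost surely only on extinction: both events have
  as probability the fixed point below 1 of the quadratic offspring generating function.\<close>

section \<open>Extension of kernel identities by truncation\<close>

lemma Fatou_integrable:
  fixes U :: "nat \<Rightarrow> 'w \<Rightarrow> real"
  assumes U: "\<And>n. integrable M (U n)" "\<And>n \<omega>. 0 \<le> U n \<omega>"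
    and V [measurable]: "V \<in> borel_measurable M"
    and lim: "AE \<omega> in M. (\<lambda>n. U n \<omega>) \<longlonglongrightarrow> V \<omega>"
    and le: "\<And>n. n \<ge> n0 \<Longrightarrow> (\<integral>\<omega>. U n \<omega> \<partial>M) \<le> C"
  shows "integrable M V" "(\<integral>\<omega>. V \<omega> \<partial>M) \<le> C"
proof -
  have [measurable]: "U n \<in> borel_measurable M" for n using U(1) by auto
  have C: "0 \<le> C"
    using le[OF order_refl] Bochner_Integration.integral_nonneg[of M "U n0"] U(2) by (meson order_trans)
  have pos: "AE \<omega> in M. 0 \<le> V \<omega>"
    using lim
  proof eventually_elim
    case (elim \<omega>) then show ?case using U(2) by (intro LIMSEQ_le_const) auto
  qed
  have "(\<integral>\<^sup>+\<omega>. ennreal (V \<omega>) \<partial>M) = (\<integral>\<^sup>+\<omega>. liminf (\<lambda>n. ennreal (U n \<omega>)) \<partial>M)"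
  proof (rule nn_integral_cong_AE, use lim in eventually_elim)
    case (elim \<omega>)
    then show ?case using lim_imp_Liminf[OF _ tendsto_ennrealI[OF elim]] by simp
  qed
  also have "\<dots> \<le> liminf (\<lambda>n. \<integral>\<^sup>+\<omega>. ennreal (U n \<omega>) \<partial>M)"
    by (rule nn_integral_liminf) measurable
  also have "\<dots> \<le> liminf (\<lambda>n::nat. ennreal C)"
    using U le by (intro Liminf_mono eventually_sequentiallyI[of n0])
      (auto simp: nn_integral_eq_integral intro!: ennreal_leI)
  also have "\<dots> = ennreal C"
    by (simp add: Liminf_const)
  finally have fin: "(\<integral>\<^sup>+\<omega>. ennreal (V \<omega>) \<partial>M) \<le> ennreal C" .
  show "integrable M V"
    using fin pos by (intro integrableI_nonneg) (auto simp: top.not_eq_extremum intro: le_less_trans)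
  then show "(\<integral>\<omega>. V \<omega> \<partial>M) \<le> C"
    using fin C pos by (simp add: nn_integral_eq_integral)
qed

definition trunc :: "nat \<Rightarrow> real \<Rightarrow> real" where
  "trunc n x = max (- real n) (min x (real n))"

lemma abs_trunc_le: "\<bar>trunc n x\<bar> \<le> \<bar>x\<bar>" and abs_trunc_le_nat: "\<bar>trunc n x\<bar> \<le> real n"
  by (auto simp: trunc_def)

lemma trunc_nonneg: "0 \<le> x \<Longrightarrow> 0 \<le> trunc n x"
  by (auto simp: trunc_def)

lemma trunc_measurable [measurable]: "trunc n \<in> borel_measurable borel"
  unfolding trunc_def by measurable

lemma bounded_trunc: "bounded (range (\<lambda>x. trunc n (g x)))"
  by (intro boundedI[of _ "real n"]) (auto simp: abs_trunc_le_nat)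

lemma trunc_tendsto: "(\<lambda>n. trunc n x) \<longlonglongrightarrow> x"
proof (rule tendsto_eventually)
  obtain n0 :: nat where "\<bar>x\<bar> \<le> real n0" using real_arch_simple by blast
  then show "\<forall>\<^sub>F n in sequentially. trunc n x = x"
    by (intro eventually_sequentiallyI[of n0]) (auto simp: trunc_def)
qed

lemma integral_trunc_tendsto:
  fixes g :: "'y \<Rightarrow> real"
  assumes "integrable P g"
  shows "(\<lambda>n. \<integral>y. trunc n (g y) \<partial>P) \<longlonglongrightarrow> (\<integral>y. g y \<partial>P)"
proof (rule integral_dominated_convergence)
  have [measurable]: "g \<in> borel_measurable P" using assms by auto
  show "g \<in> borel_measurable P" "\<And>n. (\<lambda>y. trunc n (g y)) \<in> borel_measurable P" by measurable
  show "integrable P (\<lambda>y. \<bar>g y\<bar>)" using assms by simp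
qed (auto simp: trunc_tendsto abs_trunc_le)

lemma integrable_trunc:
  fixes g :: "'y \<Rightarrow> real"
  assumes "integrable P g"
  shows "integrable P (\<lambda>y. trunc n (g y))"
proof -
  have [measurable]: "g \<in> borel_measurable P" using assms by auto
  show ?thesis
    by (rule Bochner_Integration.integrable_bound[OF assms]) (auto simp: abs_trunc_le)
qed

lemma abs_integral_trunc_le:
  fixes g :: "'y \<Rightarrow> real"
  assumes "integrable P g"
  shows "\<bar>\<integral>y. trunc n (g y) \<partial>P\<bar> \<le> (\<integral>y. \<bar>g y\<bar> \<partial>P)"
proof -
  have "\<bar>\<integral>y. trunc n (g y) \<partial>P\<bar> \<le> (\<integral>y. \<bar>trunc n (g y)\<bar> \<partial>P)"
    by (rule integral_abs_bound)
  also have "\<dots> \<le> (\<integral>y. \<bar>g y\<bar> \<partial>P)"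
    using assms by (intro integral_mono) (auto simp: abs_trunc_le integrable_trunc)
  finally show ?thesis .
qed

lemma kernel_transfer:
  fixes \<kappa> :: "'w \<Rightarrow> 'y measure" and V :: "'w \<Rightarrow> 'y" and g :: "'y \<Rightarrow> real"
  assumes "prob_space M" and V [measurable]: "V \<in> M \<rightarrow>\<^sub>M B"
    and meas: "\<And>g::'y \<Rightarrow> real. g \<in> borel_measurable B \<Longrightarrow> bounded (range g) \<Longrightarrow>
        (\<lambda>\<omega>. \<integral>y. g y \<partial>\<kappa> \<omega>) \<in> borel_measurable M"
    and law: "\<And>g::'y \<Rightarrow> real. g \<in> borel_measurable B \<Longrightarrow> bounded (range g) \<Longrightarrow>
        (\<integral>\<omega>. g (V \<omega>) \<partial>M) = (\<integral>\<omega>. (\<integral>y. g y \<partial>\<kappa> \<omega>) \<partial>M)"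
    and g [measurable]: "g \<in> borel_measurable B"
    and int: "\<And>\<omega>. \<omega> \<in> space M \<Longrightarrow> integrable (\<kappa> \<omega>) g"
    and H: "integrable M H" "\<And>\<omega>. \<omega> \<in> space M \<Longrightarrow> (\<integral>y. \<bar>g y\<bar> \<partial>\<kappa> \<omega>) \<le> H \<omega>"
  shows "integrable M (\<lambda>\<omega>. g (V \<omega>)) \<and> integrable M (\<lambda>\<omega>. \<integral>y. g y \<partial>\<kappa> \<omega>) \<and>
    (\<integral>\<omega>. g (V \<omega>) \<partial>M) = (\<integral>\<omega>. (\<integral>y. g y \<partial>\<kappa> \<omega>) \<partial>M)"
proof -
  interpret prob_space M by fact
  have m1 [measurable]: "(\<lambda>\<omega>. \<integral>y. trunc n (g y) \<partial>\<kappa> \<omega>) \<in> borel_measurable M" for n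
    by (rule meas) (auto simp: bounded_trunc)
  have m2: "(\<lambda>\<omega>. \<integral>y. trunc n \<bar>g y\<bar> \<partial>\<kappa> \<omega>) \<in> borel_measurable M" for n
    by (rule meas) (auto simp: bounded_trunc)
  have [measurable]: "(\<lambda>\<omega>. \<integral>y. g y \<partial>\<kappa> \<omega>) \<in> borel_measurable M"
    by (rule borel_measurable_LIMSEQ_metric[where f = "\<lambda>n \<omega>. \<integral>y. trunc n (g y) \<partial>\<kappa> \<omega>"])
      (auto intro!: m1 integral_trunc_tendsto int)
  have bnd: "\<bar>\<integral>y. trunc n (g y) \<partial>\<kappa> \<omega>\<bar> \<le> H \<omega>" if "\<omega> \<in> space M" for n \<omega>
    using abs_integral_trunc_le[OF int[OF that]] H(2)[OF that] by (rule order_trans)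
  have bnd2: "\<bar>\<integral>y. trunc n \<bar>g y\<bar> \<partial>\<kappa> \<omega>\<bar> \<le> H \<omega>" if "\<omega> \<in> space M" for n \<omega>
    using abs_integral_trunc_le[of "\<kappa> \<omega>" "\<lambda>y. \<bar>g y\<bar>"] int[OF that] H(2)[OF that] by (auto intro: order_trans)
  have bnd3: "\<bar>\<integral>y. g y \<partial>\<kappa> \<omega>\<bar> \<le> \<bar>H \<omega>\<bar>" if "\<omega> \<in> space M" for \<omega>
    using integral_abs_bound[of "\<kappa> \<omega>" g] H(2)[OF that] by linarith
  have "integrable M (\<lambda>\<omega>. \<bar>g (V \<omega>)\<bar>)"
  proof (rule Fatou_integrable)
    show "integrable M (\<lambda>\<omega>. trunc n \<bar>g (V \<omega>)\<bar>)" for n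
      by (rule integrable_const_bound[of _ "real n"]) (auto simp: abs_trunc_le_nat)
    show "0 \<le> trunc n \<bar>g (V \<omega>)\<bar>" for n \<omega> by (simp add: trunc_nonneg)
    show "AE \<omega> in M. (\<lambda>n. trunc n \<bar>g (V \<omega>)\<bar>) \<longlonglongrightarrow> \<bar>g (V \<omega>)\<bar>" by (simp add: trunc_tendsto)
    show "(\<integral>\<omega>. trunc n \<bar>g (V \<omega>)\<bar> \<partial>M) \<le> (\<integral>\<omega>. H \<omega> \<partial>M)" if "n \<ge> 0" for n
    proof -
      have "(\<integral>\<omega>. trunc n \<bar>g (V \<omega>)\<bar> \<partial>M) = (\<integral>\<omega>. (\<integral>y. trunc n \<bar>g y\<bar> \<partial>\<kappa> \<omega>) \<partial>M)"
        by (rule law) (auto simp: bounded_trunc)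
      also have "\<dots> \<le> (\<integral>\<omega>. H \<omega> \<partial>M)"
      proof (rule integral_mono)
        show "integrable M (\<lambda>\<omega>. \<integral>y. trunc n \<bar>g y\<bar> \<partial>\<kappa> \<omega>)"
          by (rule Bochner_Integration.integrable_bound[OF H(1) m2])
            (rule AE_I2, use bnd2[of _ n] in fastforce)
        show "(\<integral>y. trunc n \<bar>g y\<bar> \<partial>\<kappa> \<omega>) \<le> H \<omega>" if "\<omega> \<in> space M" for \<omega>
          using bnd2[OF that, of n] by linarith
      qed fact
      finally show ?thesis .
    qed
  qed measurable
  then have int1: "integrable M (\<lambda>\<omega>. g (V \<omega>))"
    by (subst (asm) integrable_abs_iff) auto
  have "(\<lambda>n. \<integral>\<omega>. trunc n (g (V \<omega>)) \<partial>M) \<longlonglongrightarrow> (\<integral>\<omega>. g (V \<omega>) \<partial>M)"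
    by (rule integral_trunc_tendsto[OF int1])
  moreover have "(\<integral>\<omega>. trunc n (g (V \<omega>)) \<partial>M) = (\<integral>\<omega>. (\<integral>y. trunc n (g y) \<partial>\<kappa> \<omega>) \<partial>M)" for n
    by (rule law) (auto simp: bounded_trunc)
  moreover have "(\<lambda>n. \<integral>\<omega>. (\<integral>y. trunc n (g y) \<partial>\<kappa> \<omega>) \<partial>M) \<longlonglongrightarrow> (\<integral>\<omega>. (\<integral>y. g y \<partial>\<kappa> \<omega>) \<partial>M)"
    by (rule integral_dominated_convergence[where w = H])
      (use H bnd in \<open>auto intro!: AE_I2 integral_trunc_tendsto int\<close>)
  ultimately have "(\<integral>\<omega>. g (V \<omega>) \<partial>M) = (\<integral>\<omega>. (\<integral>y. g y \<partial>\<kappa> \<omega>) \<partial>M)"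
    using LIMSEQ_unique by fastforce
  moreover have "integrable M (\<lambda>\<omega>. \<integral>y. g y \<partial>\<kappa> \<omega>)"
    by (rule Bochner_Integration.integrable_bound[OF H(1)])
      (auto intro!: AE_I2 bnd3)
  ultimately show ?thesis using int1 by simp
qed

lemma abs_mult_le_sum_squares: "\<bar>a * b\<bar> \<le> a\<^sup>2 + b\<^sup>2" for a b :: real
proof -
  have "2 * \<bar>a * b\<bar> \<le> a\<^sup>2 + b\<^sup>2" using sum_squares_bound[of "\<bar>a\<bar>" "\<bar>b\<bar>"] by (simp add: abs_mult)
  then show ?thesis by linarith
qed

lemma integrable_mult_of_squares:
  fixes u v :: "'w \<Rightarrow> real"
  assumes [measurable]: "u \<in> borel_measurable M" "v \<in> borel_measurable M"
    and "integrable M (\<lambda>\<omega>. (u \<omega>)\<^sup>2)" "integrable M (\<lambda>\<omega>. (v \<omega>)\<^sup>2)"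
  shows "integrable M (\<lambda>\<omega>. u \<omega> * v \<omega>)"
  by (rule Bochner_Integration.integrable_bound[OF Bochner_Integration.integrable_add[OF assms(3,4)]])
    (auto simp: abs_mult_le_sum_squares)

lemma kernel_transfer_pair:
  fixes \<kappa> \<kappa>' :: "'w \<Rightarrow> 'y measure" and V V' :: "'w \<Rightarrow> 'y" and g h :: "'y \<Rightarrow> real"
  assumes "prob_space M" and [measurable]: "V \<in> M \<rightarrow>\<^sub>M B" "V' \<in> M \<rightarrow>\<^sub>M B"
    and prob: "\<And>\<omega>. \<omega> \<in> space M \<Longrightarrow> prob_space (\<kappa> \<omega>)" "\<And>\<omega>. \<omega> \<in> space M \<Longrightarrow> prob_space (\<kappa>' \<omega>)"
    and meas: "\<And>g::'y \<Rightarrow> real. g \<in> borel_measurable B \<Longrightarrow> bounded (range g) \<Longrightarrow>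
        (\<lambda>\<omega>. \<integral>y. g y \<partial>\<kappa> \<omega>) \<in> borel_measurable M"
      "\<And>g::'y \<Rightarrow> real. g \<in> borel_measurable B \<Longrightarrow> bounded (range g) \<Longrightarrow>
        (\<lambda>\<omega>. \<integral>y. g y \<partial>\<kappa>' \<omega>) \<in> borel_measurable M"
    and law: "\<And>g h::'y \<Rightarrow> real. g \<in> borel_measurable B \<Longrightarrow> bounded (range g) \<Longrightarrow>
        h \<in> borel_measurable B \<Longrightarrow> bounded (range h) \<Longrightarrow>
        (\<integral>\<omega>. g (V \<omega>) * h (V' \<omega>) \<partial>M) = (\<integral>\<omega>. (\<integral>y. g y \<partial>\<kappa> \<omega>) * (\<integral>y. h y \<partial>\<kappa>' \<omega>) \<partial>M)"
    and [measurable]: "g \<in> borel_measurable B" "h \<in> borel_measurable B"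
    and sq: "integrable M (\<lambda>\<omega>. (g (V \<omega>))\<^sup>2)" "integrable M (\<lambda>\<omega>. (h (V' \<omega>))\<^sup>2)"
    and int: "\<And>\<omega>. \<omega> \<in> space M \<Longrightarrow> integrable (\<kappa> \<omega>) g" "\<And>\<omega>. \<omega> \<in> space M \<Longrightarrow> integrable (\<kappa>' \<omega>) h"
      "\<And>\<omega>. \<omega> \<in> space M \<Longrightarrow> integrable (\<kappa> \<omega>) (\<lambda>y. (g y)\<^sup>2)"
      "\<And>\<omega>. \<omega> \<in> space M \<Longrightarrow> integrable (\<kappa>' \<omega>) (\<lambda>y. (h y)\<^sup>2)"
    and H: "integrable M (\<lambda>\<omega>. \<integral>y. (g y)\<^sup>2 \<partial>\<kappa> \<omega>)" "integrable M (\<lambda>\<omega>. \<integral>y. (h y)\<^sup>2 \<partial>\<kappa>' \<omega>)"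
  shows "(\<integral>\<omega>. g (V \<omega>) * h (V' \<omega>) \<partial>M) = (\<integral>\<omega>. (\<integral>y. g y \<partial>\<kappa> \<omega>) * (\<integral>y. h y \<partial>\<kappa>' \<omega>) \<partial>M)"
proof -
  interpret prob_space M by fact
  have m1 [measurable]: "(\<lambda>\<omega>. \<integral>y. trunc n (g y) \<partial>\<kappa> \<omega>) \<in> borel_measurable M" for n
    by (rule meas) (auto simp: bounded_trunc)
  have m2 [measurable]: "(\<lambda>\<omega>. \<integral>y. trunc n (h y) \<partial>\<kappa>' \<omega>) \<in> borel_measurable M" for n
    by (rule meas) (auto simp: bounded_trunc)
  have [measurable]: "(\<lambda>\<omega>. \<integral>y. g y \<partial>\<kappa> \<omega>) \<in> borel_measurable M"
    by (rule borel_measurable_LIMSEQ_metric[where f = "\<lambda>n \<omega>. \<integral>y. trunc n (g y) \<partial>\<kappa> \<omega>"])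
      (auto intro!: m1 integral_trunc_tendsto int)
  have [measurable]: "(\<lambda>\<omega>. \<integral>y. h y \<partial>\<kappa>' \<omega>) \<in> borel_measurable M"
    by (rule borel_measurable_LIMSEQ_metric[where f = "\<lambda>n \<omega>. \<integral>y. trunc n (h y) \<partial>\<kappa>' \<omega>"])
      (auto intro!: m2 integral_trunc_tendsto int)
  have jen: "(\<integral>y. trunc n (g y) \<partial>P)\<^sup>2 \<le> (\<integral>y. (g y)\<^sup>2 \<partial>P)"
    if "prob_space P" "integrable P g" "integrable P (\<lambda>y. (g y)\<^sup>2)" for P n and g :: "'y \<Rightarrow> real"
  proof -
    interpret P: prob_space P by fact
    have le: "(trunc n x)\<^sup>2 \<le> x\<^sup>2" for x using abs_trunc_le[of n x] abs_le_square_iff by blast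
    have sq: "integrable P (\<lambda>y. (trunc n (g y))\<^sup>2)"
      by (rule Bochner_Integration.integrable_bound[OF that(3)])
        (use that(2) in \<open>auto simp: le intro!: borel_measurable_power borel_measurable_integrable integrable_trunc\<close>)
    have "(\<integral>y. trunc n (g y) \<partial>P)\<^sup>2 \<le> (\<integral>y. (trunc n (g y))\<^sup>2 \<partial>P)"
      using P.variance_positive[of "\<lambda>y. trunc n (g y)"] P.variance_eq[OF integrable_trunc[OF that(2)] sq]
      by simp
    also have "\<dots> \<le> (\<integral>y. (g y)\<^sup>2 \<partial>P)" using sq that(3) le by (intro integral_mono)
    finally show ?thesis .
  qed
  have "(\<lambda>n. \<integral>\<omega>. trunc n (g (V \<omega>)) * trunc n (h (V' \<omega>)) \<partial>M) \<longlonglongrightarrow> (\<integral>\<omega>. g (V \<omega>) * h (V' \<omega>) \<partial>M)"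
  proof (rule integral_dominated_convergence[where w = "\<lambda>\<omega>. (g (V \<omega>))\<^sup>2 + (h (V' \<omega>))\<^sup>2"])
    show "AE x in M. norm (trunc n (g (V x)) * trunc n (h (V' x))) \<le> (g (V x))\<^sup>2 + (h (V' x))\<^sup>2" for n
    proof (rule AE_I2)
      fix x
      have "norm (trunc n (g (V x)) * trunc n (h (V' x))) \<le> \<bar>g (V x) * h (V' x)\<bar>"
        by (auto simp: abs_mult intro!: mult_mono abs_trunc_le)
      then show "norm (trunc n (g (V x)) * trunc n (h (V' x))) \<le> (g (V x))\<^sup>2 + (h (V' x))\<^sup>2"
        using abs_mult_le_sum_squares order_trans by blast
    qed
  qed (use sq in \<open>auto intro!: tendsto_mult trunc_tendsto\<close>)
  moreover have "(\<integral>\<omega>. trunc n (g (V \<omega>)) * trunc n (h (V' \<omega>)) \<partial>M)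
      = (\<integral>\<omega>. (\<integral>y. trunc n (g y) \<partial>\<kappa> \<omega>) * (\<integral>y. trunc n (h y) \<partial>\<kappa>' \<omega>) \<partial>M)" for n
    by (rule law) (auto simp: bounded_trunc)
  moreover have "(\<lambda>n. \<integral>\<omega>. (\<integral>y. trunc n (g y) \<partial>\<kappa> \<omega>) * (\<integral>y. trunc n (h y) \<partial>\<kappa>' \<omega>) \<partial>M)
      \<longlonglongrightarrow> (\<integral>\<omega>. (\<integral>y. g y \<partial>\<kappa> \<omega>) * (\<integral>y. h y \<partial>\<kappa>' \<omega>) \<partial>M)"
  proof (rule integral_dominated_convergence
      [where w = "\<lambda>\<omega>. (\<integral>y. (g y)\<^sup>2 \<partial>\<kappa> \<omega>) + (\<integral>y. (h y)\<^sup>2 \<partial>\<kappa>' \<omega>)"])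
    show "AE \<omega> in M. norm ((\<integral>y. trunc n (g y) \<partial>\<kappa> \<omega>) * (\<integral>y. trunc n (h y) \<partial>\<kappa>' \<omega>))
        \<le> (\<integral>y. (g y)\<^sup>2 \<partial>\<kappa> \<omega>) + (\<integral>y. (h y)\<^sup>2 \<partial>\<kappa>' \<omega>)" for n
    proof (rule AE_I2)
      fix \<omega> assume \<omega>: "\<omega> \<in> space M"
      show "norm ((\<integral>y. trunc n (g y) \<partial>\<kappa> \<omega>) * (\<integral>y. trunc n (h y) \<partial>\<kappa>' \<omega>))
          \<le> (\<integral>y. (g y)\<^sup>2 \<partial>\<kappa> \<omega>) + (\<integral>y. (h y)\<^sup>2 \<partial>\<kappa>' \<omega>)"
        using abs_mult_le_sum_squares[of "\<integral>y. trunc n (g y) \<partial>\<kappa> \<omega>" "\<integral>y. trunc n (h y) \<partial>\<kappa>' \<omega>"]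
          jen[OF prob(1)[OF \<omega>] int(1,3)[OF \<omega>], of n] jen[OF prob(2)[OF \<omega>] int(2,4)[OF \<omega>], of n] by simp
    qed
  qed (use H int in \<open>auto intro!: tendsto_mult integral_trunc_tendsto\<close>)
  ultimately show ?thesis using LIMSEQ_unique by fastforce
qed

section \<open>Kernels on the state space with cemetery\<close>

lemma None_in_bar: "{None} \<in> sets bar"
  unfolding bar_def by (subst sets_measure_of) auto

lemma range_Some_in_bar: "range Some \<in> sets (bar :: 'a::topological_space option measure)"
  using Some_image_bar[of UNIV] by simp

lemma Some_measurable [measurable]: "Some \<in> borel \<rightarrow>\<^sub>M (bar :: 'a::topological_space option measure)"
  unfolding bar_def
proof (rule measurable_measure_of)
  fix A :: "'a option set" assume "A \<in> insert {None} ((`) Some ` sets borel)"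
  then consider "A = {None}" | B where "A = Some ` B" "B \<in> sets borel" by blast
  then show "Some -` A \<inter> space borel \<in> sets borel"
  proof cases
    case 1
    then have "Some -` A = {}" by auto
    then show ?thesis by simp
  next
    case (2 B)
    then have "Some -` A = B" by auto
    then show ?thesis using 2 by simp
  qed
qed auto

lemma pred_alive_measurable [measurable]:
  "Measurable.pred bar (\<lambda>y. y = (None :: 'a::topological_space option))"
  using None_in_bar by (simp add: pred_def)

definition ext :: "('a \<Rightarrow> real) \<Rightarrow> 'a option \<Rightarrow> real" where
  "ext g y = (case y of None \<Rightarrow> 0 | Some x \<Rightarrow> g x)"

lemma ext_simps [simp]: "ext g None = 0" "ext g (Some x) = g x"
  by (auto simp: ext_def)

lemma ext_measurable [measurable]:
  fixes g :: "'a::metric_space \<Rightarrow> real"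
  assumes [measurable]: "g \<in> borel_measurable borel"
  shows "ext g \<in> borel_measurable bar"
proof -
  have [measurable]: "the \<in> (bar :: 'a option measure) \<rightarrow>\<^sub>M borel" by (rule the_measurable_bar)
  have "(\<lambda>y. if y = None then 0 else g (the y)) \<in> borel_measurable bar" by measurable
  also have "(\<lambda>y. if y = None then 0 else g (the y)) = ext g" by (auto simp: ext_def split: option.split)
  finally show ?thesis .
qed

lemma ext_power2: "(ext g y)\<^sup>2 = ext (\<lambda>x. (g x)\<^sup>2) y"
  by (cases y) auto

definition daughter :: "bool \<Rightarrow> 'a option \<times> 'a option \<times> 'a option \<Rightarrow> 'a option" where
  "daughter \<delta> u = (if \<delta> then snd (snd u) else fst (snd u))"

lemma daughter_measurable [measurable]: "daughter \<delta> \<in> bar3 \<rightarrow>\<^sub>M bar"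
  unfolding daughter_def by (cases \<delta>) simp_all

lemma daughter_triple: "daughter \<delta> (triple X i \<omega>) = X (i @ [\<delta>]) \<omega>"
  by (simp add: daughter_def triple_def)

lemma alive_daughter_sets: "{u. daughter \<delta> u \<noteq> None} \<in> sets (bar3 :: ('a::metric_space option \<times> _) measure)"
proof -
  have "Measurable.pred (bar3 :: ('a option \<times> _) measure) (\<lambda>u. daughter \<delta> u \<noteq> None)"
    by measurable
  then show ?thesis by (simp add: pred_def space_pair_measure del: not_None_eq)
qed

lemma fst_triple: "fst (triple X i \<omega>) = X i \<omega>"
  by (simp add: triple_def)

definition triple_kernel :: "('a::metric_space) bkernel \<Rightarrow> 'a option \<Rightarrow> ('a option \<times> 'a option \<times> 'a option) measure"
  where "triple_kernel K x = distr (K x) bar3 (Pair x)"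

lemma sets_triple_kernel [simp, measurable_cong]: "sets (triple_kernel K x) = sets bar3"
  by (simp add: triple_kernel_def)

lemma space_triple_kernel [simp]: "space (triple_kernel K x) = UNIV"
  using sets_eq_imp_space_eq[OF sets_triple_kernel] by (simp add: space_pair_measure)

locale branching_kernel =
  fixes K :: "('a::metric_space) bkernel" and p10 p0 p1 m :: real
  assumes cemetery: "cemetery_kernel K"
    and homogeneous: "spatially_homogeneous K p10 p0 p1"
    and m_eq: "m = mean_daughters p10 p0 p1"
    and m_gt_1: "m > 1"
begin

lemma sets_K [simp, measurable_cong]: "sets (K x) = sets bar2"
  by (rule sets_cemetery_kernel[OF cemetery])

lemma space_K [simp]: "space (K x) = UNIV"
  using sets_eq_imp_space_eq[OF sets_K] by (simp add: space_pair_measure)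

lemma K_measurable: "K \<in> bar \<rightarrow>\<^sub>M prob_algebra bar2"
  using cemetery by (simp add: cemetery_kernel_def)

lemma prob_space_K: "prob_space (K x)"
  using measurable_space[OF K_measurable, of x] by (simp add: space_prob_algebra)

lemma prob_space_triple_kernel: "prob_space (triple_kernel K x)"
  unfolding triple_kernel_def by (rule prob_space.prob_space_distr[OF prob_space_K]) simp

lemma triple_kernel_measurable [measurable]: "triple_kernel K \<in> bar \<rightarrow>\<^sub>M subprob_algebra bar3"
  unfolding triple_kernel_def
  by (rule measurable_distr2[where M = bar2]) (auto intro: measurable_prob_algebraD[OF K_measurable])

lemma kapp_eq: 
  assumes "g \<in> borel_measurable bar3"
  shows "kapp K g x = (\<integral>u. g u \<partial>triple_kernel K x)"
  unfolding kapp_def triple_kernel_def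
  by (subst integral_distr) (use assms in \<open>auto simp: split_beta'\<close>)

lemma kapp_exists_iff:
  assumes "g \<in> borel_measurable bar3"
  shows "kapp_exists K g \<longleftrightarrow> (\<forall>x. integrable (triple_kernel K x) g)"
  unfolding kapp_exists_def triple_kernel_def
  by (subst integrable_distr_eq) (use assms in \<open>auto simp: split_beta'\<close>)

lemma kapp_measurable [measurable]:
  assumes [measurable]: "g \<in> borel_measurable bar3"
  shows "kapp K g \<in> borel_measurable bar"
proof -
  have "(\<lambda>x. \<integral>u. g u \<partial>triple_kernel K x) \<in> borel_measurable bar"
    by (rule measurable_compose[OF triple_kernel_measurable integral_measurable_subprob_algebra]) fact
  then show ?thesis using kapp_eq[OF assms] by (simp cong: measurable_cong)
qed

lemma AE_triple_kernel_fst: "AE u in triple_kernel K x. fst u = x"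
proof -
  have [measurable]: "{x} \<in> sets (bar :: 'a option measure)"
    using None_in_bar Some_image_bar[of "{the x}"] by (cases x) auto
  have "{u. fst u = x} = fst -` {x} \<inter> space bar3" by (auto simp: space_pair_measure)
  also have "\<dots> \<in> sets (bar3 :: ('a option \<times> 'a option \<times> 'a option) measure)" by measurable
  finally show ?thesis
    unfolding triple_kernel_def by (subst AE_distr_iff) (auto simp: space_pair_measure)
qed

lemma AE_K_None: "AE u in triple_kernel K None. u = (None, None, None)"
proof -
  interpret prob_space "K None" by (rule prob_space_K)
  have "measure (K None) {(None, None)} = 1" using cemetery by (simp add: cemetery_kernel_def)
  then have "AE u in K None. u \<in> {(None, None)}" by (rule AE_prob_1)
  moreover have "{u. u = (None, None, None)} \<in> sets bar3"
  proof -
    have "{u. u = (None, None, None)} = {None} \<times> {None} \<times> {None}" by auto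
    also have "\<dots> \<in> sets bar3" by (intro pair_measureI None_in_bar)
    finally show ?thesis .
  qed
  ultimately show ?thesis
    unfolding triple_kernel_def by (subst AE_distr_iff) (auto simp: space_pair_measure)
qed

lemma triple_kernel_None:
  fixes g :: "_ \<Rightarrow> real"
  assumes [measurable]: "g \<in> borel_measurable bar3"
  shows "integrable (triple_kernel K None) g" "(\<integral>u. g u \<partial>triple_kernel K None) = g (None, None, None)"
proof -
  interpret prob_space "triple_kernel K None" by (rule prob_space_triple_kernel)
  show "integrable (triple_kernel K None) g"
    by (rule integrable_const_bound[of _ "\<bar>g (None, None, None)\<bar>"]) (use AE_K_None in auto)
  have "(\<integral>u. g u \<partial>triple_kernel K None) = (\<integral>u. g (None, None, None) \<partial>triple_kernel K None)"
    by (rule integral_cong_AE) (use AE_K_None in auto)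
  then show "(\<integral>u. g u \<partial>triple_kernel K None) = g (None, None, None)"
    using prob_space by simp
qed

lemma triple_kernel_bounded:
  fixes g :: "_ \<Rightarrow> real"
  assumes [measurable]: "g \<in> borel_measurable bar3" and "\<And>u. \<bar>g u\<bar> \<le> C"
  shows "integrable (triple_kernel K x) g"
proof -
  interpret prob_space "triple_kernel K x" by (rule prob_space_triple_kernel)
  show ?thesis by (rule integrable_const_bound[of _ C]) (use assms(2) in auto)
qed

lemma marg_kernel_eq:
  "marg_kernel K \<delta> x = distr (restrict_space (triple_kernel K (Some x)) {u. daughter \<delta> u \<noteq> None}) borel
     (\<lambda>u. the (daughter \<delta> u))" (is "_ = distr ?R borel _")
proof (rule measure_eqI)
  have the [measurable]: "the \<in> (bar :: 'a option measure) \<rightarrow>\<^sub>M borel" by (rule the_measurable_bar)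
  have A: "{u. daughter \<delta> u \<noteq> None} \<in> sets (triple_kernel K (Some x))"
    using alive_daughter_sets by simp
  show s: "sets (marg_kernel K \<delta> x) = sets (distr ?R borel (\<lambda>u. the (daughter \<delta> u)))"
    unfolding marg_kernel_def using sets.sigma_sets_eq[of "borel :: 'a measure"] by simp
  fix B assume "B \<in> sets (marg_kernel K \<delta> x)"
  then have B [measurable]: "B \<in> sets borel" by (simp add: s)
  have m: "(\<lambda>u. the (daughter \<delta> u)) \<in> ?R \<rightarrow>\<^sub>M borel"
    by (rule measurable_restrict_space1) measurable
  have "emeasure (distr ?R borel (\<lambda>u. the (daughter \<delta> u))) B
      = emeasure (triple_kernel K (Some x)) {u. daughter \<delta> u \<in> Some ` B}"
    using A by (subst emeasure_distr[OF m B], subst emeasure_restrict_space)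
      (auto simp: space_restrict_space intro!: arg_cong2[where f = emeasure])
  also have "\<dots> = emeasure (K (Some x)) (Pair (Some x) -` {u. daughter \<delta> u \<in> Some ` B} \<inter> space (K (Some x)))"
    unfolding triple_kernel_def
  proof (rule emeasure_distr)
    have "daughter \<delta> -` (Some ` B) \<inter> space bar3 \<in> sets bar3"
      by (rule measurable_sets[OF daughter_measurable Some_image_bar[OF B]])
    then show "{u. daughter \<delta> u \<in> Some ` B} \<in> sets bar3" by (simp add: space_pair_measure vimage_def)
  qed simp
  also have "Pair (Some x) -` {u. daughter \<delta> u \<in> Some ` B} \<inter> space (K (Some x))
      = (if \<delta> then UNIV \<times> Some ` B else Some ` B \<times> UNIV)"
    by (auto simp: daughter_def)
  finally show "emeasure (marg_kernel K \<delta> x) B = emeasure (distr ?R borel (\<lambda>u. the (daughter \<delta> u))) B"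
    using emeasure_marg_kernel[OF cemetery B] by simp
qed

lemma marg_kernel_integral:
  assumes [measurable]: "g \<in> borel_measurable borel"
  shows "integrable (marg_kernel K \<delta> x) g \<longleftrightarrow> integrable (triple_kernel K (Some x)) (\<lambda>u. ext g (daughter \<delta> u))"
    and "apply_kernel (marg_kernel K \<delta>) g x = kapp K (\<lambda>u. ext g (daughter \<delta> u)) (Some x)"
proof -
  have [measurable]: "the \<in> (bar :: 'a option measure) \<rightarrow>\<^sub>M borel" by (rule the_measurable_bar)
  have A: "{u. daughter \<delta> u \<noteq> None} \<in> sets (triple_kernel K (Some x))"
    using alive_daughter_sets by simp
  have m: "(\<lambda>u. the (daughter \<delta> u)) \<in> restrict_space (triple_kernel K (Some x)) {u. daughter \<delta> u \<noteq> None} \<rightarrow>\<^sub>M borel"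
    by (rule measurable_restrict_space1) measurable
  have e: "indicator {u. daughter \<delta> u \<noteq> None} u *\<^sub>R g (the (daughter \<delta> u)) = ext g (daughter \<delta> u)" for u
    by (cases "daughter \<delta> u") auto
  show "integrable (marg_kernel K \<delta> x) g \<longleftrightarrow> integrable (triple_kernel K (Some x)) (\<lambda>u. ext g (daughter \<delta> u))"
    unfolding marg_kernel_eq using A
    by (simp add: integrable_distr_eq[OF m] integrable_restrict_space e del: real_scaleR_def not_None_eq)
  have "apply_kernel (marg_kernel K \<delta>) g x = (\<integral>u. ext g (daughter \<delta> u) \<partial>triple_kernel K (Some x))"
    unfolding apply_kernel_def marg_kernel_eq using A by (simp add: integral_distr[OF m] integral_restrict_space e del: real_scaleR_def not_None_eq)
  then show "apply_kernel (marg_kernel K \<delta>) g x = kapp K (\<lambda>u. ext g (daughter \<delta> u)) (Some x)"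
    by (simp add: kapp_eq)
qed

lemma sets_marg_kernel [simp, measurable_cong]: "sets (marg_kernel K \<delta> x) = sets borel"
  by (simp add: marg_kernel_eq)

lemma sets_aux_kernel [simp, measurable_cong]: "sets (aux_kernel K m x) = sets (borel :: 'a measure)"
  unfolding aux_kernel_def using sets.sigma_sets_eq[of "borel :: 'a measure"] by simp

lemma nn_integral_aux_kernel:
  fixes g :: "'a \<Rightarrow> ennreal"
  assumes "g \<in> borel_measurable borel"
  shows "(\<integral>\<^sup>+y. g y \<partial>aux_kernel K m x) =
    ennreal (1 / m) * ((\<integral>\<^sup>+y. g y \<partial>marg_kernel K False x) + (\<integral>\<^sup>+y. g y \<partial>marg_kernel K True x))"
  using assms
proof (induction rule: borel_measurable_induct)
  case (cong f g) then show ?case by simp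
next
  case (set A) then show ?case by (simp add: emeasure_aux_kernel)
next
  case (mult u c) then show ?case by (simp add: nn_integral_cmult distrib_left mult.left_commute mult.assoc)
next
  case (add u v) then show ?case by (simp add: nn_integral_add distrib_left algebra_simps)
next
  case (seq U)
  have *: "(\<integral>\<^sup>+y. (SUP i. U i) y \<partial>P) = (SUP i. \<integral>\<^sup>+y. U i y \<partial>P)" if "sets P = sets borel" for P
    using seq.hyps that by (subst SUP_apply, subst nn_integral_monotone_convergence_SUP)
      (auto cong: measurable_cong_sets)
  have inc: "incseq (\<lambda>i. \<integral>\<^sup>+y. U i y \<partial>P)" for P
    using seq.hyps by (auto simp: incseq_def le_fun_def intro!: nn_integral_mono)
  show ?case
    unfolding *[OF sets_aux_kernel] *[OF sets_marg_kernel] seq.IH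
    by (simp add: SUP_mult_left_ennreal ennreal_SUP_add[symmetric] inc)
qed

lemma aux_kernel_integral:
  assumes [measurable]: "g \<in> borel_measurable borel"
    and int: "\<And>\<delta>. integrable (marg_kernel K \<delta> x) g"
  shows "integrable (aux_kernel K m x) g"
    and "apply_kernel (aux_kernel K m) g x =
      (apply_kernel (marg_kernel K False) g x + apply_kernel (marg_kernel K True) g x) / m"
proof -
  have m: "m > 0" using m_gt_1 by simp
  have fin: "(\<integral>\<^sup>+y. ennreal (g y) \<partial>marg_kernel K \<delta> x) < \<infinity>" "(\<integral>\<^sup>+y. ennreal (- g y) \<partial>marg_kernel K \<delta> x) < \<infinity>"
    for \<delta> using int[of \<delta>] unfolding real_integrable_def by (auto simp: less_top)
  show i: "integrable (aux_kernel K m x) g"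
    unfolding real_integrable_def using fin
    by (auto simp: nn_integral_aux_kernel ennreal_mult_eq_top_iff less_top)
  have c: "enn2real (ennreal (1 / m) * (a + b)) = (enn2real a + enn2real b) / m" if "a < \<infinity>" "b < \<infinity>" for a b
    using that m by (simp add: enn2real_mult enn2real_plus less_top)
  show "apply_kernel (aux_kernel K m) g x =
      (apply_kernel (marg_kernel K False) g x + apply_kernel (marg_kernel K True) g x) / m"
    unfolding apply_kernel_def real_lebesgue_integral_def[OF i] real_lebesgue_integral_def[OF int]
    using fin by (simp add: nn_integral_aux_kernel c diff_divide_distrib add_divide_distrib)
qed

definition p_none :: real where "p_none = 1 - p10 - p0 - p1"

lemma flag_integral:
  fixes h :: "bool \<Rightarrow> bool \<Rightarrow> real"
  shows "(\<integral>u. h (daughter False u \<noteq> None) (daughter True u \<noteq> None) \<partial>triple_kernel K (Some x)) =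
    p10 * h True True + p0 * h True False + p1 * h False True + p_none * h False False"
proof -
  interpret prob_space "K (Some x)" by (rule prob_space_K)
  have ind: "integrable (K (Some x)) (indicat_real (A \<times> B))" if "A \<in> sets bar" "B \<in> sets bar" for A B
    using that by (intro integrable_real_indicator) (auto simp: less_top[symmetric])
  note ind [simp] = ind[OF range_Some_in_bar range_Some_in_bar] ind[OF range_Some_in_bar None_in_bar]
    ind[OF None_in_bar range_Some_in_bar]
  have "(\<integral>u. h (daughter False u \<noteq> None) (daughter True u \<noteq> None) \<partial>triple_kernel K (Some x))
     = (\<integral>u. h (fst u \<noteq> None) (snd u \<noteq> None) \<partial>K (Some x))"
    unfolding triple_kernel_def
  proof (subst integral_distr)
    have "(\<lambda>u::'a option \<times> 'a option \<times> 'a option.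
        if daughter False u \<noteq> None then if daughter True u \<noteq> None then h True True else h True False
        else if daughter True u \<noteq> None then h False True else h False False) \<in> borel_measurable bar3"
      by measurable
    also have "(\<lambda>u::'a option \<times> 'a option \<times> 'a option.
        if daughter False u \<noteq> None then if daughter True u \<noteq> None then h True True else h True False
        else if daughter True u \<noteq> None then h False True else h False False)
      = (\<lambda>u. h (daughter False u \<noteq> None) (daughter True u \<noteq> None))" by (rule HOL.ext) simp
    finally show "(\<lambda>u. h (daughter False u \<noteq> None) (daughter True u \<noteq> None))
      \<in> borel_measurable (bar3 :: ('a option \<times> _) measure)" .
  qed (auto simp: daughter_def)
  also have "\<dots> = (\<integral>u. (h True True - h False False) * indicator (range Some \<times> range Some) u
      + (h True False - h False False) * indicator (range Some \<times> {None}) u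
      + (h False True - h False False) * indicator ({None} \<times> range Some) u + h False False \<partial>K (Some x))"
  proof (intro Bochner_Integration.integral_cong refl)
    fix u :: "'a option \<times> 'a option"
    obtain a b where "u = (a, b)" by (cases u)
    then show "h (fst u \<noteq> None) (snd u \<noteq> None) = (h True True - h False False) * indicator (range Some \<times> range Some) u
      + (h True False - h False False) * indicator (range Some \<times> {None}) u
      + (h False True - h False False) * indicator ({None} \<times> range Some) u + h False False"
      by (cases a; cases b) auto
  qed
  also have "\<dots> = (h True True - h False False) * p10 + (h True False - h False False) * p0
      + (h False True - h False False) * p1 + h False False"
    using homogeneous prob_space by (simp add: spatially_homogeneous_def)
  finally show ?thesis by (simp add: p_none_def algebra_simps)
qed

lemma offspring_nonneg: "p10 \<ge> 0" "p0 \<ge> 0" "p1 \<ge> 0" "p_none \<ge> 0"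
proof -
  show "p10 \<ge> 0" "p0 \<ge> 0" "p1 \<ge> 0"
    using homogeneous measure_nonneg unfolding spatially_homogeneous_def by metis+
  have "p_none = (\<integral>u. of_bool (\<not> (daughter False u \<noteq> None) \<and> \<not> (daughter True u \<noteq> None))
      \<partial>triple_kernel K (Some undefined))"
    using flag_integral[where h = "\<lambda>a b. of_bool (\<not> a \<and> \<not> b)" and x = undefined] by simp
  also have "\<dots> \<ge> 0"
    by (rule Bochner_Integration.integral_nonneg) simp
  finally show "p_none \<ge> 0" .
qed

lemma marg_kernel_const:
  "apply_kernel (marg_kernel K False) (\<lambda>_. c) x + apply_kernel (marg_kernel K True) (\<lambda>_. c) x = m * c"
proof -
  have *: "ext (\<lambda>_. c) y = (if y \<noteq> None then c else 0)" for y :: "'a option" by (cases y) auto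
  show ?thesis
    using flag_integral[where h = "\<lambda>a _. if a then c else 0" and x = x]
      flag_integral[where h = "\<lambda>_ b. if b then c else 0" and x = x]
    by (simp add: marg_kernel_integral kapp_eq * m_eq mean_daughters_def algebra_simps del: not_None_eq)
qed

end

section \<open>Moments of sums over a generation\<close>

lemma finite_gen [simp]: "finite (gen k)"
  using finite_lists_length_eq[of "UNIV :: bool set" k] by (simp add: gen_def)

lemma gen_0: "gen 0 = {[]}"
  by (auto simp: gen_def)

lemma bij_betw_gen_Suc: "bij_betw (\<lambda>(i, \<delta>). i @ [\<delta>]) (gen n \<times> UNIV) (gen (Suc n))"
proof (rule bij_betwI')
  fix j :: node assume "j \<in> gen (Suc n)"
  then have "length j = Suc n" by (simp add: gen_def)
  then have "j = butlast j @ [last j]" "length (butlast j) = n"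
    by (metis append_butlast_last_id length_0_conv nat.distinct(1), simp)
  then show "\<exists>p\<in>gen n \<times> UNIV. j = (\<lambda>(i, \<delta>). i @ [\<delta>]) p"
    by (intro bexI[of _ "(butlast j, last j)"]) (auto simp: gen_def)
qed (auto simp: gen_def)

lemma sum_gen_Suc:
  "(\<Sum>j\<in>gen (Suc n). a j) = (\<Sum>i\<in>gen n. a (i @ [False]) + a (i @ [True]))" for a :: "node \<Rightarrow> real"
proof -
  have "(\<Sum>j\<in>gen (Suc n). a j) = (\<Sum>p\<in>gen n \<times> UNIV. a ((\<lambda>(i, \<delta>). i @ [\<delta>]) p))"
    by (rule sum.reindex_bij_betw[OF bij_betw_gen_Suc, symmetric])
  also have "\<dots> = (\<Sum>(i, \<delta>)\<in>gen n \<times> UNIV. a (i @ [\<delta>]))"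
    by (intro sum.cong) auto
  also have "\<dots> = (\<Sum>i\<in>gen n. \<Sum>\<delta>\<in>UNIV. a (i @ [\<delta>]))"
    by (simp add: sum.cartesian_product)
  finally show ?thesis by (simp add: UNIV_bool add.commute)
qed

lemma prod_gen_Suc:
  "(\<Prod>j\<in>gen (Suc n). a j) = (\<Prod>i\<in>gen n. a (i @ [False]) * a (i @ [True]))" for a :: "node \<Rightarrow> real"
proof -
  have "(\<Prod>j\<in>gen (Suc n). a j) = (\<Prod>p\<in>gen n \<times> UNIV. a ((\<lambda>(i, \<delta>). i @ [\<delta>]) p))"
    by (rule prod.reindex_bij_betw[OF bij_betw_gen_Suc, symmetric])
  also have "\<dots> = (\<Prod>(i, \<delta>)\<in>gen n \<times> UNIV. a (i @ [\<delta>]))"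
    by (intro prod.cong) auto
  also have "\<dots> = (\<Prod>i\<in>gen n. \<Prod>\<delta>\<in>UNIV. a (i @ [\<delta>]))"
    by (simp add: prod.cartesian_product)
  finally show ?thesis by (simp add: UNIV_bool mult.commute)
qed

lemma subalgebra_gen_sigma:
  assumes "\<And>j. X j \<in> M \<rightarrow>\<^sub>M N"
  shows "subalgebra M (gen_sigma M N J X)"
proof -
  have "sets (gen_sigma M N J X) = sigma_sets (space M) {X j -` A \<inter> space M | j A. j \<in> J \<and> A \<in> sets N}"
    unfolding gen_sigma_def by (rule sets_measure_of) auto
  also have "\<dots> \<subseteq> sets M"
    using assms by (intro sets.sigma_sets_subset) (auto intro: measurable_sets)
  finally show ?thesis
    by (auto simp: subalgebra_def gen_sigma_def space_measure_of_conv)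
qed

lemma integral_cond_exp_eq:
  fixes Z Z' :: "'w \<Rightarrow> real"
  assumes "prob_space M" "\<And>j. X j \<in> M \<rightarrow>\<^sub>M N"
    and "integrable M Z" and [measurable]: "Z' \<in> borel_measurable M"
    and eq: "AE \<omega> in M. real_cond_exp M (gen_sigma M N J X) Z \<omega> = Z' \<omega>"
  shows "(\<integral>\<omega>. Z \<omega> \<partial>M) = (\<integral>\<omega>. Z' \<omega> \<partial>M)"
proof -
  interpret prob_space M by fact
  interpret finite_measure_subalgebra M "gen_sigma M N J X"
    by unfold_locales (rule subalgebra_gen_sigma[OF assms(2)])
  have "(\<integral>\<omega>. Z \<omega> \<partial>M) = (\<integral>\<omega>. real_cond_exp M (gen_sigma M N J X) Z \<omega> \<partial>M)"
    using real_cond_exp_int(2)[OF assms(3)] by simp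
  also have "\<dots> = (\<integral>\<omega>. Z' \<omega> \<partial>M)"
    by (rule integral_cong_AE) (use eq in auto)
  finally show ?thesis .
qed

locale bmc = branching_kernel K p10 p0 p1 m
  for K :: "('a::metric_space) bkernel" and p10 p0 p1 m +
  fixes M :: "'w measure" and \<nu> :: "'a measure" and X :: "node \<Rightarrow> 'w \<Rightarrow> 'a option"
  assumes BMC: "BMC M K \<nu> X"
begin

sublocale prob_space M
  using BMC by (simp add: BMC_def)

lemma X_measurable [measurable]: "X i \<in> M \<rightarrow>\<^sub>M bar"
  using BMC by (simp add: BMC_def)

lemma triple_measurable [measurable]: "triple X i \<in> M \<rightarrow>\<^sub>M bar3"
  unfolding triple_def by measurable

lemma expectation_prod:
  fixes g :: "node \<Rightarrow> 'a option \<times> 'a option \<times> 'a option \<Rightarrow> real"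
  assumes g: "\<And>i. g i \<in> borel_measurable bar3" "\<And>i. bounded (range (g i))"
  shows "expectation (\<lambda>\<omega>. \<Prod>i\<in>gen k. g i (triple X i \<omega>)) = expectation (\<lambda>\<omega>. \<Prod>i\<in>gen k. kapp K (g i) (X i \<omega>))"
proof (rule integral_cond_exp_eq[OF prob_space_axioms X_measurable])
  note [measurable] = g(1)
  obtain C where C: "\<And>i u. \<bar>g i u\<bar> \<le> C i"
    using g(2) unfolding bounded_iff by (metis rangeI real_norm_def)
  show "integrable M (\<lambda>\<omega>. \<Prod>i\<in>gen k. g i (triple X i \<omega>))"
    by (rule integrable_const_bound[of _ "\<Prod>i\<in>gen k. C i"])
      (auto simp: abs_prod intro!: prod_mono C)
  show "(\<lambda>\<omega>. \<Prod>i\<in>gen k. kapp K (g i) (X i \<omega>)) \<in> borel_measurable M" by measurable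
  show "AE \<omega> in M. real_cond_exp M (gen_sigma M bar (tree_upto k) X) (\<lambda>\<omega>. \<Prod>i\<in>gen k. g i (triple X i \<omega>)) \<omega> =
      (\<Prod>i\<in>gen k. kapp K (g i) (X i \<omega>))"
  proof -
    have "\<forall>g :: node \<Rightarrow> 'a option \<times> 'a option \<times> 'a option \<Rightarrow> real.
        (\<forall>i. g i \<in> borel_measurable bar3 \<and> bounded (range (g i))) \<longrightarrow>
        (\<forall>k. AE \<omega> in M. real_cond_exp M (gen_sigma M bar (tree_upto k) X) (\<lambda>\<omega>. \<Prod>i\<in>gen k. g i (triple X i \<omega>)) \<omega>
           = (\<Prod>i\<in>gen k. kapp K (g i) (X i \<omega>)))"
      using BMC unfolding BMC_def by (elim conjE)
    from this[rule_format, of g k] show ?thesis using g by simp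
  qed
qed

lemma expectation_pair_bounded:
  fixes g h :: "'a option \<times> 'a option \<times> 'a option \<Rightarrow> real"
  assumes "i \<in> gen k" "j \<in> gen k" "i \<noteq> j"
    and "g \<in> borel_measurable bar3" "bounded (range g)" "h \<in> borel_measurable bar3" "bounded (range h)"
  shows "expectation (\<lambda>\<omega>. g (triple X i \<omega>) * h (triple X j \<omega>)) =
    expectation (\<lambda>\<omega>. kapp K g (X i \<omega>) * kapp K h (X j \<omega>))"
proof -
  define G where "G l = (if l = i then g else if l = j then h else (\<lambda>_. 1))" for l
  have one: "kapp K (\<lambda>_. 1) x = 1" for x
    using prob_space.prob_space[OF prob_space_triple_kernel] by (simp add: kapp_eq)
  have prod: "(\<Prod>l\<in>gen k. if l = i then a else if l = j then b else 1) = a * b" for a b :: real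
  proof -
    have "(\<Prod>l\<in>gen k. if l = i then a else if l = j then b else 1)
        = (\<Prod>l\<in>gen k. (if l = i then a else 1) * (if l = j then b else 1))"
      using assms(3) by (intro prod.cong) auto
    then show ?thesis using assms(1,2) by (simp add: prod.distrib)
  qed
  have "expectation (\<lambda>\<omega>. \<Prod>l\<in>gen k. G l (triple X l \<omega>)) = expectation (\<lambda>\<omega>. \<Prod>l\<in>gen k. kapp K (G l) (X l \<omega>))"
    by (rule expectation_prod) (use assms in \<open>auto simp: G_def\<close>)
  moreover have "(\<Prod>l\<in>gen k. G l (triple X l \<omega>)) = g (triple X i \<omega>) * h (triple X j \<omega>)" for \<omega>
    unfolding prod[symmetric] by (intro prod.cong) (auto simp: G_def)
  moreover have "(\<Prod>l\<in>gen k. kapp K (G l) (X l \<omega>)) = kapp K g (X i \<omega>) * kapp K h (X j \<omega>)" for \<omega>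
    unfolding prod[symmetric] by (intro prod.cong) (auto simp: G_def one)
  ultimately show ?thesis by simp
qed

lemma expectation_single_bounded:
  fixes g :: "'a option \<times> 'a option \<times> 'a option \<Rightarrow> real"
  assumes "g \<in> borel_measurable bar3" "bounded (range g)"
  shows "expectation (\<lambda>\<omega>. g (triple X i \<omega>)) = expectation (\<lambda>\<omega>. kapp K g (X i \<omega>))"
proof -
  define G where "G l = (if l = i then g else (\<lambda>_. 1))" for l
  define k where "k = length i"
  have i: "i \<in> gen k" by (simp add: gen_def k_def)
  have one: "kapp K (\<lambda>_. 1) x = 1" for x
    using prob_space.prob_space[OF prob_space_triple_kernel] by (simp add: kapp_eq)
  have prod: "(\<Prod>l\<in>gen k. if l = i then a else 1) = a" for a :: real
    using i by simp
  have "expectation (\<lambda>\<omega>. \<Prod>l\<in>gen k. G l (triple X l \<omega>)) = expectation (\<lambda>\<omega>. \<Prod>l\<in>gen k. kapp K (G l) (X l \<omega>))"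
    by (rule expectation_prod) (use assms in \<open>auto simp: G_def\<close>)
  moreover have "(\<Prod>l\<in>gen k. G l (triple X l \<omega>)) = g (triple X i \<omega>)" for \<omega>
    by (rule trans[OF prod.cong prod]) (auto simp: G_def)
  moreover have "(\<Prod>l\<in>gen k. kapp K (G l) (X l \<omega>)) = kapp K g (X i \<omega>)" for \<omega>
    by (rule trans[OF prod.cong prod]) (auto simp: G_def one)
  ultimately show ?thesis by simp
qed

lemma expectation_triple:
  assumes [measurable]: "g \<in> borel_measurable bar3"
    and int: "\<And>x. integrable (triple_kernel K x) g"
    and H: "integrable M H" "\<And>\<omega>. kapp K (\<lambda>u. \<bar>g u\<bar>) (X i \<omega>) \<le> H \<omega>"
  shows "integrable M (\<lambda>\<omega>. g (triple X i \<omega>))" "integrable M (\<lambda>\<omega>. kapp K g (X i \<omega>))"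
    "expectation (\<lambda>\<omega>. g (triple X i \<omega>)) = expectation (\<lambda>\<omega>. kapp K g (X i \<omega>))"
proof -
  have m: "(\<lambda>\<omega>. \<integral>u. g u \<partial>triple_kernel K (X i \<omega>)) \<in> borel_measurable M"
    if "g \<in> borel_measurable bar3" "bounded (range g)" for g :: "_ \<Rightarrow> real"
    using measurable_compose[OF X_measurable kapp_measurable[OF that(1)]] by (simp add: kapp_eq that)
  have l: "expectation (\<lambda>\<omega>. g (triple X i \<omega>)) = expectation (\<lambda>\<omega>. \<integral>u. g u \<partial>triple_kernel K (X i \<omega>))"
    if "g \<in> borel_measurable bar3" "bounded (range g)" for g :: "_ \<Rightarrow> real"
    using expectation_single_bounded[OF that] that by (simp add: kapp_eq)
  have H': "(\<integral>u. \<bar>g u\<bar> \<partial>triple_kernel K (X i \<omega>)) \<le> H \<omega>" for \<omega>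
    using H(2)[of \<omega>] by (simp add: kapp_eq)
  have T: "integrable M (\<lambda>\<omega>. g (triple X i \<omega>)) \<and> integrable M (\<lambda>\<omega>. \<integral>u. g u \<partial>triple_kernel K (X i \<omega>)) \<and>
    expectation (\<lambda>\<omega>. g (triple X i \<omega>)) = expectation (\<lambda>\<omega>. \<integral>u. g u \<partial>triple_kernel K (X i \<omega>))"
  proof (rule kernel_transfer[where \<kappa> = "\<lambda>\<omega>. triple_kernel K (X i \<omega>)" and V = "triple X i" and B = bar3
        and g = g and M = M and H = H])
    fix g :: "'a option \<times> 'a option \<times> 'a option \<Rightarrow> real"
    assume g: "g \<in> borel_measurable bar3" "bounded (range g)"
    show "(\<lambda>\<omega>. \<integral>u. g u \<partial>triple_kernel K (X i \<omega>)) \<in> borel_measurable M"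
      using m[OF g] .
    show "expectation (\<lambda>\<omega>. g (triple X i \<omega>)) = expectation (\<lambda>\<omega>. \<integral>u. g u \<partial>triple_kernel K (X i \<omega>))"
      using l[OF g] .
  qed (simp_all add: H(1) int H' prob_space_axioms)
  show "integrable M (\<lambda>\<omega>. g (triple X i \<omega>))" using T by blast
  show "integrable M (\<lambda>\<omega>. kapp K g (X i \<omega>))" using T by (simp add: kapp_eq)
  show "expectation (\<lambda>\<omega>. g (triple X i \<omega>)) = expectation (\<lambda>\<omega>. kapp K g (X i \<omega>))"
    using T by (simp add: kapp_eq)
qed

lemma kapp_power2_le:
  assumes [measurable]: "g \<in> borel_measurable bar3"
    and "integrable (triple_kernel K x) g" "integrable (triple_kernel K x) (\<lambda>u. (g u)\<^sup>2)"
  shows "(kapp K g x)\<^sup>2 \<le> kapp K (\<lambda>u. (g u)\<^sup>2) x"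
proof -
  interpret P: prob_space "triple_kernel K x" by (rule prob_space_triple_kernel)
  show ?thesis
    using P.variance_positive[of g] P.variance_eq[OF assms(2,3)] by (simp add: kapp_eq)
qed

lemma expectation_power2_sum:
  fixes g :: "'a option \<times> 'a option \<times> 'a option \<Rightarrow> real"
  assumes [measurable]: "g \<in> borel_measurable bar3"
    and int: "\<And>x. integrable (triple_kernel K x) g" "\<And>x. integrable (triple_kernel K x) (\<lambda>u. (g u)\<^sup>2)"
    and H: "\<And>i. i \<in> gen k \<Longrightarrow> integrable M (\<lambda>\<omega>. kapp K (\<lambda>u. (g u)\<^sup>2) (X i \<omega>))"
  shows "integrable M (\<lambda>\<omega>. (\<Sum>i\<in>gen k. g (triple X i \<omega>))\<^sup>2)" (is ?A)
    and "integrable M (\<lambda>\<omega>. (\<Sum>i\<in>gen k. kapp K g (X i \<omega>))\<^sup>2)" (is ?B)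
    and "expectation (\<lambda>\<omega>. (\<Sum>i\<in>gen k. g (triple X i \<omega>))\<^sup>2) =
      expectation (\<lambda>\<omega>. (\<Sum>i\<in>gen k. kapp K g (X i \<omega>))\<^sup>2) +
      (\<Sum>i\<in>gen k. expectation (\<lambda>\<omega>. kapp K (\<lambda>u. (g u)\<^sup>2) (X i \<omega>)) - expectation (\<lambda>\<omega>. (kapp K g (X i \<omega>))\<^sup>2))" (is ?C)
proof -
  let ?a = "\<lambda>i \<omega>. g (triple X i \<omega>)" and ?b = "\<lambda>i \<omega>. kapp K g (X i \<omega>)"
  have a2: "integrable M (\<lambda>\<omega>. (?a i \<omega>)\<^sup>2)"
    and ea2: "expectation (\<lambda>\<omega>. (?a i \<omega>)\<^sup>2) = expectation (\<lambda>\<omega>. kapp K (\<lambda>u. (g u)\<^sup>2) (X i \<omega>))" if "i \<in> gen k" for i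
    using expectation_triple[of "\<lambda>u. (g u)\<^sup>2" "\<lambda>\<omega>. kapp K (\<lambda>u. (g u)\<^sup>2) (X i \<omega>)" i] int(2) H[OF that] by simp_all
  have b2: "integrable M (\<lambda>\<omega>. (?b i \<omega>)\<^sup>2)" if "i \<in> gen k" for i
  proof (rule Bochner_Integration.integrable_bound[OF H[OF that]])
    show "AE \<omega> in M. norm ((?b i \<omega>)\<^sup>2) \<le> norm (kapp K (\<lambda>u. (g u)\<^sup>2) (X i \<omega>))"
      using kapp_power2_le[OF _ int] by (intro AE_I2) (simp add: order_trans[OF _ abs_ge_self])
  qed measurable
  have a: "integrable M (\<lambda>\<omega>. ?a i \<omega> * ?a j \<omega>)" if "i \<in> gen k" "j \<in> gen k" for i j
    by (rule integrable_mult_of_squares) (use a2 that in auto)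
  have b: "integrable M (\<lambda>\<omega>. ?b i \<omega> * ?b j \<omega>)" if "i \<in> gen k" "j \<in> gen k" for i j
    by (rule integrable_mult_of_squares) (use b2 that in auto)
  have ab: "expectation (\<lambda>\<omega>. ?a i \<omega> * ?a j \<omega>) = expectation (\<lambda>\<omega>. ?b i \<omega> * ?b j \<omega>)"
    if ij: "i \<in> gen k" "j \<in> gen k" "i \<noteq> j" for i j
  proof -
    have m: "(\<lambda>\<omega>. \<integral>u. g u \<partial>triple_kernel K (X i \<omega>)) \<in> borel_measurable M"
      if "g \<in> borel_measurable bar3" for g :: "_ \<Rightarrow> real" and i
      using measurable_compose[OF X_measurable kapp_measurable[OF that]] by (simp add: kapp_eq that)
    have "expectation (\<lambda>\<omega>. ?a i \<omega> * ?a j \<omega>) =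
        expectation (\<lambda>\<omega>. (\<integral>u. g u \<partial>triple_kernel K (X i \<omega>)) * (\<integral>u. g u \<partial>triple_kernel K (X j \<omega>)))"
    proof (rule kernel_transfer_pair[OF prob_space_axioms triple_measurable triple_measurable])
      show "expectation (\<lambda>\<omega>. g (triple X i \<omega>) * h (triple X j \<omega>)) =
          expectation (\<lambda>\<omega>. integral\<^sup>L (triple_kernel K (X i \<omega>)) g * integral\<^sup>L (triple_kernel K (X j \<omega>)) h)"
        if "g \<in> borel_measurable bar3" "bounded (range g)" "h \<in> borel_measurable bar3" "bounded (range h)"
        for g h :: "'a option \<times> 'a option \<times> 'a option \<Rightarrow> real"
        using expectation_pair_bounded[OF ij that] that by (simp add: kapp_eq)
    qed (use H[OF ij(1)] H[OF ij(2)] a2 ij int m in \<open>auto simp: kapp_eq prob_space_triple_kernel\<close>)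
    then show ?thesis by (simp add: kapp_eq)
  qed
  show ?A ?B
    unfolding power2_eq_square sum_product using a b by (auto intro!: Bochner_Integration.integrable_sum)
  have sa: "expectation (\<lambda>\<omega>. (\<Sum>i\<in>gen k. ?a i \<omega>)\<^sup>2) = (\<Sum>i\<in>gen k. \<Sum>j\<in>gen k. expectation (\<lambda>\<omega>. ?a i \<omega> * ?a j \<omega>))"
    unfolding power2_eq_square sum_product using a by (simp add: Bochner_Integration.integral_sum)
  have sb: "expectation (\<lambda>\<omega>. (\<Sum>i\<in>gen k. ?b i \<omega>)\<^sup>2) = (\<Sum>i\<in>gen k. \<Sum>j\<in>gen k. expectation (\<lambda>\<omega>. ?b i \<omega> * ?b j \<omega>))"
    unfolding power2_eq_square sum_product using b by (simp add: Bochner_Integration.integral_sum)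
  define d where "d i = expectation (\<lambda>\<omega>. kapp K (\<lambda>u. (g u)\<^sup>2) (X i \<omega>)) - expectation (\<lambda>\<omega>. (?b i \<omega>)\<^sup>2)" for i
  have "(\<Sum>i\<in>gen k. \<Sum>j\<in>gen k. expectation (\<lambda>\<omega>. ?a i \<omega> * ?a j \<omega>))
      = (\<Sum>i\<in>gen k. \<Sum>j\<in>gen k. expectation (\<lambda>\<omega>. ?b i \<omega> * ?b j \<omega>) + (if j = i then d i else 0))"
  proof (intro sum.cong refl)
    fix i j assume "i \<in> gen k" "j \<in> gen k"
    then show "expectation (\<lambda>\<omega>. ?a i \<omega> * ?a j \<omega>) = expectation (\<lambda>\<omega>. ?b i \<omega> * ?b j \<omega>) + (if j = i then d i else 0)"
      by (cases "j = i") (simp_all add: ab ea2 d_def flip: power2_eq_square)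
  qed
  also have "\<dots> = (\<Sum>i\<in>gen k. \<Sum>j\<in>gen k. expectation (\<lambda>\<omega>. ?b i \<omega> * ?b j \<omega>)) + (\<Sum>i\<in>gen k. d i)"
    by (simp add: sum.distrib)
  finally show ?C unfolding sa sb d_def .
qed

end

section \<open>The class of test functions and the auxiliary chain\<close>

locale bmc_class = bmc K p10 p0 p1 m M \<nu> X
  for K :: "('a::metric_space) bkernel" and p10 p0 p1 m and M :: "'w measure" and \<nu> and X +
  fixes \<mu> :: "'a measure" and F :: "('a \<Rightarrow> real) set" and N :: "'a \<Rightarrow> 'c measure" and Y :: "nat \<Rightarrow> 'c \<Rightarrow> 'a"
  assumes chain: "\<And>x. markov_chain (N x) (aux_kernel K m) (return borel x) Y"
    and admissible: "admissible_class K m \<nu> N Y \<mu> F"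
begin

abbreviation P :: "bool \<Rightarrow> ('a \<Rightarrow> real) \<Rightarrow> 'a \<Rightarrow> real" where
  "P \<delta> \<equiv> apply_kernel (marg_kernel K \<delta>)"

abbreviation Q :: "('a \<Rightarrow> real) \<Rightarrow> 'a \<Rightarrow> real" where
  "Q \<equiv> apply_kernel (aux_kernel K m)"

lemma F_measurable: "f \<in> F \<Longrightarrow> f \<in> borel_measurable borel"
  using admissible[unfolded admissible_class_def, THEN conjunct1]
  by blast

lemma F_add: "f \<in> F \<Longrightarrow> g \<in> F \<Longrightarrow> (\<lambda>x. f x + g x) \<in> F"
  using admissible[unfolded admissible_class_def, THEN conjunct2, THEN conjunct1]
  by blast

lemma F_scale: "f \<in> F \<Longrightarrow> (\<lambda>x. c * f x) \<in> F"
  using admissible[unfolded admissible_class_def, THEN conjunct2, THEN conjunct2, THEN conjunct1]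
  by blast

lemma F_const: "(\<lambda>x. c) \<in> F"
  using admissible[unfolded admissible_class_def, THEN conjunct2, THEN conjunct2, THEN conjunct2, THEN conjunct1]
  by blast

lemma F_square: "f \<in> F \<Longrightarrow> (\<lambda>x. (f x)\<^sup>2) \<in> F"
  using admissible[unfolded admissible_class_def, THEN conjunct2, THEN conjunct2, THEN conjunct2, THEN conjunct2, THEN conjunct1]
  by blast

lemma F_marg_integrable: "f \<in> F \<Longrightarrow> integrable (marg_kernel K \<delta> x) f"
  using admissible[unfolded admissible_class_def, THEN conjunct2, THEN conjunct2, THEN conjunct2, THEN conjunct2, THEN conjunct2, THEN conjunct2, THEN conjunct1]
  by blast

lemma F_marg: "f \<in> F \<Longrightarrow> P \<delta> f \<in> F"
  using admissible[unfolded admissible_class_def, THEN conjunct2, THEN conjunct2, THEN conjunct2, THEN conjunct2, THEN conjunct2, THEN conjunct2, THEN conjunct1]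
  by blast

lemma F_\<nu>: "f \<in> F \<Longrightarrow> integrable \<nu> f"
  using admissible[unfolded admissible_class_def, THEN conjunct2, THEN conjunct2, THEN conjunct2, THEN conjunct2, THEN conjunct2,
    THEN conjunct2, THEN conjunct2, THEN conjunct2, THEN conjunct2, THEN conjunct2, THEN conjunct2, THEN conjunct2]
  by blast

lemma F_\<mu>: "f \<in> F \<Longrightarrow> integrable \<mu> f"
  using admissible[unfolded admissible_class_def, THEN conjunct2, THEN conjunct2, THEN conjunct2, THEN conjunct2, THEN conjunct2,
    THEN conjunct2, THEN conjunct2, THEN conjunct2, THEN conjunct2, THEN conjunct1]
  by blast

lemma F_bound: "f \<in> F \<Longrightarrow> \<exists>g\<in>F. \<forall>r x. \<bar>(Q ^^ r) f x\<bar> \<le> g x"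
  using admissible[unfolded admissible_class_def, THEN conjunct2, THEN conjunct2, THEN conjunct2, THEN conjunct2, THEN conjunct2,
    THEN conjunct2, THEN conjunct2, THEN conjunct2, THEN conjunct2, THEN conjunct2, THEN conjunct2, THEN conjunct1]
  by blast

lemma F_limit: "f \<in> F \<Longrightarrow> (\<lambda>n. \<integral>\<omega>. f (Y n \<omega>) \<partial>N x) \<longlonglongrightarrow> (\<integral>y. f y \<partial>\<mu>)"
  using admissible[unfolded admissible_class_def, THEN conjunct2, THEN conjunct2, THEN conjunct2, THEN conjunct2, THEN conjunct2,
    THEN conjunct2, THEN conjunct2, THEN conjunct2, THEN conjunct2, THEN conjunct2, THEN conjunct1]
  by blast

lemma prob_space_\<mu>: "prob_space \<mu>"
  using admissible[unfolded admissible_class_def, THEN conjunct2, THEN conjunct2, THEN conjunct2, THEN conjunct2, THEN conjunct2,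
    THEN conjunct2, THEN conjunct2, THEN conjunct1]
  by blast

lemma F_diff_const: "f \<in> F \<Longrightarrow> (\<lambda>x. f x - c) \<in> F"
  using F_add[OF _ F_const[of "- c"]] by simp

lemma Q_eq: "f \<in> F \<Longrightarrow> Q f = (\<lambda>x. (1 / m) * (P False f x + P True f x))"
  by (rule HOL.ext) (simp add: aux_kernel_integral F_measurable F_marg_integrable)

lemma F_Q: "f \<in> F \<Longrightarrow> Q f \<in> F"
  unfolding Q_eq by (intro F_scale F_add F_marg)

lemma F_Q_funpow: "f \<in> F \<Longrightarrow> (Q ^^ n) f \<in> F"
  by (induction n) (auto intro: F_Q)

lemma F_aux_integrable: "f \<in> F \<Longrightarrow> integrable (aux_kernel K m x) f"
  by (simp add: aux_kernel_integral F_measurable F_marg_integrable)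

lemma aux_bounded:
  assumes [measurable]: "g \<in> borel_measurable borel" and "bounded (range g)"
  shows "Q g \<in> borel_measurable borel"
proof -
  obtain C where C: "\<And>x. \<bar>g x\<bar> \<le> C" using assms(2) by (auto simp: bounded_iff)
  have "\<bar>ext g y\<bar> \<le> \<bar>C\<bar>" for y
    using C[of "the y"] by (cases y) auto
  then have "integrable (marg_kernel K \<delta> x) g" for \<delta> x
    unfolding marg_kernel_integral(1)[OF assms(1)] by (intro triple_kernel_bounded[where C = "\<bar>C\<bar>"]) auto
  then have "Q g = (\<lambda>x. (kapp K (\<lambda>u. ext g (daughter False u)) (Some x) + kapp K (\<lambda>u. ext g (daughter True u)) (Some x)) / m)"
    by (intro HOL.ext) (simp add: aux_kernel_integral(2) marg_kernel_integral(2))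
  then show ?thesis by simp
qed

lemma chain_expectation:
  "f \<in> F \<Longrightarrow> integrable (N x) (\<lambda>\<omega>. f (Y n \<omega>)) \<and> (\<integral>\<omega>. f (Y n \<omega>) \<partial>N x) = (Q ^^ n) f x"
proof (induction n arbitrary: f)
  case 0
  have [measurable]: "Y 0 \<in> N x \<rightarrow>\<^sub>M borel" and d: "distr (N x) borel (Y 0) = return borel x"
    using chain[of x] by (auto simp: markov_chain_def)
  note [measurable] = F_measurable[OF 0]
  have "integrable (return borel x) f"
    by (rule integrableI_bounded) (simp_all add: nn_integral_return)
  then have "integrable (N x) (\<lambda>\<omega>. f (Y 0 \<omega>))"
    unfolding d[symmetric] by (subst (asm) integrable_distr_eq) auto
  moreover have "(\<integral>\<omega>. f (Y 0 \<omega>) \<partial>N x) = (\<integral>y. f y \<partial>return borel x)"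
    unfolding d[symmetric] by (rule integral_distr[symmetric]) auto
  ultimately show ?case by (simp add: integral_return)
next
  case (Suc n)
  have chn: "prob_space (N x)" "\<And>n. Y n \<in> N x \<rightarrow>\<^sub>M borel"
    using chain[of x] by (auto simp: markov_chain_def)
  interpret Nx: prob_space "N x" by (rule chn)
  note [measurable] = chn(2) F_measurable[OF Suc.prems]
  define G where "G = (\<lambda>x. 1 + (f x)\<^sup>2)"
  have G: "G \<in> F" unfolding G_def by (intro F_add F_const F_square Suc.prems)
  have "integrable (N x) (\<lambda>\<omega>. f (Y (Suc n) \<omega>)) \<and> integrable (N x) (\<lambda>\<omega>. \<integral>y. f y \<partial>aux_kernel K m (Y n \<omega>)) \<and>
      (\<integral>\<omega>. f (Y (Suc n) \<omega>) \<partial>N x) = (\<integral>\<omega>. \<integral>y. f y \<partial>aux_kernel K m (Y n \<omega>) \<partial>N x)"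
  proof (rule kernel_transfer[where M = "N x" and V = "Y (Suc n)" and \<kappa> = "\<lambda>\<omega>. aux_kernel K m (Y n \<omega>)"
        and B = borel and g = f and H = "\<lambda>\<omega>. Q G (Y n \<omega>)"])
    fix g :: "'a \<Rightarrow> real" assume g [measurable]: "g \<in> borel_measurable borel" and b: "bounded (range g)"
    have Qg: "(\<lambda>\<omega>. Q g (Y n \<omega>)) \<in> borel_measurable (N x)"
      using measurable_compose[OF chn(2) aux_bounded[OF g b]] .
    then show "(\<lambda>\<omega>. \<integral>y. g y \<partial>aux_kernel K m (Y n \<omega>)) \<in> borel_measurable (N x)"
      by (simp add: apply_kernel_def)
    obtain C where C: "\<And>x. \<bar>g x\<bar> \<le> C" using b by (auto simp: bounded_iff)
    have "(\<integral>\<omega>. g (Y (Suc n) \<omega>) \<partial>N x) = (\<integral>\<omega>. Q g (Y n \<omega>) \<partial>N x)"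
    proof (rule integral_cond_exp_eq[OF chn(1)])
      show "integrable (N x) (\<lambda>\<omega>. g (Y (Suc n) \<omega>))"
        by (rule Nx.integrable_const_bound[of _ C]) (auto simp: C)
      show "AE \<omega> in N x. real_cond_exp (N x) (gen_sigma (N x) borel {0..n} Y) (\<lambda>\<omega>. g (Y (Suc n) \<omega>)) \<omega> = Q g (Y n \<omega>)"
        using chain[of x] g b by (auto simp: markov_chain_def)
    qed (use Qg chn in auto)
    then show "(\<integral>\<omega>. g (Y (Suc n) \<omega>) \<partial>N x) = (\<integral>\<omega>. \<integral>y. g y \<partial>aux_kernel K m (Y n \<omega>) \<partial>N x)"
      by (simp add: apply_kernel_def)
  next
    show "integrable (N x) (\<lambda>\<omega>. Q G (Y n \<omega>))" using Suc.IH[OF F_Q[OF G]] by simp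
    show "(\<integral>y. \<bar>f y\<bar> \<partial>aux_kernel K m (Y n \<omega>)) \<le> Q G (Y n \<omega>)" for \<omega>
      unfolding apply_kernel_def
    proof (rule integral_mono)
      show "\<bar>f y\<bar> \<le> G y" for y
        using abs_mult_le_sum_squares[of "f y" 1] by (simp add: G_def)
    qed (use F_aux_integrable[OF G] F_aux_integrable[OF Suc.prems] in auto)
  qed (use chn F_aux_integrable[OF Suc.prems] in auto)
  then show ?case
    using Suc.IH[OF F_Q[OF Suc.prems]] by (simp add: funpow_Suc_right apply_kernel_def del: funpow.simps)
qed

lemma Q_funpow_tendsto: "f \<in> F \<Longrightarrow> (\<lambda>n. (Q ^^ n) f x) \<longlonglongrightarrow> (\<integral>y. f y \<partial>\<mu>)"
  using F_limit[of f x] chain_expectation[of f x] by simp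

lemma ext_daughter_kapp: "f \<in> F \<Longrightarrow> kapp K (\<lambda>u. ext f (daughter \<delta> u)) y = ext (P \<delta> f) y"
proof (cases y)
  case None
  assume "f \<in> F"
  then show ?thesis
    using None F_measurable by (simp add: kapp_eq triple_kernel_None daughter_def)
qed (simp add: marg_kernel_integral(2) F_measurable)

lemma ext_daughter_integrable: "f \<in> F \<Longrightarrow> integrable (triple_kernel K y) (\<lambda>u. ext f (daughter \<delta> u))"
proof (cases y)
  case None
  assume "f \<in> F"
  then show ?thesis
    using None F_measurable by (simp add: triple_kernel_None)
qed (use F_marg_integrable marg_kernel_integral(1) F_measurable in blast)

lemma X_child_expectation:
  assumes f: "f \<in> F" and IH: "\<And>g. g \<in> F \<Longrightarrow> integrable M (\<lambda>\<omega>. ext g (X i \<omega>))"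
  shows "integrable M (\<lambda>\<omega>. ext f (X (i @ [\<delta>]) \<omega>))"
    "expectation (\<lambda>\<omega>. ext f (X (i @ [\<delta>]) \<omega>)) = expectation (\<lambda>\<omega>. ext (P \<delta> f) (X i \<omega>))"
proof -
  note [measurable] = F_measurable[OF f]
  define G where "G = (\<lambda>x. 1 + (f x)\<^sup>2)"
  have G: "G \<in> F" unfolding G_def by (intro F_add F_const F_square f)
  have le: "\<bar>ext f y\<bar> \<le> ext G y" for y
    using abs_mult_le_sum_squares[of "f (the y)" 1] by (cases y) (auto simp: G_def)
  have bound: "kapp K (\<lambda>u. \<bar>ext f (daughter \<delta> u)\<bar>) y \<le> ext (P \<delta> G) y" for y
  proof -
    have "kapp K (\<lambda>u. \<bar>ext f (daughter \<delta> u)\<bar>) y \<le> kapp K (\<lambda>u. ext G (daughter \<delta> u)) y"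
      using ext_daughter_integrable[OF f] ext_daughter_integrable[OF G] F_measurable[OF G] le
      by (simp add: kapp_eq integral_mono)
    then show ?thesis by (simp add: ext_daughter_kapp G)
  qed
  note T = expectation_triple[of "\<lambda>u. ext f (daughter \<delta> u)" "\<lambda>\<omega>. ext (P \<delta> G) (X i \<omega>)" i,
      OF _ ext_daughter_integrable[OF f] IH[OF F_marg[OF G]] bound]
  show "integrable M (\<lambda>\<omega>. ext f (X (i @ [\<delta>]) \<omega>))"
    "expectation (\<lambda>\<omega>. ext f (X (i @ [\<delta>]) \<omega>)) = expectation (\<lambda>\<omega>. ext (P \<delta> f) (X i \<omega>))"
    using T(1,3) by (simp_all add: daughter_triple ext_daughter_kapp f)
qed

lemma X_root_integral:
  assumes "f \<in> F"
  shows "integrable M (\<lambda>\<omega>. ext f (X [] \<omega>))" "expectation (\<lambda>\<omega>. ext f (X [] \<omega>)) = (\<integral>x. f x \<partial>\<nu>)"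
proof -
  note [measurable] = F_measurable[OF assms]
  have d: "distr M bar (X []) = distr \<nu> bar Some" and s [measurable_cong]: "sets \<nu> = sets borel"
    using BMC by (auto simp: BMC_def)
  have [measurable]: "Some \<in> \<nu> \<rightarrow>\<^sub>M bar" by measurable
  have "integrable (distr M bar (X [])) (ext f) \<longleftrightarrow> integrable M (\<lambda>\<omega>. ext f (X [] \<omega>))"
    by (rule integrable_distr_eq) auto
  moreover have "integrable (distr \<nu> bar Some) (ext f) \<longleftrightarrow> integrable \<nu> (\<lambda>x. ext f (Some x))"
    by (rule integrable_distr_eq) auto
  ultimately show "integrable M (\<lambda>\<omega>. ext f (X [] \<omega>))"
    using d F_\<nu>[OF assms] by simp
  have "integral\<^sup>L (distr M bar (X [])) (ext f) = expectation (\<lambda>\<omega>. ext f (X [] \<omega>))"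
    by (rule integral_distr) auto
  moreover have "integral\<^sup>L (distr \<nu> bar Some) (ext f) = (\<integral>x. ext f (Some x) \<partial>\<nu>)"
    by (rule integral_distr) auto
  ultimately show "expectation (\<lambda>\<omega>. ext f (X [] \<omega>)) = (\<integral>x. f x \<partial>\<nu>)"
    using d by simp
qed

lemma X_integrable: "f \<in> F \<Longrightarrow> integrable M (\<lambda>\<omega>. ext f (X i \<omega>))"
proof (induction i arbitrary: f rule: rev_induct)
  case Nil then show ?case by (rule X_root_integral)
next
  case (snoc \<delta> i) then show ?case by (intro X_child_expectation)
qed

definition popsum :: "nat \<Rightarrow> ('a \<Rightarrow> real) \<Rightarrow> 'w \<Rightarrow> real" where
  "popsum n f \<omega> = (\<Sum>i\<in>gen n. ext f (X i \<omega>))"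

lemma popsum_integrable: "f \<in> F \<Longrightarrow> integrable M (popsum n f)"
  unfolding popsum_def by (intro Bochner_Integration.integrable_sum X_integrable)

lemma popsum_expectation: "f \<in> F \<Longrightarrow> expectation (popsum n f) = m ^ n * (\<integral>x. (Q ^^ n) f x \<partial>\<nu>)"
proof (induction n arbitrary: f)
  case 0 then show ?case by (simp add: popsum_def gen_0 X_root_integral)
next
  case (Suc n)
  have Q: "P False f x + P True f x = m * Q f x" for x
    using m_gt_1 by (simp add: Q_eq Suc.prems)
  have e: "ext (P False f) y + ext (P True f) y = m * ext (Q f) y" for y
    by (cases y) (simp_all add: Q)
  have "expectation (popsum (Suc n) f) =
      (\<Sum>i\<in>gen n. expectation (\<lambda>\<omega>. ext f (X (i @ [False]) \<omega>)) + expectation (\<lambda>\<omega>. ext f (X (i @ [True]) \<omega>)))"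
    unfolding popsum_def sum_gen_Suc using Suc.prems by (simp add: X_integrable)
  also have "\<dots> = (\<Sum>i\<in>gen n. expectation (\<lambda>\<omega>. ext (P False f) (X i \<omega>) + ext (P True f) (X i \<omega>)))"
    using Suc.prems by (simp add: X_child_expectation X_integrable F_marg)
  also have "\<dots> = m * expectation (popsum n (Q f))"
    unfolding popsum_def e using Suc.prems by (simp add: X_integrable F_Q sum_distrib_left)
  also have "\<dots> = m ^ Suc n * (\<integral>x. (Q ^^ Suc n) f x \<partial>\<nu>)"
    by (simp add: Suc.IH F_Q Suc.prems funpow_Suc_right del: funpow.simps)
  finally show ?case .
qed

end

section \<open>Second moments and \<open>L\<^sup>2\<close> convergence\<close>

lemma power2_sum_le: "(a + b)\<^sup>2 \<le> 2 * a\<^sup>2 + 2 * b\<^sup>2" for a b :: real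
  using sum_squares_bound[of a b] by (simp add: power2_sum)

lemma square_integrable_scale:
  "square_integrable M U \<Longrightarrow> square_integrable M (\<lambda>\<omega>. a * U \<omega>)"
  by (auto simp: square_integrable_def power_mult_distrib)

lemma square_integrable_add:
  assumes "square_integrable M U" "square_integrable M V"
  shows "square_integrable M (\<lambda>\<omega>. U \<omega> + V \<omega>)"
  unfolding square_integrable_def
proof
  have [measurable]: "U \<in> borel_measurable M" "V \<in> borel_measurable M"
    using assms by (auto simp: square_integrable_def)
  show "(\<lambda>\<omega>. U \<omega> + V \<omega>) \<in> borel_measurable M" by measurable
  show "integrable M (\<lambda>\<omega>. (U \<omega> + V \<omega>)\<^sup>2)"
  proof (rule Bochner_Integration.integrable_bound)
    show "integrable M (\<lambda>\<omega>. 2 * (U \<omega>)\<^sup>2 + 2 * (V \<omega>)\<^sup>2)"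
      using assms by (auto simp: square_integrable_def)
  qed (auto simp: power2_sum_le)
qed

lemma square_integrable_diff:
  assumes "square_integrable M U" "square_integrable M V"
  shows "square_integrable M (\<lambda>\<omega>. U \<omega> - V \<omega>)"
  using square_integrable_add[OF assms(1) square_integrable_scale[OF assms(2), of "-1"]] by simp

lemma square_integrable_zero: "square_integrable M (\<lambda>_. 0)"
  by (simp add: square_integrable_def)

lemma square_integrable_sum:
  "(\<And>i. i \<in> I \<Longrightarrow> square_integrable M (U i)) \<Longrightarrow> square_integrable M (\<lambda>\<omega>. \<Sum>i\<in>I. U i \<omega>)"
  by (induction I rule: infinite_finite_induct)
    (auto intro: square_integrable_add square_integrable_zero)

lemma integrable_of_square_integrable:
  "prob_space M \<Longrightarrow> square_integrable M U \<Longrightarrow> integrable M U"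
  using finite_measure.square_integrable_imp_integrable prob_space.finite_measure
  unfolding square_integrable_def by blast

lemma integral_power2_add_le:
  assumes "square_integrable M U" "square_integrable M V"
  shows "(\<integral>\<omega>. (U \<omega> + V \<omega>)\<^sup>2 \<partial>M) \<le> 2 * (\<integral>\<omega>. (U \<omega>)\<^sup>2 \<partial>M) + 2 * (\<integral>\<omega>. (V \<omega>)\<^sup>2 \<partial>M)"
proof -
  have "(\<integral>\<omega>. (U \<omega> + V \<omega>)\<^sup>2 \<partial>M) \<le> (\<integral>\<omega>. 2 * (U \<omega>)\<^sup>2 + 2 * (V \<omega>)\<^sup>2 \<partial>M)"
    using assms square_integrable_add[OF assms]
    by (intro integral_mono) (auto simp: square_integrable_def power2_sum_le)
  also have "\<dots> = 2 * (\<integral>\<omega>. (U \<omega>)\<^sup>2 \<partial>M) + 2 * (\<integral>\<omega>. (V \<omega>)\<^sup>2 \<partial>M)"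
    using assms by (simp add: square_integrable_def)
  finally show ?thesis .
qed

lemma converges_L2_add:
  assumes "converges_L2 M U V" "converges_L2 M U' V'"
  shows "converges_L2 M (\<lambda>n \<omega>. U n \<omega> + U' n \<omega>) (\<lambda>\<omega>. V \<omega> + V' \<omega>)"
proof -
  have sq: "square_integrable M (U n)" "square_integrable M V" "square_integrable M (U' n)" "square_integrable M V'" for n
    using assms by (auto simp: converges_L2_def)
  have "(\<lambda>n. \<integral>\<omega>. ((U n \<omega> + U' n \<omega>) - (V \<omega> + V' \<omega>))\<^sup>2 \<partial>M) \<longlonglongrightarrow> 0"
  proof (rule tendsto_sandwich[OF always_eventually always_eventually tendsto_const])
    show "(\<lambda>n. 2 * (\<integral>\<omega>. (U n \<omega> - V \<omega>)\<^sup>2 \<partial>M) + 2 * (\<integral>\<omega>. (U' n \<omega> - V' \<omega>)\<^sup>2 \<partial>M)) \<longlonglongrightarrow> 0"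
      using assms by (auto simp: converges_L2_def intro!: tendsto_eq_intros)
    show "\<forall>n. (\<integral>\<omega>. ((U n \<omega> + U' n \<omega>) - (V \<omega> + V' \<omega>))\<^sup>2 \<partial>M)
        \<le> 2 * (\<integral>\<omega>. (U n \<omega> - V \<omega>)\<^sup>2 \<partial>M) + 2 * (\<integral>\<omega>. (U' n \<omega> - V' \<omega>)\<^sup>2 \<partial>M)"
      using integral_power2_add_le[OF square_integrable_diff square_integrable_diff, OF sq] by (simp add: algebra_simps)
  qed auto
  then show ?thesis
    using sq by (auto simp: converges_L2_def intro: square_integrable_add)
qed

lemma converges_L2_scale:
  assumes "converges_L2 M U V"
  shows "converges_L2 M (\<lambda>n \<omega>. a * U n \<omega>) (\<lambda>\<omega>. a * V \<omega>)"
proof -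
  have "(\<lambda>n. a\<^sup>2 * (\<integral>\<omega>. (U n \<omega> - V \<omega>)\<^sup>2 \<partial>M)) \<longlonglongrightarrow> a\<^sup>2 * 0"
    using assms by (intro tendsto_mult_left) (auto simp: converges_L2_def)
  moreover have "(a * U n \<omega> - a * V \<omega>)\<^sup>2 = a\<^sup>2 * (U n \<omega> - V \<omega>)\<^sup>2" for n \<omega>
    by (simp add: power_mult_distrib flip: right_diff_distrib)
  ultimately show ?thesis
    using assms by (auto simp: converges_L2_def intro: square_integrable_scale)
qed

lemma converges_L2_zeroI:
  assumes "\<And>n. square_integrable M (U n)" "(\<lambda>n. \<integral>\<omega>. (U n \<omega>)\<^sup>2 \<partial>M) \<longlonglongrightarrow> 0"
  shows "converges_L2 M U (\<lambda>_. 0)"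
  using assms by (auto simp: converges_L2_def square_integrable_def)

text \<open>Weighting the recursion \<open>(a + b)\<^sup>2 \<le> (1 + t) a\<^sup>2 + (1 + 1/t) b\<^sup>2\<close> with \<open>(1 + t) r < 1\<close> sums the geometric
  increments without Minkowski's inequality.\<close>

lemma geometric_increments_L2:
  fixes D :: "nat \<Rightarrow> 'w \<Rightarrow> real"
  assumes sq: "\<And>n. square_integrable M (D n)"
    and inc: "\<And>n. (\<integral>\<omega>. (D (Suc n) \<omega> - D n \<omega>)\<^sup>2 \<partial>M) \<le> C * r ^ n" and r: "0 < r" "r < 1"
  shows "\<exists>B. \<forall>p n. (\<integral>\<omega>. (D (p + n) \<omega> - D p \<omega>)\<^sup>2 \<partial>M) \<le> B * r ^ p"
proof -
  define t where "t = (1 - r) / (2 * r)"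
  have t: "t > 0" using r by (simp add: t_def)
  have tr: "(1 + t) * r = (1 + r) / 2" using r by (simp add: t_def field_simps)
  define B where "B = (1 + 1 / t) * C / (1 - (1 + t) * r)"
  have C: "C \<ge> 0"
  proof -
    have "0 \<le> (\<integral>\<omega>. (D (Suc 0) \<omega> - D 0 \<omega>)\<^sup>2 \<partial>M)" by simp
    also have "\<dots> \<le> C" using inc[of 0] by simp
    finally show ?thesis .
  qed
  have pos: "1 - (1 + t) * r > 0" using r unfolding tr by simp
  have B: "B \<ge> 0" "(1 + t) * r * B + (1 + 1 / t) * C = B"
  proof -
    show "B \<ge> 0" unfolding B_def using C t pos by (intro divide_nonneg_pos mult_nonneg_nonneg) auto
    have "B * (1 - (1 + t) * r) = (1 + 1 / t) * C" 
      by (rule nonzero_eq_divide_eq[THEN iffD1, OF _ B_def]) (use pos in linarith)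
    then show "(1 + t) * r * B + (1 + 1 / t) * C = B" by (simp add: algebra_simps)
  qed
  have wt: "(a + b)\<^sup>2 \<le> (1 + t) * a\<^sup>2 + (1 + 1 / t) * b\<^sup>2" for a b :: real
  proof -
    have "0 \<le> (t * a - b)\<^sup>2 / t" using t by simp
    also have "\<dots> = t * a\<^sup>2 + b\<^sup>2 / t - 2 * a * b" using t by (simp add: field_simps power2_eq_square)
    finally show ?thesis by (simp add: power2_sum algebra_simps)
  qed
  have "(\<integral>\<omega>. (D (p + n) \<omega> - D p \<omega>)\<^sup>2 \<partial>M) \<le> B * r ^ p" for p n
  proof (induction n arbitrary: p)
    case 0 then show ?case using B r by simp
  next
    case (Suc n)
    have s: "integrable M (\<lambda>\<omega>. (D i \<omega> - D j \<omega>)\<^sup>2)" for i j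
      using square_integrable_diff[OF sq sq] by (simp add: square_integrable_def)
    have "(\<integral>\<omega>. (D (p + Suc n) \<omega> - D p \<omega>)\<^sup>2 \<partial>M)
        \<le> (\<integral>\<omega>. (1 + t) * (D (Suc p + n) \<omega> - D (Suc p) \<omega>)\<^sup>2 + (1 + 1 / t) * (D (Suc p) \<omega> - D p \<omega>)\<^sup>2 \<partial>M)"
    proof (rule integral_mono)
      show "(D (p + Suc n) \<omega> - D p \<omega>)\<^sup>2 \<le> (1 + t) * (D (Suc p + n) \<omega> - D (Suc p) \<omega>)\<^sup>2 + (1 + 1 / t) * (D (Suc p) \<omega> - D p \<omega>)\<^sup>2" for \<omega>
        using wt[of "D (Suc p + n) \<omega> - D (Suc p) \<omega>" "D (Suc p) \<omega> - D p \<omega>"] by simp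
      show "integrable M (\<lambda>\<omega>. (1 + t) * (D (Suc p + n) \<omega> - D (Suc p) \<omega>)\<^sup>2 + (1 + 1 / t) * (D (Suc p) \<omega> - D p \<omega>)\<^sup>2)"
        by (intro Bochner_Integration.integrable_add integrable_mult_right s)
    qed (rule s)
    also have "\<dots> = (1 + t) * (\<integral>\<omega>. (D (Suc p + n) \<omega> - D (Suc p) \<omega>)\<^sup>2 \<partial>M) + (1 + 1 / t) * (\<integral>\<omega>. (D (Suc p) \<omega> - D p \<omega>)\<^sup>2 \<partial>M)"
      by (subst Bochner_Integration.integral_add) (auto intro!: integrable_mult_right s)
    also have "\<dots> \<le> (1 + t) * (B * r ^ Suc p) + (1 + 1 / t) * (C * r ^ p)"
      using t by (intro add_mono mult_left_mono Suc.IH inc) auto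
    also have "\<dots> = ((1 + t) * r * B + (1 + 1 / t) * C) * r ^ p"
      by (simp add: algebra_simps)
    finally show ?case unfolding B(2) .
  qed
  then show ?thesis by blast
qed

lemma geometric_increments_AE:
  fixes D :: "nat \<Rightarrow> 'w \<Rightarrow> real"
  assumes "prob_space M" and sq: "\<And>n. square_integrable M (D n)"
    and inc: "\<And>n. (\<integral>\<omega>. (D (Suc n) \<omega> - D n \<omega>)\<^sup>2 \<partial>M) \<le> C * r ^ n" and r: "0 < r" "r < 1"
  shows "AE \<omega> in M. convergent (\<lambda>n. D n \<omega>)"
proof -
  interpret prob_space M by fact
  define \<rho> where "\<rho> = sqrt r"
  have \<rho>: "0 < \<rho>" "\<rho> < 1" "\<rho>\<^sup>2 = r" using r by (auto simp: \<rho>_def)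
  let ?d = "\<lambda>n \<omega>. \<bar>D (Suc n) \<omega> - D n \<omega>\<bar>"
  have s: "integrable M (\<lambda>\<omega>. (D (Suc n) \<omega> - D n \<omega>)\<^sup>2)" for n
    using square_integrable_diff[OF sq sq] by (simp add: square_integrable_def)
  have i: "integrable M (?d n)" for n
    using integrable_of_square_integrable[OF prob_space_axioms square_integrable_diff[OF sq sq]] by simp
  have [measurable]: "D n \<in> borel_measurable M" for n using sq by (simp add: square_integrable_def)
  have le: "(\<integral>\<omega>. ?d n \<omega> \<partial>M) \<le> (1 + C) * \<rho> ^ n" for n
  proof -
    have "?d n \<omega> \<le> \<rho> ^ n + (D (Suc n) \<omega> - D n \<omega>)\<^sup>2 / \<rho> ^ n" for \<omega>
    proof -
      have "?d n \<omega> * \<rho> ^ n \<le> (?d n \<omega>)\<^sup>2 + (\<rho> ^ n)\<^sup>2"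
        using abs_mult_le_sum_squares[of "?d n \<omega>" "\<rho> ^ n"] by (rule order_trans[OF abs_ge_self])
      then show ?thesis using \<rho> by (simp add: field_simps power2_eq_square)
    qed
    then have "(\<integral>\<omega>. ?d n \<omega> \<partial>M) \<le> (\<integral>\<omega>. \<rho> ^ n + (D (Suc n) \<omega> - D n \<omega>)\<^sup>2 / \<rho> ^ n \<partial>M)"
      using i s by (intro integral_mono) auto
    also have "\<dots> = \<rho> ^ n + (\<integral>\<omega>. (D (Suc n) \<omega> - D n \<omega>)\<^sup>2 \<partial>M) / \<rho> ^ n"
      using s by (simp add: prob_space)
    also have "\<dots> \<le> \<rho> ^ n + (C * r ^ n) / \<rho> ^ n"
      using inc[of n] \<rho> by (simp add: divide_right_mono)
    also have "(C * r ^ n) / \<rho> ^ n = C * \<rho> ^ n"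
      using \<rho> by (simp add: \<rho>(3)[symmetric] power_mult[symmetric] power2_eq_square power_mult_distrib)
    finally show ?thesis by (simp add: algebra_simps)
  qed
  have C: "C \<ge> 0"
  proof -
    have "0 \<le> (\<integral>\<omega>. (D (Suc 0) \<omega> - D 0 \<omega>)\<^sup>2 \<partial>M)" by simp
    also have "\<dots> \<le> C" using inc[of 0] by simp
    finally show ?thesis .
  qed
  have "(\<integral>\<^sup>+\<omega>. (\<Sum>n. ennreal (?d n \<omega>)) \<partial>M) = (\<Sum>n. \<integral>\<^sup>+\<omega>. ennreal (?d n \<omega>) \<partial>M)"
    by (rule nn_integral_suminf) measurable
  also have "\<dots> \<le> (\<Sum>n. ennreal ((1 + C) * \<rho> ^ n))"
    using i le by (intro suminf_le) (auto simp: nn_integral_eq_integral intro!: ennreal_leI)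
  also have "\<dots> = ennreal (\<Sum>n. (1 + C) * \<rho> ^ n)"
    using C \<rho> by (intro suminf_ennreal2) (auto intro!: summable_mult summable_geometric)
  finally have "(\<integral>\<^sup>+\<omega>. (\<Sum>n. ennreal (?d n \<omega>)) \<partial>M) \<noteq> \<infinity>"
    by (auto simp: top_unique)
  then have "AE \<omega> in M. (\<Sum>n. ennreal (?d n \<omega>)) \<noteq> \<infinity>"
    by (intro nn_integral_noteq_infinite) measurable
  then show ?thesis
  proof eventually_elim
    case (elim \<omega>)
    then have "summable (\<lambda>n. ?d n \<omega>)"
      by (intro summable_suminf_not_top) auto
    then have "summable (\<lambda>n. D (Suc n) \<omega> - D n \<omega>)"
      by (rule summable_rabs_cancel)
    then have "convergent (\<lambda>n. \<Sum>k<n. D (Suc k) \<omega> - D k \<omega>)"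
      by (simp add: summable_iff_convergent)
    then have "convergent (\<lambda>n. D n \<omega> - D 0 \<omega>)"
      using sum_lessThan_telescope[of "\<lambda>k. D k \<omega>"] by simp
    then show ?case by (simp add: convergent_diff_const_right_iff)
  qed
qed

lemma geometric_increments_converges_L2:
  fixes D :: "nat \<Rightarrow> 'w \<Rightarrow> real"
  assumes "prob_space M" and sq: "\<And>n. square_integrable M (D n)"
    and inc: "\<And>n. (\<integral>\<omega>. (D (Suc n) \<omega> - D n \<omega>)\<^sup>2 \<partial>M) \<le> C * r ^ n" and r: "0 < r" "r < 1"
  shows "converges_L2 M D (\<lambda>\<omega>. lim (\<lambda>n. D n \<omega>))"
proof -
  have [measurable]: "D n \<in> borel_measurable M" for n using sq by (simp add: square_integrable_def)
  define W where "W \<omega> = lim (\<lambda>n. D n \<omega>)" for \<omega>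
  have W [measurable]: "W \<in> borel_measurable M" unfolding W_def by (rule borel_measurable_lim_metric) measurable
  have lim: "AE \<omega> in M. (\<lambda>n. D n \<omega>) \<longlonglongrightarrow> W \<omega>"
    using geometric_increments_AE[OF assms] by (simp add: W_def convergent_LIMSEQ_iff)
  obtain B where B: "\<And>p n. (\<integral>\<omega>. (D (p + n) \<omega> - D p \<omega>)\<^sup>2 \<partial>M) \<le> B * r ^ p"
    using geometric_increments_L2[OF sq inc r] by blast
  have WD: "integrable M (\<lambda>\<omega>. (W \<omega> - D p \<omega>)\<^sup>2)" "(\<integral>\<omega>. (W \<omega> - D p \<omega>)\<^sup>2 \<partial>M) \<le> B * r ^ p" for p
  proof -
    have i: "integrable M (\<lambda>\<omega>. (D (p + n) \<omega> - D p \<omega>)\<^sup>2)" for n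
      using square_integrable_diff[OF sq sq] by (simp add: square_integrable_def)
    have l: "AE \<omega> in M. (\<lambda>n. (D (p + n) \<omega> - D p \<omega>)\<^sup>2) \<longlonglongrightarrow> (W \<omega> - D p \<omega>)\<^sup>2"
      using lim
    proof eventually_elim
      case (elim \<omega>)
      then have "(\<lambda>n. D (n + p) \<omega>) \<longlonglongrightarrow> W \<omega>" by (rule LIMSEQ_ignore_initial_segment)
      then show ?case by (intro tendsto_intros) (simp add: add.commute)
    qed
    have "(\<lambda>\<omega>. (W \<omega> - D p \<omega>)\<^sup>2) \<in> borel_measurable M" by measurable
    note Fatou_integrable[OF i zero_le_power2 this l B]
    then show "integrable M (\<lambda>\<omega>. (W \<omega> - D p \<omega>)\<^sup>2)" "(\<integral>\<omega>. (W \<omega> - D p \<omega>)\<^sup>2 \<partial>M) \<le> B * r ^ p" by auto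
  qed
  have "square_integrable M (\<lambda>\<omega>. (W \<omega> - D 0 \<omega>) + D 0 \<omega>)"
    by (rule square_integrable_add[OF _ sq]) (use WD in \<open>simp add: square_integrable_def\<close>)
  then have "square_integrable M W" by simp
  moreover have "(\<lambda>p. \<integral>\<omega>. (D p \<omega> - W \<omega>)\<^sup>2 \<partial>M) \<longlonglongrightarrow> 0"
  proof (rule tendsto_sandwich[OF always_eventually always_eventually tendsto_const])
    show "(\<lambda>p. B * r ^ p) \<longlonglongrightarrow> 0"
      using r by (intro tendsto_mult_right_zero LIMSEQ_power_zero) simp
    show "\<forall>p. (\<integral>\<omega>. (D p \<omega> - W \<omega>)\<^sup>2 \<partial>M) \<le> B * r ^ p"
      using WD by (simp add: power2_commute)
  qed auto
  ultimately show ?thesis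
    using sq by (simp add: converges_L2_def W_def[abs_def])
qed

context bmc_class
begin

lemma F_nu_bound:
  assumes "G \<in> F" shows "\<exists>C. \<forall>n. (\<integral>x. (Q ^^ n) G x \<partial>\<nu>) \<le> C"
proof -
  obtain g where g: "g \<in> F" "\<And>r x. \<bar>(Q ^^ r) G x\<bar> \<le> g x" using F_bound[OF assms] by blast
  have "(\<integral>x. (Q ^^ n) G x \<partial>\<nu>) \<le> (\<integral>x. g x \<partial>\<nu>)" for n
    using g(2)[of n] by (intro integral_mono F_\<nu> F_Q_funpow assms g) (auto intro: order_trans[OF abs_ge_self])
  then show ?thesis by blast
qed

lemma ext_square_integrable: "g \<in> F \<Longrightarrow> square_integrable M (\<lambda>\<omega>. ext g (X i \<omega>))"
  using X_integrable[OF F_square, of g i] F_measurable by (simp add: square_integrable_def ext_power2)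

lemma popsum_square_integrable: "g \<in> F \<Longrightarrow> square_integrable M (popsum n g)"
  unfolding popsum_def by (intro square_integrable_sum ext_square_integrable)

lemma popsum_mono: "(\<And>x. f x \<le> g x) \<Longrightarrow> popsum n f \<omega> \<le> popsum n g \<omega>"
  unfolding popsum_def
proof (rule sum_mono)
  show "(\<And>x. f x \<le> g x) \<Longrightarrow> ext f (X i \<omega>) \<le> ext g (X i \<omega>)" for i by (cases "X i \<omega>") auto
qed

lemma popsum_scale: "popsum n (\<lambda>x. a * f x) \<omega> = a * popsum n f \<omega>"
proof -
  have "ext (\<lambda>x. a * f x) y = a * ext f y" for y by (cases y) auto
  then show ?thesis by (simp add: popsum_def sum_distrib_left)
qed

lemma popsum_second_moment:
  assumes g: "g \<in> F"
  shows "expectation (\<lambda>\<omega>. (popsum (Suc n) g \<omega>)\<^sup>2) \<le>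
    m\<^sup>2 * expectation (\<lambda>\<omega>. (popsum n (Q g) \<omega>)\<^sup>2) + 2 * expectation (popsum (Suc n) (\<lambda>x. (g x)\<^sup>2))"
proof -
  let ?g2 = "\<lambda>x. (g x)\<^sup>2"
  note g2 = F_square[OF g]
  have [measurable]: "g \<in> borel_measurable borel" by (rule F_measurable[OF g])
  define \<phi> where "\<phi> u = ext g (daughter False u) + ext g (daughter True u)" for u
  have [measurable]: "\<phi> \<in> borel_measurable bar3" unfolding \<phi>_def by measurable
  have mQ: "ext (P False f) y + ext (P True f) y = m * ext (Q f) y" if "f \<in> F" for f y
    using m_gt_1 that by (cases y) (simp_all add: Q_eq)
  have i1: "integrable (triple_kernel K y) \<phi>" for y
    unfolding \<phi>_def by (intro Bochner_Integration.integrable_add ext_daughter_integrable g)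
  have k1: "kapp K \<phi> y = m * ext (Q g) y" for y
    unfolding mQ[OF g, symmetric] ext_daughter_kapp[OF g, symmetric]
    by (simp add: kapp_eq \<phi>_def ext_daughter_integrable g)
  have le: "(\<phi> u)\<^sup>2 \<le> 2 * ext ?g2 (daughter False u) + 2 * ext ?g2 (daughter True u)" for u
    unfolding \<phi>_def ext_power2[symmetric] by (rule power2_sum_le)
  have i2': "integrable (triple_kernel K y) (\<lambda>u. 2 * ext ?g2 (daughter False u) + 2 * ext ?g2 (daughter True u))" for y
    by (intro Bochner_Integration.integrable_add integrable_mult_right ext_daughter_integrable g2)
  have i2: "integrable (triple_kernel K y) (\<lambda>u. (\<phi> u)\<^sup>2)" for y
    by (rule Bochner_Integration.integrable_bound[OF i2'])
      (auto intro!: AE_I2 order_trans[OF le abs_ge_self])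
  have k2: "kapp K (\<lambda>u. (\<phi> u)\<^sup>2) y \<le> 2 * (ext (P False ?g2) y + ext (P True ?g2) y)" for y
  proof -
    have "kapp K (\<lambda>u. (\<phi> u)\<^sup>2) y \<le> (\<integral>u. 2 * ext ?g2 (daughter False u) + 2 * ext ?g2 (daughter True u) \<partial>triple_kernel K y)"
      unfolding kapp_eq[OF borel_measurable_power[OF \<open>\<phi> \<in> borel_measurable bar3\<close>]]
      by (rule integral_mono[OF i2 i2' le])
    also have "\<dots> = 2 * (ext (P False ?g2) y + ext (P True ?g2) y)"
      unfolding ext_daughter_kapp[OF g2, symmetric]
      by (simp add: kapp_eq ext_daughter_integrable g2 distrib_left)
    finally show ?thesis .
  qed
  have k2_int: "integrable M (\<lambda>\<omega>. kapp K (\<lambda>u. (\<phi> u)\<^sup>2) (X i \<omega>))" for i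
  proof (rule Bochner_Integration.integrable_bound)
    show "integrable M (\<lambda>\<omega>. 2 * (ext (P False ?g2) (X i \<omega>) + ext (P True ?g2) (X i \<omega>)))"
      by (intro Bochner_Integration.integrable_add integrable_mult_right X_integrable F_marg g2)
    show "AE \<omega> in M. norm (kapp K (\<lambda>u. (\<phi> u)\<^sup>2) (X i \<omega>)) \<le> norm (2 * (ext (P False ?g2) (X i \<omega>) + ext (P True ?g2) (X i \<omega>)))"
    proof (rule AE_I2)
      fix \<omega>
      have "0 \<le> kapp K (\<lambda>u. (\<phi> u)\<^sup>2) (X i \<omega>)" by (simp add: kapp_eq)
      then show "norm (kapp K (\<lambda>u. (\<phi> u)\<^sup>2) (X i \<omega>)) \<le> norm (2 * (ext (P False ?g2) (X i \<omega>) + ext (P True ?g2) (X i \<omega>)))"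
        using k2[of "X i \<omega>"] by simp
    qed
  qed measurable
  note V = expectation_power2_sum[of \<phi> n, OF _ i1 i2 k2_int, simplified]
  have "popsum (Suc n) g \<omega> = (\<Sum>i\<in>gen n. \<phi> (triple X i \<omega>))" for \<omega>
    by (simp add: popsum_def sum_gen_Suc \<phi>_def daughter_triple)
  then have "expectation (\<lambda>\<omega>. (popsum (Suc n) g \<omega>)\<^sup>2) =
      expectation (\<lambda>\<omega>. (\<Sum>i\<in>gen n. kapp K \<phi> (X i \<omega>))\<^sup>2) +
      (\<Sum>i\<in>gen n. expectation (\<lambda>\<omega>. kapp K (\<lambda>u. (\<phi> u)\<^sup>2) (X i \<omega>)) - expectation (\<lambda>\<omega>. (kapp K \<phi> (X i \<omega>))\<^sup>2))"
    using V(3) by simp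
  also have "\<dots> \<le> expectation (\<lambda>\<omega>. (\<Sum>i\<in>gen n. kapp K \<phi> (X i \<omega>))\<^sup>2) +
      (\<Sum>i\<in>gen n. expectation (\<lambda>\<omega>. 2 * (ext (P False ?g2) (X i \<omega>) + ext (P True ?g2) (X i \<omega>))))"
  proof (intro add_left_mono sum_mono)
    fix i
    have "expectation (\<lambda>\<omega>. kapp K (\<lambda>u. (\<phi> u)\<^sup>2) (X i \<omega>)) \<le> expectation (\<lambda>\<omega>. 2 * (ext (P False ?g2) (X i \<omega>) + ext (P True ?g2) (X i \<omega>)))"
      by (intro integral_mono k2_int k2 Bochner_Integration.integrable_add integrable_mult_right X_integrable F_marg g2)
    moreover have "0 \<le> expectation (\<lambda>\<omega>. (kapp K \<phi> (X i \<omega>))\<^sup>2)" by simp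
    ultimately show "expectation (\<lambda>\<omega>. kapp K (\<lambda>u. (\<phi> u)\<^sup>2) (X i \<omega>)) - expectation (\<lambda>\<omega>. (kapp K \<phi> (X i \<omega>))\<^sup>2)
        \<le> expectation (\<lambda>\<omega>. 2 * (ext (P False ?g2) (X i \<omega>) + ext (P True ?g2) (X i \<omega>)))" by linarith
  qed
  also have "expectation (\<lambda>\<omega>. (\<Sum>i\<in>gen n. kapp K \<phi> (X i \<omega>))\<^sup>2) = m\<^sup>2 * expectation (\<lambda>\<omega>. (popsum n (Q g) \<omega>)\<^sup>2)"
    by (simp add: k1 popsum_def sum_distrib_left[symmetric] power_mult_distrib)
  also have "(\<Sum>i\<in>gen n. expectation (\<lambda>\<omega>. 2 * (ext (P False ?g2) (X i \<omega>) + ext (P True ?g2) (X i \<omega>))))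
      = 2 * expectation (popsum (Suc n) ?g2)"
    unfolding popsum_def sum_gen_Suc
    by (simp add: X_integrable F_marg g2 X_child_expectation sum_distrib_left distrib_left)
  finally show ?thesis .
qed

lemma popsum_second_moment_iter:
  assumes "g \<in> F" and "G \<in> F" and G: "\<And>r x. ((Q ^^ r) g x)\<^sup>2 \<le> G x"
    and C: "\<And>n. (\<integral>x. (Q ^^ n) G x \<partial>\<nu>) \<le> C"
  shows "expectation (\<lambda>\<omega>. (popsum (p + n) g \<omega> / m ^ (p + n))\<^sup>2) \<le>
    expectation (\<lambda>\<omega>. (popsum p ((Q ^^ n) g) \<omega> / m ^ p)\<^sup>2) + 2 * C / (m - 1) * (1 / m ^ p - 1 / m ^ (p + n))"
  using assms(1) G
proof (induction n arbitrary: g)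
  case 0 then show ?case by simp
next
  case (Suc n)
  have m: "m > 0" using m_gt_1 by simp
  let ?k = "p + n"
  have "expectation (popsum (Suc ?k) (\<lambda>x. (g x)\<^sup>2)) \<le> expectation (popsum (Suc ?k) G)"
    using Suc.prems(2)[of 0] by (intro integral_mono popsum_integrable F_square Suc.prems assms(2) popsum_mono) simp
  also have "\<dots> \<le> m ^ Suc ?k * C"
    unfolding popsum_expectation[OF assms(2)] using m by (intro mult_left_mono C) simp
  finally have le: "expectation (popsum (Suc ?k) (\<lambda>x. (g x)\<^sup>2)) \<le> m ^ Suc ?k * C" .
  have "expectation (\<lambda>\<omega>. (popsum (Suc ?k) g \<omega> / m ^ Suc ?k)\<^sup>2) = expectation (\<lambda>\<omega>. (popsum (Suc ?k) g \<omega>)\<^sup>2) / (m ^ Suc ?k)\<^sup>2"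
    by (simp add: power_divide)
  also have "\<dots> \<le> (m\<^sup>2 * expectation (\<lambda>\<omega>. (popsum ?k (Q g) \<omega>)\<^sup>2) + 2 * (m ^ Suc ?k * C)) / (m ^ Suc ?k)\<^sup>2"
    using popsum_second_moment[OF Suc.prems(1), of ?k] le by (intro divide_right_mono) auto
  also have "\<dots> = expectation (\<lambda>\<omega>. (popsum ?k (Q g) \<omega> / m ^ ?k)\<^sup>2) + 2 * C / m ^ Suc ?k"
    using m by (simp add: power_divide add_divide_distrib power_mult_distrib) (simp add: power2_eq_square)
  also have "2 * C / m ^ Suc ?k = 2 * C / (m - 1) * (1 / m ^ ?k - 1 / m ^ Suc ?k)"
    using m_gt_1 by (simp add: field_simps)
  also have "expectation (\<lambda>\<omega>. (popsum ?k (Q g) \<omega> / m ^ ?k)\<^sup>2) \<le>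
      expectation (\<lambda>\<omega>. (popsum p ((Q ^^ n) (Q g)) \<omega> / m ^ p)\<^sup>2) + 2 * C / (m - 1) * (1 / m ^ p - 1 / m ^ ?k)"
  proof (rule Suc.IH)
    show "Q g \<in> F" by (rule F_Q[OF Suc.prems(1)])
    show "((Q ^^ r) (Q g) x)\<^sup>2 \<le> G x" for r x
      using Suc.prems(2)[of "Suc r" x] by (simp add: funpow_Suc_right del: funpow.simps)
  qed
  finally show ?case
    by (simp add: funpow_Suc_right algebra_simps del: funpow.simps)
qed

lemma popsum_normalized_tendsto_0:
  assumes g: "g \<in> F" and "(\<integral>x. g x \<partial>\<mu>) = 0"
  shows "(\<lambda>n. expectation (\<lambda>\<omega>. (popsum n g \<omega> / m ^ n)\<^sup>2)) \<longlonglongrightarrow> 0"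
proof (rule LIMSEQ_I)
  fix \<epsilon> :: real assume \<epsilon>: "\<epsilon> > 0"
  obtain g1 where g1: "g1 \<in> F" "\<And>r x. \<bar>(Q ^^ r) g x\<bar> \<le> g1 x" using F_bound[OF g] by blast
  have sq: "((Q ^^ r) g x)\<^sup>2 \<le> (g1 x)\<^sup>2" for r x
    using g1(2)[of r x] by (intro power2_le_iff_abs_le[THEN iffD2]) (auto intro: order_trans[OF abs_ge_zero])
  obtain C where C: "\<And>n. (\<integral>x. (Q ^^ n) (\<lambda>x. (g1 x)\<^sup>2) x \<partial>\<nu>) \<le> C"
    using F_nu_bound[OF F_square[OF g1(1)]] by blast
  have "0 \<le> (\<integral>x. (Q ^^ 0) (\<lambda>x. (g1 x)\<^sup>2) x \<partial>\<nu>)" by simp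
  then have C0: "C \<ge> 0" using C[of 0] by linarith
  define B where "B = 2 * C / (m - 1)"
  have B: "B \<ge> 0" using C0 m_gt_1 by (simp add: B_def)
  have "(\<lambda>p. B * (1 / m) ^ p) \<longlonglongrightarrow> 0"
    using m_gt_1 by (intro tendsto_mult_right_zero LIMSEQ_power_zero) simp
  then have "\<forall>\<^sub>F p in sequentially. B * (1 / m) ^ p < \<epsilon> / 2"
    using \<epsilon> by (intro order_tendstoD(2)) auto
  then obtain p where p: "B * (1 / m) ^ p < \<epsilon> / 2" by (auto simp: eventually_sequentially)
  have "(\<lambda>n. expectation (\<lambda>\<omega>. (popsum p ((Q ^^ n) g) \<omega> / m ^ p)\<^sup>2)) \<longlonglongrightarrow> expectation (\<lambda>\<omega>. 0)"
  proof (rule integral_dominated_convergence[where w = "\<lambda>\<omega>. (popsum p g1 \<omega> / m ^ p)\<^sup>2"])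
    show "integrable M (\<lambda>\<omega>. (popsum p g1 \<omega> / m ^ p)\<^sup>2)"
      using popsum_square_integrable[OF g1(1), of p] by (simp add: square_integrable_def power_divide)
    have [measurable]: "popsum p h \<in> borel_measurable M" if "h \<in> F" for h
      using popsum_square_integrable[OF that] by (simp add: square_integrable_def)
    show "(\<lambda>\<omega>. (popsum p ((Q ^^ n) g) \<omega> / m ^ p)\<^sup>2) \<in> borel_measurable M" for n
      using F_Q_funpow[OF g] by measurable
    show "AE \<omega> in M. (\<lambda>n. (popsum p ((Q ^^ n) g) \<omega> / m ^ p)\<^sup>2) \<longlonglongrightarrow> 0"
    proof (rule AE_I2)
      fix \<omega>
      have "(\<lambda>n. ext ((Q ^^ n) g) y) \<longlonglongrightarrow> 0" for y
        using Q_funpow_tendsto[OF g] assms(2) by (cases y) auto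
      then have "(\<lambda>n. popsum p ((Q ^^ n) g) \<omega>) \<longlonglongrightarrow> (\<Sum>i\<in>gen p. 0)"
        unfolding popsum_def by (intro tendsto_sum)
      then have "(\<lambda>n. (popsum p ((Q ^^ n) g) \<omega> / m ^ p)\<^sup>2) \<longlonglongrightarrow> (0 / m ^ p)\<^sup>2"
        using m_gt_1 by (intro tendsto_power tendsto_divide tendsto_const) auto
      then show "(\<lambda>n. (popsum p ((Q ^^ n) g) \<omega> / m ^ p)\<^sup>2) \<longlonglongrightarrow> 0" by simp
    qed
    show "AE \<omega> in M. norm ((popsum p ((Q ^^ n) g) \<omega> / m ^ p)\<^sup>2) \<le> (popsum p g1 \<omega> / m ^ p)\<^sup>2" for n
    proof (rule AE_I2)
      fix \<omega>
      have "popsum p ((Q ^^ n) g) \<omega> \<le> popsum p g1 \<omega>" "popsum p (\<lambda>x. - 1 * (Q ^^ n) g x) \<omega> \<le> popsum p g1 \<omega>"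
        using g1(2)[of n] by (auto intro!: popsum_mono simp: abs_le_iff)
      then have "\<bar>popsum p ((Q ^^ n) g) \<omega>\<bar> \<le> \<bar>popsum p g1 \<omega>\<bar>"
        unfolding popsum_scale by linarith
      then show "norm ((popsum p ((Q ^^ n) g) \<omega> / m ^ p)\<^sup>2) \<le> (popsum p g1 \<omega> / m ^ p)\<^sup>2"
        by (simp add: power_divide divide_right_mono abs_le_square_iff)
    qed
  qed auto
  then have "\<forall>\<^sub>F n in sequentially. expectation (\<lambda>\<omega>. (popsum p ((Q ^^ n) g) \<omega> / m ^ p)\<^sup>2) < \<epsilon> / 2"
    using \<epsilon> by (intro order_tendstoD(2)) auto
  then obtain n0 where n0: "\<And>n. n \<ge> n0 \<Longrightarrow> expectation (\<lambda>\<omega>. (popsum p ((Q ^^ n) g) \<omega> / m ^ p)\<^sup>2) < \<epsilon> / 2"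
    by (auto simp: eventually_sequentially)
  have "expectation (\<lambda>\<omega>. (popsum n g \<omega> / m ^ n)\<^sup>2) < \<epsilon>" if n: "n \<ge> p + n0" for n
  proof -
    define k where "k = n - p"
    have k: "n = p + k" "k \<ge> n0" using n by (auto simp: k_def)
    have "B * (1 / m ^ p - 1 / m ^ (p + k)) \<le> B * (1 / m ^ p)"
      using B m_gt_1 by (intro mult_left_mono) auto
    also have "\<dots> = B * (1 / m) ^ p" by (simp add: power_one_over)
    finally show ?thesis
      using popsum_second_moment_iter[OF g F_square[OF g1(1)] sq C, of p k] n0[OF k(2)] p
      unfolding k(1) B_def by linarith
  qed
  then show "\<exists>n0. \<forall>n\<ge>n0. norm (expectation (\<lambda>\<omega>. (popsum n g \<omega> / m ^ n)\<^sup>2) - 0) < \<epsilon>"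
    by (intro exI[of _ "p + n0"]) auto
qed

lemma centered_sum_second_moment:
  assumes [measurable]: "\<phi> \<in> borel_measurable bar3"
    and i1: "\<And>y. integrable (triple_kernel K y) \<phi>" and i2: "\<And>y. integrable (triple_kernel K y) (\<lambda>u. (\<phi> u)\<^sup>2)"
    and "G \<in> F" and k1: "\<And>y. kapp K \<phi> y = 0" and k2: "\<And>y. kapp K (\<lambda>u. (\<phi> u)\<^sup>2) y \<le> ext G y"
  shows "\<exists>C. \<forall>n. square_integrable M (\<lambda>\<omega>. \<Sum>i\<in>gen n. \<phi> (triple X i \<omega>)) \<and>
    expectation (\<lambda>\<omega>. (\<Sum>i\<in>gen n. \<phi> (triple X i \<omega>))\<^sup>2) \<le> C * m ^ n"
proof -
  obtain C where C: "\<And>n. (\<integral>x. (Q ^^ n) G x \<partial>\<nu>) \<le> C" using F_nu_bound[OF assms(4)] by blast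
  have k2_int: "integrable M (\<lambda>\<omega>. kapp K (\<lambda>u. (\<phi> u)\<^sup>2) (X i \<omega>))" for i
  proof (rule Bochner_Integration.integrable_bound[OF X_integrable[OF assms(4)]])
    show "AE \<omega> in M. norm (kapp K (\<lambda>u. (\<phi> u)\<^sup>2) (X i \<omega>)) \<le> norm (ext G (X i \<omega>))"
    proof (rule AE_I2)
      fix \<omega>
      have "0 \<le> kapp K (\<lambda>u. (\<phi> u)\<^sup>2) (X i \<omega>)" by (simp add: kapp_eq)
      then show "norm (kapp K (\<lambda>u. (\<phi> u)\<^sup>2) (X i \<omega>)) \<le> norm (ext G (X i \<omega>))" using k2[of "X i \<omega>"] by simp
    qed
  qed measurable
  have "square_integrable M (\<lambda>\<omega>. \<Sum>i\<in>gen n. \<phi> (triple X i \<omega>)) \<and>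
    expectation (\<lambda>\<omega>. (\<Sum>i\<in>gen n. \<phi> (triple X i \<omega>))\<^sup>2) \<le> C * m ^ n" for n
  proof
    note V = expectation_power2_sum[of \<phi> n, OF _ i1 i2 k2_int, simplified]
    show "square_integrable M (\<lambda>\<omega>. \<Sum>i\<in>gen n. \<phi> (triple X i \<omega>))"
      using V(1) by (simp add: square_integrable_def)
    have "expectation (\<lambda>\<omega>. (\<Sum>i\<in>gen n. \<phi> (triple X i \<omega>))\<^sup>2) = (\<Sum>i\<in>gen n. expectation (\<lambda>\<omega>. kapp K (\<lambda>u. (\<phi> u)\<^sup>2) (X i \<omega>)))"
      using V(3) by (simp add: k1)
    also have "\<dots> \<le> (\<Sum>i\<in>gen n. expectation (\<lambda>\<omega>. ext G (X i \<omega>)))"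
      by (intro sum_mono integral_mono k2_int k2 X_integrable assms(4))
    also have "\<dots> = expectation (popsum n G)"
      unfolding popsum_def by (simp add: X_integrable assms(4))
    also have "\<dots> \<le> C * m ^ n"
      unfolding popsum_expectation[OF assms(4)] using C[of n] m_gt_1 by (simp add: mult.commute mult_right_mono)
    finally show "expectation (\<lambda>\<omega>. (\<Sum>i\<in>gen n. \<phi> (triple X i \<omega>))\<^sup>2) \<le> C * m ^ n" .
  qed
  then show ?thesis by blast
qed

end

section \<open>Convergence of the normalised sums\<close>

lemma finite_tree_upto [simp]: "finite (tree_upto r)"
  by (simp add: tree_upto_def)

lemma sum_tree_upto: "(\<Sum>i\<in>tree_upto r. a i) = (\<Sum>q\<le>r. \<Sum>i\<in>gen q. a i)" for a :: "node \<Rightarrow> real"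
  unfolding tree_upto_def atLeast0AtMost
proof (rule sum.UNION_disjoint)
  show "\<forall>i\<in>{..r}. \<forall>j\<in>{..r}. i \<noteq> j \<longrightarrow> gen i \<inter> gen j = {}" by (auto simp: gen_def)
qed simp_all

lemma sum_alive:
  fixes a :: "node \<Rightarrow> real"
  assumes "finite J"
  shows "(\<Sum>i\<in>alive X J \<omega>. a i) = (\<Sum>i\<in>J. if X i \<omega> = None then 0 else a i)"
  unfolding alive_def sum.inter_filter[OF assms] by (intro sum.cong refl) simp

lemma card_alive:
  assumes "finite J"
  shows "real (card (alive X J \<omega>)) = (\<Sum>i\<in>J. ext (\<lambda>_. 1) (X i \<omega>))"
proof -
  have "real (card (alive X J \<omega>)) = (\<Sum>i\<in>alive X J \<omega>. 1)" by simp
  also have "\<dots> = (\<Sum>i\<in>J. ext (\<lambda>_. 1) (X i \<omega>))"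
    unfolding sum_alive[OF assms] by (intro sum.cong refl) (auto simp: ext_def split: option.split)
  finally show ?thesis .
qed

lemma geometric_average_tendsto_0:
  fixes a :: "nat \<Rightarrow> real"
  assumes "a \<longlonglongrightarrow> 0" and m: "m > 1" and nonneg: "\<And>q. a q \<ge> 0"
  shows "(\<lambda>r. (\<Sum>q\<le>r. m ^ q * a q) / (\<Sum>q\<le>r. m ^ q)) \<longlonglongrightarrow> 0"
proof (rule LIMSEQ_I)
  fix \<epsilon> :: real assume \<epsilon>: "\<epsilon> > 0"
  have "\<forall>\<^sub>F q in sequentially. a q < \<epsilon> / 2"
    using assms(1) \<epsilon> by (intro order_tendstoD(2)[where y = 0]) auto
  then obtain n0 where n0: "\<And>q. q \<ge> n0 \<Longrightarrow> a q < \<epsilon> / 2" by (auto simp: eventually_sequentially)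
  define S where "S = (\<Sum>q<n0. m ^ q * a q)"
  have S: "S \<ge> 0" unfolding S_def using m nonneg by (intro sum_nonneg) auto
  have "(\<lambda>r. S * (1 / m) ^ r) \<longlonglongrightarrow> 0"
    using m by (intro tendsto_mult_right_zero LIMSEQ_power_zero) simp
  then have "\<forall>\<^sub>F r in sequentially. S * (1 / m) ^ r < \<epsilon> / 2"
    using \<epsilon> by (intro order_tendstoD(2)) auto
  then obtain r0 where r0: "\<And>r. r \<ge> r0 \<Longrightarrow> S * (1 / m) ^ r < \<epsilon> / 2" by (auto simp: eventually_sequentially)
  have "(\<Sum>q\<le>r. m ^ q * a q) / (\<Sum>q\<le>r. m ^ q) < \<epsilon>" if "r \<ge> r0" for r
  proof -
    let ?t = "\<Sum>q\<le>r. m ^ q"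
    have t: "?t \<ge> m ^ r" using m by (intro member_le_sum) auto
    then have t0: "?t > 0" using m by (meson less_le_trans zero_less_power zero_less_one less_trans)
    have "(\<Sum>q\<le>r. m ^ q * a q) \<le> (\<Sum>q\<le>r. (if q < n0 then m ^ q * a q else 0) + \<epsilon> / 2 * m ^ q)"
    proof (rule sum_mono)
      fix q
      show "m ^ q * a q \<le> (if q < n0 then m ^ q * a q else 0) + \<epsilon> / 2 * m ^ q"
        using n0[of q] m \<epsilon> by (cases "q < n0") (auto simp: mult.commute intro!: mult_right_mono less_imp_le)
    qed
    also have "\<dots> = (\<Sum>q\<in>{..r} \<inter> {..<n0}. m ^ q * a q) + \<epsilon> / 2 * ?t"
      by (simp add: sum.distrib sum_distrib_left sum.inter_restrict)
    also have "(\<Sum>q\<in>{..r} \<inter> {..<n0}. m ^ q * a q) \<le> S"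
      unfolding S_def using m nonneg by (intro sum_mono2) auto
    finally have "(\<Sum>q\<le>r. m ^ q * a q) / ?t \<le> (S + \<epsilon> / 2 * ?t) / ?t"
      using t0 by (intro divide_right_mono) auto
    also have "\<dots> = S / ?t + \<epsilon> / 2" using t0 by (simp add: add_divide_distrib)
    also have "S / ?t \<le> S / m ^ r" using t t0 S m by (intro divide_left_mono mult_pos_pos) auto
    also have "S / m ^ r = S * (1 / m) ^ r" by (simp add: power_one_over)
    finally show ?thesis using r0[OF that] by linarith
  qed
  moreover have "(\<Sum>q\<le>r. m ^ q * a q) / (\<Sum>q\<le>r. m ^ q) \<ge> 0" for r
    using m nonneg by (intro divide_nonneg_nonneg sum_nonneg) auto
  ultimately show "\<exists>r0. \<forall>r\<ge>r0. norm ((\<Sum>q\<le>r. m ^ q * a q) / (\<Sum>q\<le>r. m ^ q) - 0) < \<epsilon>"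
    by (intro exI[of _ r0]) (simp only: diff_0_right real_norm_def abs_of_nonneg simp_thms, blast)
qed

lemma weighted_sum_power2_le:
  fixes w x :: "'i \<Rightarrow> real"
  assumes "\<And>i. i \<in> I \<Longrightarrow> w i \<ge> 0"
  shows "(\<Sum>i\<in>I. w i * x i)\<^sup>2 \<le> (\<Sum>i\<in>I. w i) * (\<Sum>i\<in>I. w i * (x i)\<^sup>2)"
proof -
  have "(\<Sum>i\<in>I. w i * x i) = (\<Sum>i\<in>I. sqrt (w i) * (sqrt (w i) * x i))"
    using assms by (intro sum.cong) (auto simp: mult.assoc[symmetric])
  then have "(\<Sum>i\<in>I. w i * x i)\<^sup>2 \<le> (\<Sum>i\<in>I. (sqrt (w i))\<^sup>2) * (\<Sum>i\<in>I. (sqrt (w i) * x i)\<^sup>2)"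
    using Cauchy_Schwarz_ineq_sum by metis
  then show ?thesis using assms by (simp add: power_mult_distrib)
qed

lemma converges_L2_geometric_average:
  assumes UV: "converges_L2 M U V" and m: "m > 1"
  shows "converges_L2 M (\<lambda>r \<omega>. (\<Sum>q\<le>r. m ^ q * U q \<omega>) / (\<Sum>q\<le>r. m ^ q)) V"
proof -
  have sq: "square_integrable M (U n)" "square_integrable M V" for n using UV by (auto simp: converges_L2_def)
  define t where "t r = (\<Sum>q\<le>r. m ^ q)" for r
  have t: "t r > 0" for r unfolding t_def using m by (intro sum_pos) auto
  define A where "A r \<omega> = (\<Sum>q\<le>r. m ^ q * U q \<omega>) / t r" for r \<omega>
  have sqA: "square_integrable M (A r)" for r
  proof -
    have "square_integrable M (\<lambda>\<omega>. 1 / t r * (\<Sum>q\<le>r. m ^ q * U q \<omega>))"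
      by (intro square_integrable_scale square_integrable_sum sq(1))
    then show ?thesis by (simp add: A_def[abs_def])
  qed
  have i: "integrable M (\<lambda>\<omega>. (U q \<omega> - V \<omega>)\<^sup>2)" for q
    using square_integrable_diff[OF sq] by (simp add: square_integrable_def)
  have "(\<integral>\<omega>. (A r \<omega> - V \<omega>)\<^sup>2 \<partial>M) \<le> (\<Sum>q\<le>r. m ^ q * (\<integral>\<omega>. (U q \<omega> - V \<omega>)\<^sup>2 \<partial>M)) / t r" for r
  proof -
    have "(A r \<omega> - V \<omega>)\<^sup>2 \<le> (\<Sum>q\<le>r. m ^ q * (U q \<omega> - V \<omega>)\<^sup>2) / t r" for \<omega>
    proof -
      have "A r \<omega> - V \<omega> = (\<Sum>q\<le>r. m ^ q * (U q \<omega> - V \<omega>)) / t r"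
        using t[of r] by (simp add: A_def right_diff_distrib sum_subtractf sum_distrib_left t_def field_simps)
      then have "(A r \<omega> - V \<omega>)\<^sup>2 = (\<Sum>q\<le>r. m ^ q * (U q \<omega> - V \<omega>))\<^sup>2 / (t r)\<^sup>2"
        by (simp add: power_divide)
      also have "\<dots> \<le> (t r * (\<Sum>q\<le>r. m ^ q * (U q \<omega> - V \<omega>)\<^sup>2)) / (t r)\<^sup>2"
        unfolding t_def using m by (intro divide_right_mono weighted_sum_power2_le) auto
      also have "\<dots> = (\<Sum>q\<le>r. m ^ q * (U q \<omega> - V \<omega>)\<^sup>2) / t r"
        using t[of r] by (simp add: power2_eq_square)
      finally show ?thesis .
    qed
    then have "(\<integral>\<omega>. (A r \<omega> - V \<omega>)\<^sup>2 \<partial>M) \<le> (\<integral>\<omega>. (\<Sum>q\<le>r. m ^ q * (U q \<omega> - V \<omega>)\<^sup>2) / t r \<partial>M)"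
      using square_integrable_diff[OF sqA sq(2)] i
      by (intro integral_mono integrable_divide Bochner_Integration.integrable_sum integrable_mult_right)
        (auto simp: square_integrable_def)
    also have "\<dots> = (\<Sum>q\<le>r. m ^ q * (\<integral>\<omega>. (U q \<omega> - V \<omega>)\<^sup>2 \<partial>M)) / t r"
      using i by simp
    finally show ?thesis .
  qed
  note le = this
  have "(\<lambda>r. \<integral>\<omega>. (A r \<omega> - V \<omega>)\<^sup>2 \<partial>M) \<longlonglongrightarrow> 0"
  proof (rule tendsto_sandwich[OF always_eventually always_eventually tendsto_const])
    show "(\<lambda>r. (\<Sum>q\<le>r. m ^ q * (\<integral>\<omega>. (U q \<omega> - V \<omega>)\<^sup>2 \<partial>M)) / t r) \<longlonglongrightarrow> 0"
      unfolding t_def using UV m by (intro geometric_average_tendsto_0) (auto simp: converges_L2_def)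
  qed (use le in auto)
  then show ?thesis
    using sq sqA unfolding converges_L2_def A_def[abs_def] t_def by blast
qed

context bmc_class
begin

abbreviation Z :: "nat \<Rightarrow> 'w \<Rightarrow> real" where
  "Z n \<omega> \<equiv> real (card (alive X (gen n) \<omega>))"

abbreviation W :: "'w \<Rightarrow> real" where
  "W \<equiv> gw_limit m X"

lemma Z_eq_popsum: "Z n = popsum n (\<lambda>_. 1)"
  by (rule HOL.ext) (simp add: card_alive popsum_def)

lemma Z_measurable [measurable]: "Z n \<in> borel_measurable M"
  using popsum_square_integrable[OF F_const] unfolding Z_eq_popsum by (simp add: square_integrable_def)

lemma Q_one: "(Q ^^ n) (\<lambda>_. 1) = (\<lambda>_. 1)"
proof (induction n)
  case (Suc n)
  have "Q (\<lambda>_. 1) = (\<lambda>_. 1)"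
    using m_gt_1 marg_kernel_const[of 1] by (simp add: Q_eq F_const)
  then show ?case using Suc by simp
qed simp

lemma prob_space_\<nu>: "prob_space \<nu>"
  using BMC by (simp add: BMC_def)

lemma Z_expectation: "expectation (Z n) = m ^ n"
  unfolding Z_eq_popsum popsum_expectation[OF F_const] Q_one
  using prob_space.prob_space[OF prob_space_\<nu>] by simp

lemma Z_square_integrable: "square_integrable M (\<lambda>\<omega>. Z n \<omega> / m ^ n)"
  using square_integrable_scale[OF popsum_square_integrable[OF F_const], of "1 / m ^ n" n 1]
  by (simp add: Z_eq_popsum[THEN fun_cong])

lemma Z_increments:
  "\<exists>C. \<forall>n. expectation (\<lambda>\<omega>. (Z (Suc n) \<omega> / m ^ Suc n - Z n \<omega> / m ^ n)\<^sup>2) \<le> C * (1 / m) ^ n"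
proof -
  let ?e = "ext (\<lambda>_::'a. 1)"
  have m: "m > 0" using m_gt_1 by simp
  define \<phi> :: "'a option \<times> 'a option \<times> 'a option \<Rightarrow> real"
    where "\<phi> u = ?e (daughter False u) + ?e (daughter True u) - m * ?e (fst u)" for u
  have [measurable]: "\<phi> \<in> borel_measurable bar3" unfolding \<phi>_def by measurable
  have e: "0 \<le> ?e y" "?e y \<le> 1" for y by (cases y; simp)+
  have b: "\<bar>\<phi> u\<bar> \<le> 2 + m" for u
    using e[of "daughter False u"] e[of "daughter True u"] e[of "fst u"] m mult_left_mono[OF e(2)[of "fst u"], of m]
      mult_nonneg_nonneg[OF less_imp_le[OF m] e(1)[of "fst u"]]
    unfolding \<phi>_def by linarith
  have b2: "(\<phi> u)\<^sup>2 \<le> (2 + m)\<^sup>2" for u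
    using b[of u] m by (intro power2_le_iff_abs_le[THEN iffD2]) auto
  have i1: "integrable (triple_kernel K y) \<phi>" for y by (rule triple_kernel_bounded[OF _ b]) measurable
  have i2: "integrable (triple_kernel K y) (\<lambda>u. (\<phi> u)\<^sup>2)" for y
    by (rule triple_kernel_bounded[where C = "(2 + m)\<^sup>2"]) (auto simp: b2)
  have k1: "kapp K \<phi> y = 0" for y
  proof -
    interpret P: prob_space "triple_kernel K y" by (rule prob_space_triple_kernel)
    have i: "integrable (triple_kernel K y) (\<lambda>u. ?e (fst u))"
      by (rule triple_kernel_bounded[where C = 1]) (auto simp: e)
    have "P.expectation (\<lambda>u. ?e (fst u)) = P.expectation (\<lambda>u. ?e y)"
      using AE_triple_kernel_fst[of y] by (intro integral_cong_AE) auto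
    then have ey: "P.expectation (\<lambda>u. ?e (fst u)) = ?e y" using P.prob_space by simp
    have "kapp K \<phi> y = kapp K (\<lambda>u. ?e (daughter False u)) y + kapp K (\<lambda>u. ?e (daughter True u)) y - m * ?e y"
      using i ey ext_daughter_integrable[OF F_const] by (simp add: kapp_eq \<phi>_def)
    also have "\<dots> = 0"
      unfolding ext_daughter_kapp[OF F_const] using marg_kernel_const[of 1] by (cases y) auto
    finally show ?thesis .
  qed
  have k2: "kapp K (\<lambda>u. (\<phi> u)\<^sup>2) y \<le> ext (\<lambda>_. (2 + m)\<^sup>2) y" for y
  proof (cases y)
    case None
    then show ?thesis by (simp add: kapp_eq triple_kernel_None \<phi>_def daughter_def)
  next
    case (Some x)
    interpret P: prob_space "triple_kernel K y" by (rule prob_space_triple_kernel)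
    have "P.expectation (\<lambda>u. (\<phi> u)\<^sup>2) \<le> (2 + m)\<^sup>2"
      by (rule P.integral_le_const[OF i2]) (simp add: b2)
    then show ?thesis using Some by (simp add: kapp_eq)
  qed
  obtain C where C: "\<And>n. expectation (\<lambda>\<omega>. (\<Sum>i\<in>gen n. \<phi> (triple X i \<omega>))\<^sup>2) \<le> C * m ^ n"
    using centered_sum_second_moment[OF _ i1 i2 F_const k1 k2] by auto
  have "expectation (\<lambda>\<omega>. (Z (Suc n) \<omega> / m ^ Suc n - Z n \<omega> / m ^ n)\<^sup>2) \<le> (C / m\<^sup>2) * (1 / m) ^ n" for n
  proof -
    have "Z (Suc n) \<omega> - m * Z n \<omega> = (\<Sum>i\<in>gen n. \<phi> (triple X i \<omega>))" for \<omega>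
      by (simp add: card_alive sum_gen_Suc \<phi>_def daughter_triple fst_triple sum_subtractf sum_distrib_left)
    moreover have "Z (Suc n) \<omega> / m ^ Suc n - Z n \<omega> / m ^ n = (Z (Suc n) \<omega> - m * Z n \<omega>) / m ^ Suc n" for \<omega>
      using m by (simp add: field_simps)
    ultimately have "expectation (\<lambda>\<omega>. (Z (Suc n) \<omega> / m ^ Suc n - Z n \<omega> / m ^ n)\<^sup>2)
        = expectation (\<lambda>\<omega>. (\<Sum>i\<in>gen n. \<phi> (triple X i \<omega>))\<^sup>2) / (m ^ Suc n)\<^sup>2"
      by (simp add: power_divide)
    also have "\<dots> \<le> C * m ^ n / (m ^ Suc n)\<^sup>2"
      using C by (intro divide_right_mono) auto
    also have "\<dots> = (C / m\<^sup>2) * (1 / m) ^ n"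
      using m by (simp add: power_one_over power2_eq_square field_simps)
    finally show ?thesis .
  qed
  then show ?thesis by blast
qed

lemma W_L2: "converges_L2 M (\<lambda>n \<omega>. Z n \<omega> / m ^ n) W"
  and W_AE: "AE \<omega> in M. (\<lambda>n. Z n \<omega> / m ^ n) \<longlonglongrightarrow> W \<omega>"
proof -
  obtain C where C: "\<And>n. expectation (\<lambda>\<omega>. (Z (Suc n) \<omega> / m ^ Suc n - Z n \<omega> / m ^ n)\<^sup>2) \<le> C * (1 / m) ^ n"
    using Z_increments by blast
  have r: "0 < 1 / m" "1 / m < 1" using m_gt_1 by auto
  show "converges_L2 M (\<lambda>n \<omega>. Z n \<omega> / m ^ n) W"
    using geometric_increments_converges_L2[OF prob_space_axioms Z_square_integrable C r]
    by (simp add: gw_limit_def[abs_def])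
  show "AE \<omega> in M. (\<lambda>n. Z n \<omega> / m ^ n) \<longlonglongrightarrow> W \<omega>"
    using geometric_increments_AE[OF prob_space_axioms Z_square_integrable C r]
    by (simp add: gw_limit_def convergent_LIMSEQ_iff)
qed

end

locale bmc_observable = bmc_class K p10 p0 p1 m M \<nu> X \<mu> F N Y
  for K :: "('a::metric_space) bkernel" and p10 p0 p1 m and M :: "'w measure" and \<nu> and X
    and \<mu> :: "'a measure" and F and N :: "'a \<Rightarrow> 'c measure" and Y +
  fixes f :: "'a option \<times> 'a option \<times> 'a option \<Rightarrow> real"
  assumes f_measurable [measurable]: "f \<in> borel_measurable bar3"
    and f_exists: "kapp_exists K f" and f_class: "in_class (kapp K f) F"
    and f2_exists: "kapp_exists K (\<lambda>u. (f u)\<^sup>2)" and f2_class: "in_class (kapp K (\<lambda>u. (f u)\<^sup>2)) F"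
begin

definition h :: "'a \<Rightarrow> real" where "h x = kapp K f (Some x)"

definition c :: real where "c = (\<integral>x. h x \<partial>\<mu>)"

definition gen_avg :: "nat \<Rightarrow> 'w \<Rightarrow> real" where
  "gen_avg q \<omega> = (\<Sum>i\<in>alive X (gen q) \<omega>. f (triple X i \<omega>)) / m ^ q"

lemma h_in_F: "h \<in> F"
  using f_class by (simp add: in_class_def h_def[abs_def] comp_def)

lemma gen_sum_approx:
  "\<exists>C. \<forall>q. square_integrable M (\<lambda>\<omega>. (\<Sum>i\<in>alive X (gen q) \<omega>. f (triple X i \<omega>)) - popsum q h \<omega>) \<and>
    expectation (\<lambda>\<omega>. ((\<Sum>i\<in>alive X (gen q) \<omega>. f (triple X i \<omega>)) - popsum q h \<omega>)\<^sup>2) \<le> C * m ^ q"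
proof -
  note [measurable] = F_measurable[OF h_in_F]
  define \<phi> where "\<phi> u = (if fst u = None then 0 else f u) - ext h (fst u)" for u
  have \<phi> [measurable]: "\<phi> \<in> borel_measurable bar3" unfolding \<phi>_def by measurable
  have f1: "integrable (triple_kernel K y) f" for y using f_exists by (simp add: kapp_exists_iff)
  have f2: "integrable (triple_kernel K y) (\<lambda>u. (f u)\<^sup>2)" for y using f2_exists by (simp add: kapp_exists_iff)
  have AE0: "AE u in triple_kernel K None. \<phi> u = 0"
    using AE_triple_kernel_fst[of None] by eventually_elim (simp add: \<phi>_def)
  have AE1: "AE u in triple_kernel K (Some x). \<phi> u = f u - h x" for x
    using AE_triple_kernel_fst[of "Some x"] by eventually_elim (simp add: \<phi>_def)
  have K1: "integrable (triple_kernel K (Some x)) \<phi> \<and> kapp K \<phi> (Some x) = 0" for x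
  proof
    interpret P: prob_space "triple_kernel K (Some x)" by (rule prob_space_triple_kernel)
    have "integrable (triple_kernel K (Some x)) \<phi> \<longleftrightarrow> integrable (triple_kernel K (Some x)) (\<lambda>u. f u - h x)"
      using AE1 by (intro integrable_cong_AE) auto
    then show "integrable (triple_kernel K (Some x)) \<phi>" using f1 by simp
    have "kapp K \<phi> (Some x) = P.expectation (\<lambda>u. f u - h x)"
      unfolding kapp_eq[OF \<phi>] using AE1 by (intro integral_cong_AE) auto
    then show "kapp K \<phi> (Some x) = 0" using f1 P.prob_space by (simp add: h_def kapp_eq)
  qed
  have K2: "integrable (triple_kernel K (Some x)) (\<lambda>u. (\<phi> u)\<^sup>2) \<and>
      kapp K (\<lambda>u. (\<phi> u)\<^sup>2) (Some x) \<le> kapp K (\<lambda>u. (f u)\<^sup>2) (Some x)" for x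
  proof
    interpret P: prob_space "triple_kernel K (Some x)" by (rule prob_space_triple_kernel)
    have i: "integrable (triple_kernel K (Some x)) (\<lambda>u. (f u - h x)\<^sup>2)"
      using f1 f2 by (simp add: power2_diff)
    have "integrable (triple_kernel K (Some x)) (\<lambda>u. (\<phi> u)\<^sup>2) \<longleftrightarrow> integrable (triple_kernel K (Some x)) (\<lambda>u. (f u - h x)\<^sup>2)"
      using AE1[of x] by (intro integrable_cong_AE) auto
    then show "integrable (triple_kernel K (Some x)) (\<lambda>u. (\<phi> u)\<^sup>2)" using i by simp
    have "kapp K (\<lambda>u. (\<phi> u)\<^sup>2) (Some x) = P.expectation (\<lambda>u. (f u - h x)\<^sup>2)"
      unfolding kapp_eq[OF borel_measurable_power[OF \<phi>]] using AE1[of x] by (intro integral_cong_AE) auto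
    also have "\<dots> = P.variance f"
      by (simp add: h_def kapp_eq)
    also have "\<dots> \<le> kapp K (\<lambda>u. (f u)\<^sup>2) (Some x)"
      using P.variance_eq[OF f1 f2] by (simp add: kapp_eq)
    finally show "kapp K (\<lambda>u. (\<phi> u)\<^sup>2) (Some x) \<le> kapp K (\<lambda>u. (f u)\<^sup>2) (Some x)" .
  qed
  have "\<exists>C. \<forall>n. square_integrable M (\<lambda>\<omega>. \<Sum>i\<in>gen n. \<phi> (triple X i \<omega>)) \<and>
      expectation (\<lambda>\<omega>. (\<Sum>i\<in>gen n. \<phi> (triple X i \<omega>))\<^sup>2) \<le> C * m ^ n"
  proof (rule centered_sum_second_moment[OF \<phi>])
    show "kapp K (\<lambda>u. (f u)\<^sup>2) \<circ> Some \<in> F" using f2_class by (simp add: in_class_def)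
    show "integrable (triple_kernel K y) \<phi>" for y
      using K1 by (cases y) (auto intro: triple_kernel_None)
    show "integrable (triple_kernel K y) (\<lambda>u. (\<phi> u)\<^sup>2)" for y
      using K2 by (cases y) (auto intro!: triple_kernel_None)
    show "kapp K \<phi> y = 0" for y
      using K1 by (cases y) (auto simp: kapp_eq triple_kernel_None \<phi>_def)
    show "kapp K (\<lambda>u. (\<phi> u)\<^sup>2) y \<le> ext (kapp K (\<lambda>u. (f u)\<^sup>2) \<circ> Some) y" for y
      using K2 by (cases y) (auto simp: kapp_eq triple_kernel_None \<phi>_def)
  qed
  moreover have "(\<Sum>i\<in>gen q. \<phi> (triple X i \<omega>)) = (\<Sum>i\<in>alive X (gen q) \<omega>. f (triple X i \<omega>)) - popsum q h \<omega>" for q \<omega>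
    by (simp add: sum_alive \<phi>_def popsum_def fst_triple sum_subtractf)
  ultimately show ?thesis by simp
qed

lemma gen_avg_L2: "converges_L2 M gen_avg (\<lambda>\<omega>. c * W \<omega>)"
proof -
  have m: "m > 0" using m_gt_1 by simp
  let ?R = "\<lambda>q \<omega>. (\<Sum>i\<in>alive X (gen q) \<omega>. f (triple X i \<omega>)) - popsum q h \<omega>"
  obtain C where C: "\<And>q. square_integrable M (?R q)" "\<And>q. expectation (\<lambda>\<omega>. (?R q \<omega>)\<^sup>2) \<le> C * m ^ q"
    using gen_sum_approx by blast
  have R: "converges_L2 M (\<lambda>q \<omega>. 1 / m ^ q * ?R q \<omega>) (\<lambda>_. 0)"
  proof (rule converges_L2_zeroI)
    show "square_integrable M (\<lambda>\<omega>. 1 / m ^ q * ?R q \<omega>)" for q by (rule square_integrable_scale[OF C(1)])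
    show "(\<lambda>q. expectation (\<lambda>\<omega>. (1 / m ^ q * ?R q \<omega>)\<^sup>2)) \<longlonglongrightarrow> 0"
    proof (rule tendsto_sandwich[OF always_eventually always_eventually tendsto_const])
      show "(\<lambda>q. C * (1 / m) ^ q) \<longlonglongrightarrow> 0"
        using m_gt_1 by (intro tendsto_mult_right_zero LIMSEQ_power_zero) simp
      show "\<forall>q. expectation (\<lambda>\<omega>. (1 / m ^ q * ?R q \<omega>)\<^sup>2) \<le> C * (1 / m) ^ q"
      proof
        fix q
        have "expectation (\<lambda>\<omega>. (1 / m ^ q * ?R q \<omega>)\<^sup>2) = expectation (\<lambda>\<omega>. (?R q \<omega>)\<^sup>2) / (m ^ q)\<^sup>2"
          by (simp add: power_divide)
        also have "\<dots> \<le> C * m ^ q / (m ^ q)\<^sup>2" using C(2) by (intro divide_right_mono) auto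
        also have "\<dots> = C * (1 / m) ^ q" using m by (simp add: power_one_over power2_eq_square)
        finally show "expectation (\<lambda>\<omega>. (1 / m ^ q * ?R q \<omega>)\<^sup>2) \<le> C * (1 / m) ^ q" .
      qed
    qed auto
  qed
  let ?g = "\<lambda>x. h x - c"
  have g: "?g \<in> F" by (rule F_diff_const[OF h_in_F])
  have g0: "(\<integral>x. ?g x \<partial>\<mu>) = 0"
    using F_\<mu>[OF h_in_F] F_\<mu>[OF F_const] prob_space.prob_space[OF prob_space_\<mu>] by (simp add: c_def)
  have G: "converges_L2 M (\<lambda>q \<omega>. popsum q ?g \<omega> / m ^ q) (\<lambda>_. 0)"
    using popsum_normalized_tendsto_0[OF g g0] square_integrable_scale[OF popsum_square_integrable[OF g], of "1 / m ^ q" for q]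
    by (intro converges_L2_zeroI) auto
  have "gen_avg q \<omega> = (1 / m ^ q * ?R q \<omega> + popsum q ?g \<omega> / m ^ q) + c * (Z q \<omega> / m ^ q)" for q \<omega>
  proof -
    have "ext ?g y = ext h y - c * ext (\<lambda>_. 1) y" for y by (cases y) auto
    then have "popsum q ?g \<omega> = popsum q h \<omega> - c * Z q \<omega>"
      by (simp add: popsum_def card_alive sum_subtractf sum_distrib_left)
    then show ?thesis by (simp add: gen_avg_def diff_divide_distrib)
  qed
  then show ?thesis
    using converges_L2_add[OF converges_L2_add[OF R G] converges_L2_scale[OF W_L2, of c]]
    by (simp add: gen_avg_def[abs_def])
qed

definition tree_avg :: "nat \<Rightarrow> 'w \<Rightarrow> real" where
  "tree_avg r \<omega> = (\<Sum>i\<in>alive X (tree_upto r) \<omega>. f (triple X i \<omega>)) / (\<Sum>q\<le>r. m ^ q)"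

lemma tree_avg_L2: "converges_L2 M tree_avg (\<lambda>\<omega>. c * W \<omega>)"
proof -
  have "(\<Sum>i\<in>alive X (tree_upto r) \<omega>. f (triple X i \<omega>)) = (\<Sum>q\<le>r. m ^ q * gen_avg q \<omega>)" for r \<omega>
    using m_gt_1 by (simp add: gen_avg_def sum_alive sum_tree_upto)
  then show ?thesis
    using converges_L2_geometric_average[OF gen_avg_L2 m_gt_1] by (simp add: tree_avg_def[abs_def])
qed

end

section \<open>Quotients on the survival event\<close>

lemma Chebyshev_L2:
  assumes "prob_space M" "square_integrable M R" "a > 0"
  shows "measure M {\<omega> \<in> space M. \<bar>R \<omega>\<bar> > a} \<le> (\<integral>\<omega>. (R \<omega>)\<^sup>2 \<partial>M) / a\<^sup>2"
proof -
  interpret prob_space M by fact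
  have [measurable]: "R \<in> borel_measurable M" using assms(2) by (simp add: square_integrable_def)
  have "measure M {\<omega> \<in> space M. \<bar>R \<omega>\<bar> > a} \<le> measure M {\<omega> \<in> space M. (R \<omega>)\<^sup>2 \<ge> a\<^sup>2}"
    using assms(3) by (intro finite_measure_mono) (auto simp: abs_le_square_iff[symmetric])
  also have "\<dots> \<le> (\<integral>\<omega>. (R \<omega>)\<^sup>2 \<partial>M) / a\<^sup>2"
    using assms(2,3) by (intro integral_Markov_inequality_measure[where A = "space M"]) (auto simp: square_integrable_def)
  finally show ?thesis .
qed

lemma converges_L2_tail:
  assumes "prob_space M" "converges_L2 M U V" "a > 0"
  shows "(\<lambda>n. measure M {\<omega> \<in> space M. \<bar>U n \<omega> - V \<omega>\<bar> > a}) \<longlonglongrightarrow> 0"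
proof (rule tendsto_sandwich[OF always_eventually always_eventually tendsto_const])
  show "(\<lambda>n. (\<integral>\<omega>. (U n \<omega> - V \<omega>)\<^sup>2 \<partial>M) / a\<^sup>2) \<longlonglongrightarrow> 0"
    using assms(2) by (intro tendsto_divide_zero) (simp add: converges_L2_def)
  show "\<forall>n. measure M {\<omega> \<in> space M. \<bar>U n \<omega> - V \<omega>\<bar> > a} \<le> (\<integral>\<omega>. (U n \<omega> - V \<omega>)\<^sup>2 \<partial>M) / a\<^sup>2"
    using assms by (intro allI Chebyshev_L2 square_integrable_diff) (auto simp: converges_L2_def)
qed auto

lemma small_values_unlikely:
  fixes W :: "'w \<Rightarrow> real"
  assumes "prob_space M" and [measurable]: "W \<in> borel_measurable M" and "e > 0"
  shows "\<exists>\<delta>>0. measure M {\<omega> \<in> space M. 0 < \<bar>W \<omega>\<bar> \<and> \<bar>W \<omega>\<bar> < \<delta>} < e"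
proof -
  interpret prob_space M by fact
  define A where "A k = {\<omega> \<in> space M. 0 < \<bar>W \<omega>\<bar> \<and> \<bar>W \<omega>\<bar> < 1 / real (Suc k)}" for k
  have "(\<lambda>k. measure M (A k)) \<longlonglongrightarrow> measure M (\<Inter>k. A k)"
  proof (rule finite_Lim_measure_decseq)
    show "range A \<subseteq> sets M" unfolding A_def by auto
    show "decseq A"
    proof (rule decseq_SucI)
      fix k
      have "1 / real (Suc (Suc k)) \<le> 1 / real (Suc k)" by (rule divide_left_mono) auto
      then show "A (Suc k) \<subseteq> A k" unfolding A_def by auto
    qed
  qed
  moreover have "(\<Inter>k. A k) = {}"
  proof (rule equals0I)
    fix \<omega> assume w: "\<omega> \<in> (\<Inter>k. A k)"
    then have "0 < \<bar>W \<omega>\<bar>" by (auto simp: A_def)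
    then obtain k where "1 / real (Suc k) < \<bar>W \<omega>\<bar>" using nat_approx_posE by blast
    moreover have "\<bar>W \<omega>\<bar> < 1 / real (Suc k)" using w by (auto simp: A_def)
    ultimately show False by simp
  qed
  ultimately have "(\<lambda>k. measure M (A k)) \<longlonglongrightarrow> 0" by simp
  then have "\<forall>\<^sub>F k in sequentially. measure M (A k) < e"
    using assms(3) by (intro order_tendstoD(2)) auto
  then obtain k where "measure M (A k) < e" by (auto simp: eventually_sequentially)
  then show ?thesis unfolding A_def by (intro exI[of _ "1 / real (Suc k)"]) simp
qed

lemma converges_prob_quotient:
  fixes U V :: "nat \<Rightarrow> 'w \<Rightarrow> real"
  assumes prob: "prob_space M"
    and U: "converges_L2 M U (\<lambda>\<omega>. c * W \<omega>)" and V: "converges_L2 M V W"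
    and A [measurable]: "\<And>n. Measurable.pred M (A n)"
    and A0: "(\<lambda>n. measure M {\<omega> \<in> space M. A n \<omega> \<and> W \<omega> = 0}) \<longlonglongrightarrow> 0"
    and A1: "\<And>n. AE \<omega> in M. \<not> A n \<omega> \<longrightarrow> W \<omega> = 0"
  shows "converges_prob M (\<lambda>n \<omega>. if A n \<omega> then U n \<omega> / V n \<omega> else 0) (\<lambda>\<omega>. c * (if W \<omega> \<noteq> 0 then 1 else 0))"
proof -
  interpret prob_space M by fact
  have [measurable]: "U n \<in> borel_measurable M" "V n \<in> borel_measurable M" "W \<in> borel_measurable M" for n
    using U V by (auto simp: converges_L2_def square_integrable_def)
  let ?q = "\<lambda>n \<omega>. if A n \<omega> then U n \<omega> / V n \<omega> else 0" and ?l = "\<lambda>\<omega>. c * (if W \<omega> \<noteq> 0 then 1 else 0)"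
  have R: "converges_L2 M (\<lambda>n \<omega>. U n \<omega> + - c * V n \<omega>) (\<lambda>_. 0)"
    using converges_L2_add[OF U converges_L2_scale[OF V, of "- c"]] by simp
  have "(\<lambda>n. measure M {\<omega> \<in> space M. \<bar>?q n \<omega> - ?l \<omega>\<bar> > \<epsilon>}) \<longlonglongrightarrow> 0" if \<epsilon>: "\<epsilon> > 0" for \<epsilon>
  proof (rule LIMSEQ_I)
    fix e :: real assume e: "e > 0"
    then obtain \<delta> where \<delta>: "\<delta> > 0" "measure M {\<omega> \<in> space M. 0 < \<bar>W \<omega>\<bar> \<and> \<bar>W \<omega>\<bar> < \<delta>} < e / 2"
      using small_values_unlikely[OF prob, of W "e / 2"] by auto
    define T where "T n = measure M {\<omega> \<in> space M. A n \<omega> \<and> W \<omega> = 0} + measure M {\<omega> \<in> space M. \<bar>V n \<omega> - W \<omega>\<bar> > \<delta> / 2}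
      + measure M {\<omega> \<in> space M. \<bar>U n \<omega> + - c * V n \<omega>\<bar> > \<epsilon> * (\<delta> / 2)}" for n
    have "T \<longlonglongrightarrow> 0 + 0 + 0"
      unfolding T_def using converges_L2_tail[OF prob R, of "\<epsilon> * (\<delta> / 2)"] \<epsilon> \<delta>(1)
      by (intro tendsto_add A0 converges_L2_tail[OF prob V]) auto
    then have "\<forall>\<^sub>F n in sequentially. T n < e / 2"
      using e by (intro order_tendstoD(2)) auto
    then obtain n0 where n0: "\<And>n. n \<ge> n0 \<Longrightarrow> T n < e / 2" by (auto simp: eventually_sequentially)
    have "measure M {\<omega> \<in> space M. \<bar>?q n \<omega> - ?l \<omega>\<bar> > \<epsilon>} < e" if n: "n \<ge> n0" for n
    proof -
      let ?B1 = "{\<omega> \<in> space M. A n \<omega> \<and> W \<omega> = 0}" and ?B2 = "{\<omega> \<in> space M. \<bar>V n \<omega> - W \<omega>\<bar> > \<delta> / 2}"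
        and ?B3 = "{\<omega> \<in> space M. \<bar>U n \<omega> + - c * V n \<omega>\<bar> > \<epsilon> * (\<delta> / 2)}"
        and ?B4 = "{\<omega> \<in> space M. 0 < \<bar>W \<omega>\<bar> \<and> \<bar>W \<omega>\<bar> < \<delta>}"
      have B: "?B1 \<in> sets M" "?B2 \<in> sets M" "?B3 \<in> sets M" "?B4 \<in> sets M" by measurable
      have "measure M {\<omega> \<in> space M. \<bar>?q n \<omega> - ?l \<omega>\<bar> > \<epsilon>} \<le> measure M (?B1 \<union> ?B2 \<union> ?B3 \<union> ?B4)"
      proof (rule finite_measure_mono_AE)
        show "AE \<omega> in M. \<omega> \<in> {\<omega> \<in> space M. \<bar>?q n \<omega> - ?l \<omega>\<bar> > \<epsilon>} \<longrightarrow> \<omega> \<in> ?B1 \<union> ?B2 \<union> ?B3 \<union> ?B4"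
          using A1[of n]
        proof eventually_elim
          case (elim \<omega>)
          show ?case
          proof (intro impI, rule ccontr)
            assume w: "\<omega> \<in> {\<omega> \<in> space M. \<bar>?q n \<omega> - ?l \<omega>\<bar> > \<epsilon>}" and nB: "\<omega> \<notin> ?B1 \<union> ?B2 \<union> ?B3 \<union> ?B4"
            have W0: "W \<omega> \<noteq> 0"
            proof
              assume "W \<omega> = 0"
              moreover from this nB w have "\<not> A n \<omega>" by auto
              ultimately show False using w \<epsilon> by simp
            qed
            with elim have An: "A n \<omega>" by auto
            have b: "\<bar>V n \<omega> - W \<omega>\<bar> \<le> \<delta> / 2" "\<bar>U n \<omega> + - c * V n \<omega>\<bar> \<le> \<epsilon> * (\<delta> / 2)" "\<bar>W \<omega>\<bar> \<ge> \<delta>"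
              using w nB W0 by auto
            then have v: "\<bar>V n \<omega>\<bar> \<ge> \<delta> / 2" by linarith
            then have v0: "V n \<omega> \<noteq> 0" using \<delta>(1) by auto
            have "\<epsilon> < \<bar>U n \<omega> / V n \<omega> - c\<bar>" using w An W0 by simp
            also have "U n \<omega> / V n \<omega> - c = (U n \<omega> + - c * V n \<omega>) / V n \<omega>" using v0 by (simp add: field_simps)
            finally have "\<epsilon> * \<bar>V n \<omega>\<bar> < \<bar>U n \<omega> + - c * V n \<omega>\<bar>" using v0 by (simp add: abs_divide pos_less_divide_eq)
            moreover have "\<epsilon> * (\<delta> / 2) \<le> \<epsilon> * \<bar>V n \<omega>\<bar>" using v \<epsilon> by (intro mult_left_mono) auto
            ultimately show False using b(2) by linarith
          qed
        qed
        show "?B1 \<union> ?B2 \<union> ?B3 \<union> ?B4 \<in> sets M" using B by blast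
      qed
      also have "\<dots> \<le> measure M (?B1 \<union> ?B2 \<union> ?B3) + measure M ?B4"
        using B by (intro measure_Un_le) auto
      also have "measure M (?B1 \<union> ?B2 \<union> ?B3) \<le> measure M (?B1 \<union> ?B2) + measure M ?B3"
        using B by (intro measure_Un_le) auto
      also have "measure M (?B1 \<union> ?B2) \<le> measure M ?B1 + measure M ?B2"
        using B by (intro measure_Un_le) auto
      finally show ?thesis using n0[OF n] \<delta>(2) unfolding T_def by linarith
    qed
    then show "\<exists>n0. \<forall>n\<ge>n0. norm (measure M {\<omega> \<in> space M. \<bar>?q n \<omega> - ?l \<omega>\<bar> > \<epsilon>} - 0) < e"
      by (intro exI[of _ n0]) auto
  qed
  then show ?thesis unfolding converges_prob_def by auto
qed

context bmc_class
begin

definition pgf :: "real \<Rightarrow> real" where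
  "pgf s = p_none + (p0 + p1) * s + p10 * s\<^sup>2"

lemma pgf_one: "pgf 1 = 1"
  by (simp add: pgf_def p_none_def)

lemma pgf_mono: "0 \<le> s \<Longrightarrow> s \<le> t \<Longrightarrow> pgf s \<le> pgf t"
  unfolding pgf_def using offspring_nonneg by (intro add_mono mult_left_mono power_mono) auto

lemma pgf_range: "0 \<le> s \<Longrightarrow> s \<le> 1 \<Longrightarrow> 0 \<le> pgf s \<and> pgf s \<le> 1"
  using pgf_mono[of s 1] pgf_one offspring_nonneg by (simp add: pgf_def)

lemma power_card_alive:
  "finite J \<Longrightarrow> s ^ card (alive X J \<omega>) = (\<Prod>i\<in>J. if X i \<omega> = None then 1 else s)" for s :: real
proof -
  assume J: "finite J"
  have "s ^ card (alive X J \<omega>) = (\<Prod>i\<in>alive X J \<omega>. s)" by simp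
  also have "\<dots> = (\<Prod>i\<in>J. if X i \<omega> \<noteq> None then s else 1)"
    unfolding alive_def by (rule prod.inter_filter[OF J])
  also have "\<dots> = (\<Prod>i\<in>J. if X i \<omega> = None then 1 else s)" by (intro prod.cong) auto
  finally show ?thesis .
qed

lemma Z_pgf:
  "0 \<le> s \<Longrightarrow> s \<le> 1 \<Longrightarrow> expectation (\<lambda>\<omega>. s ^ card (alive X (gen n) \<omega>)) = (pgf ^^ n) s"
proof (induction n arbitrary: s)
  case 0
  have "s ^ card (alive X (gen 0) \<omega>) = 1 - (1 - s) * ext (\<lambda>_. 1) (X [] \<omega>)" for \<omega>
    by (cases "X [] \<omega>") (simp_all add: power_card_alive gen_0)
  then show ?case
    using X_root_integral[OF F_const, of 1] prob_space prob_space.prob_space[OF prob_space_\<nu>] by simp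
next
  case (Suc n)
  define g where "g u = (if daughter False u = None then 1 else s) * (if daughter True u = None then 1 else s)"
    for u :: "'a option \<times> 'a option \<times> 'a option"
  have g [measurable]: "g \<in> borel_measurable bar3" unfolding g_def by measurable
  have gb: "bounded (range g)"
    using Suc.prems by (intro boundedI[of _ 1]) (auto simp: g_def abs_mult mult_le_one)
  have kg: "kapp K g y = (if y = None then 1 else pgf s)" for y
  proof (cases y)
    case None
    then show ?thesis by (simp add: kapp_eq triple_kernel_None) (simp add: g_def daughter_def)
  next
    case (Some x)
    have "g u = (if daughter False u \<noteq> None then s else 1) * (if daughter True u \<noteq> None then s else 1)" for u
      by (simp add: g_def)
    then show ?thesis
      using Some flag_integral[where h = "\<lambda>a b. (if a then s else 1) * (if b then s else 1)" and x = x]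
      by (simp add: kapp_eq pgf_def algebra_simps power2_eq_square del: not_None_eq)
  qed
  have "expectation (\<lambda>\<omega>. s ^ card (alive X (gen (Suc n)) \<omega>)) = expectation (\<lambda>\<omega>. \<Prod>i\<in>gen n. g (triple X i \<omega>))"
    by (simp add: power_card_alive prod_gen_Suc g_def daughter_triple)
  also have "\<dots> = expectation (\<lambda>\<omega>. \<Prod>i\<in>gen n. kapp K g (X i \<omega>))"
    by (rule expectation_prod) (simp_all add: gb)
  also have "\<dots> = expectation (\<lambda>\<omega>. pgf s ^ card (alive X (gen n) \<omega>))"
    by (simp add: kg power_card_alive)
  also have "\<dots> = (pgf ^^ Suc n) s"
    using Suc.IH[of "pgf s"] pgf_range[OF Suc.prems] by (simp add: funpow_Suc_right del: funpow.simps)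
  finally show ?case .
qed

lemma W_measurable [measurable]: "W \<in> borel_measurable M"
  using W_L2 by (simp add: converges_L2_def square_integrable_def)

lemma W_nonneg: "AE \<omega> in M. 0 \<le> W \<omega>"
  using W_AE
proof eventually_elim
  case (elim \<omega>)
  show ?case by (rule LIMSEQ_le_const[OF elim]) (use m_gt_1 in auto)
qed

lemma W_expectation: "expectation W = 1"
proof -
  let ?D = "\<lambda>n \<omega>. Z n \<omega> / m ^ n"
  have sq: "square_integrable M (?D n)" "square_integrable M W" for n using W_L2 by (auto simp: converges_L2_def)
  note int = integrable_of_square_integrable[OF prob_space_axioms]
  have "(1 - expectation W)\<^sup>2 \<le> expectation (\<lambda>\<omega>. (?D n \<omega> - W \<omega>)\<^sup>2)" for n
  proof -
    have d: "square_integrable M (\<lambda>\<omega>. ?D n \<omega> - W \<omega>)" by (rule square_integrable_diff[OF sq])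
    have "expectation (\<lambda>\<omega>. ?D n \<omega> - W \<omega>) = 1 - expectation W"
      using int[OF sq(1)] int[OF sq(2)] Z_expectation[of n] m_gt_1 by simp
    moreover have "(expectation (\<lambda>\<omega>. ?D n \<omega> - W \<omega>))\<^sup>2 \<le> expectation (\<lambda>\<omega>. (?D n \<omega> - W \<omega>)\<^sup>2)"
    proof -
      have "integrable M (\<lambda>\<omega>. (?D n \<omega> - W \<omega>)\<^sup>2)" using d by (simp add: square_integrable_def)
      from variance_eq[OF int[OF d] this] variance_positive[of "\<lambda>\<omega>. ?D n \<omega> - W \<omega>"]
      show ?thesis by linarith
    qed
    ultimately show ?thesis by simp
  qed
  then have "(1 - expectation W)\<^sup>2 \<le> 0"
    using W_L2 unfolding converges_L2_def by (intro LIMSEQ_le_const[of _ 0]) auto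
  then show ?thesis by simp
qed

lemma offspring_supercritical: "p_none < p10"
  using m_gt_1 by (simp add: p_none_def m_eq mean_daughters_def)

text \<open>The Laplace transform \<open>L\<close> of \<open>W\<close> satisfies \<open>L (m \<theta>) = pgf (L \<theta>)\<close>; letting \<open>\<theta>\<close> tend to infinity,
  \<open>P(W = 0)\<close> is a fixed point of \<open>pgf\<close>, and it is not the fixed point \<open>1\<close> because \<open>E W = 1\<close>.\<close>

lemma prob_W_zero: "prob {\<omega> \<in> space M. W \<omega> = 0} = p_none / p10"
proof -
  define L where "L \<theta> = expectation (\<lambda>\<omega>. exp (- \<theta> * W \<omega>))" for \<theta>
  have m: "m > 0" using m_gt_1 by simp
  have Llim: "(\<lambda>q. (pgf ^^ q) (exp (- \<theta> / m ^ q))) \<longlonglongrightarrow> L \<theta>" if \<theta>: "\<theta> \<ge> 0" for \<theta>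
  proof -
    have "(\<lambda>q. expectation (\<lambda>\<omega>. exp (- \<theta> * (Z q \<omega> / m ^ q)))) \<longlonglongrightarrow> L \<theta>"
      unfolding L_def
    proof (rule integral_dominated_convergence[where w = "\<lambda>_. 1"])
      show "AE \<omega> in M. (\<lambda>q. exp (- \<theta> * (Z q \<omega> / m ^ q))) \<longlonglongrightarrow> exp (- \<theta> * W \<omega>)"
        using W_AE by eventually_elim (intro tendsto_intros)
      show "AE \<omega> in M. norm (exp (- \<theta> * (Z q \<omega> / m ^ q))) \<le> 1" for q
        using \<theta> m by (intro AE_I2) (simp add: divide_nonneg_nonneg)
    qed auto
    moreover have "expectation (\<lambda>\<omega>. exp (- \<theta> * (Z q \<omega> / m ^ q))) = (pgf ^^ q) (exp (- \<theta> / m ^ q))" for q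
    proof -
      have "exp (- \<theta> * (Z q \<omega> / m ^ q)) = exp (- \<theta> / m ^ q) ^ card (alive X (gen q) \<omega>)" for \<omega>
        by (simp add: exp_of_nat_mult[symmetric] mult.commute)
      then show ?thesis using Z_pgf[of "exp (- \<theta> / m ^ q)" q] \<theta> m by simp
    qed
    ultimately show ?thesis by simp
  qed
  have Leq: "L (m * \<theta>) = pgf (L \<theta>)" if "\<theta> \<ge> 0" for \<theta>
  proof (rule LIMSEQ_unique)
    show "(\<lambda>q. (pgf ^^ Suc q) (exp (- (m * \<theta>) / m ^ Suc q))) \<longlonglongrightarrow> L (m * \<theta>)"
      using LIMSEQ_Suc[OF Llim[of "m * \<theta>"]] that m by simp
    have "(\<lambda>q. pgf ((pgf ^^ q) (exp (- \<theta> / m ^ q)))) \<longlonglongrightarrow> pgf (L \<theta>)"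
      unfolding pgf_def by (intro tendsto_intros Llim[unfolded pgf_def] that)
    then show "(\<lambda>q. (pgf ^^ Suc q) (exp (- (m * \<theta>) / m ^ Suc q))) \<longlonglongrightarrow> pgf (L \<theta>)"
      using m by simp
  qed
  define \<pi> where "\<pi> = prob {\<omega> \<in> space M. W \<omega> = 0}"
  have "(\<lambda>n. L (m ^ n)) \<longlonglongrightarrow> expectation (\<lambda>\<omega>. indicator {\<omega> \<in> space M. W \<omega> = 0} \<omega>)"
    unfolding L_def
  proof (rule integral_dominated_convergence[where w = "\<lambda>_. 1"])
    show "AE \<omega> in M. (\<lambda>n. exp (- (m ^ n) * W \<omega>)) \<longlonglongrightarrow> indicator {\<omega> \<in> space M. W \<omega> = 0} \<omega>"
      using W_nonneg AE_space
    proof eventually_elim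
      case (elim \<omega>)
      show ?case
      proof (cases "W \<omega> = 0")
        case False
        then have W: "W \<omega> > 0" using elim by simp
        have le: "exp (- (m ^ n * W \<omega>)) \<le> (1 / m) ^ n * (1 / W \<omega>)" for n
        proof -
          have "m ^ n * W \<omega> > 0" using m W by simp
          moreover have "m ^ n * W \<omega> \<le> exp (m ^ n * W \<omega>)" using exp_ge_add_one_self[of "m ^ n * W \<omega>"] by linarith
          ultimately have "1 / exp (m ^ n * W \<omega>) \<le> 1 / (m ^ n * W \<omega>)"
            using m W by (intro divide_left_mono mult_pos_pos) auto
          then show ?thesis by (simp add: exp_minus power_one_over field_simps)
        qed
        have lim0: "(\<lambda>n. (1 / m) ^ n * (1 / W \<omega>)) \<longlonglongrightarrow> 0"
          using m_gt_1 by (intro tendsto_mult_left_zero LIMSEQ_power_zero) simp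
        have "(\<lambda>n. exp (- (m ^ n * W \<omega>))) \<longlonglongrightarrow> 0"
        proof (rule tendsto_sandwich[OF always_eventually always_eventually tendsto_const lim0])
          show "\<forall>n. exp (- (m ^ n * W \<omega>)) \<le> (1 / m) ^ n * (1 / W \<omega>)" using le by blast
        qed simp
        then show ?thesis using False by simp
      qed (use elim in simp)
    qed
    show "AE \<omega> in M. norm (exp (- (m ^ n) * W \<omega>)) \<le> 1" for n
      using W_nonneg by eventually_elim (use m in simp)
  qed auto
  then have lim: "(\<lambda>n. L (m ^ n)) \<longlonglongrightarrow> \<pi>" by (simp add: \<pi>_def)
  have fixpoint: "\<pi> = pgf \<pi>"
  proof (rule LIMSEQ_unique)
    show "(\<lambda>n. L (m ^ Suc n)) \<longlonglongrightarrow> \<pi>" by (rule LIMSEQ_Suc[OF lim])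
    have "(\<lambda>n. pgf (L (m ^ n))) \<longlonglongrightarrow> pgf \<pi>"
      unfolding pgf_def by (intro tendsto_intros lim)
    then show "(\<lambda>n. L (m ^ Suc n)) \<longlonglongrightarrow> pgf \<pi>" using m by (simp add: Leq)
  qed
  have "\<pi> \<noteq> 1"
  proof
    assume "\<pi> = 1"
    then have "AE \<omega> in M. \<omega> \<in> {\<omega> \<in> space M. W \<omega> = 0}" unfolding \<pi>_def by (rule AE_prob_1)
    then have "expectation W = expectation (\<lambda>_. 0)" by (intro integral_cong_AE) auto
    then show False by (simp add: W_expectation)
  qed
  moreover have "(\<pi> - 1) * (p10 * \<pi> - p_none) = 0"
    using fixpoint by (simp add: pgf_def p_none_def power2_eq_square algebra_simps)
  ultimately have "p10 * \<pi> = p_none" by simp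
  then show ?thesis using offspring_supercritical offspring_nonneg by (simp add: \<pi>_def[symmetric] field_simps)
qed

lemma prob_extinct_tendsto: "(\<lambda>n. prob {\<omega> \<in> space M. Z n \<omega> = 0}) \<longlonglongrightarrow> p_none / p10"
proof -
  define \<eta> where "\<eta> = p_none / p10"
  define \<rho> where "\<rho> = p0 + p1 + 2 * p_none"
  have p10: "p10 > 0" using offspring_supercritical offspring_nonneg by simp
  have \<eta>: "\<eta> \<ge> 0" "p10 * \<eta> = p_none" using p10 offspring_nonneg by (auto simp: \<eta>_def)
  have \<rho>: "0 \<le> \<rho>" "\<rho> < 1" using offspring_nonneg offspring_supercritical by (auto simp: \<rho>_def p_none_def)
  have step: "\<eta> - pgf t = (\<eta> - t) * (p0 + p1 + p_none + p10 * t)" for t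
  proof -
    have "pgf \<eta> - \<eta> = (\<eta> - 1) * (p10 * \<eta> - p_none)"
      by (simp add: pgf_def p_none_def power2_eq_square algebra_simps)
    then have "\<eta> - pgf t = pgf \<eta> - pgf t" by (simp add: \<eta>(2))
    also have "\<dots> = (\<eta> - t) * (p0 + p1 + p10 * \<eta> + p10 * t)"
      by (simp add: pgf_def power2_eq_square algebra_simps)
    finally show ?thesis by (simp add: \<eta>(2))
  qed
  have "0 \<le> (pgf ^^ n) 0 \<and> (pgf ^^ n) 0 \<le> \<eta> \<and> \<eta> - (pgf ^^ n) 0 \<le> \<eta> * \<rho> ^ n" for n
  proof (induction n)
    case 0 then show ?case using \<eta> by simp
  next
    case (Suc n)
    let ?t = "(pgf ^^ n) 0"
    have t: "0 \<le> ?t" "?t \<le> \<eta>" using Suc by auto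
    have "p10 * ?t \<le> p10 * \<eta>" using t p10 by simp
    then have le: "p0 + p1 + p_none + p10 * ?t \<le> \<rho>" unfolding \<rho>_def \<eta>(2) by simp
    have nn: "0 \<le> p0 + p1 + p_none + p10 * ?t" using t offspring_nonneg by simp
    have "\<eta> - pgf ?t \<le> (\<eta> - ?t) * \<rho>" unfolding step using t le by (intro mult_left_mono) auto
    also have "\<dots> \<le> \<eta> * \<rho> ^ n * \<rho>" using Suc \<rho> by (intro mult_right_mono) auto
    finally have "\<eta> - pgf ?t \<le> \<eta> * \<rho> ^ Suc n" by (simp add: mult_ac)
    moreover have "0 \<le> \<eta> - pgf ?t" unfolding step using t nn by simp
    moreover have "0 \<le> pgf ?t" using t offspring_nonneg by (simp add: pgf_def)
    ultimately show ?case by simp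
  qed
  note bounds = this
  have "(\<lambda>n. (pgf ^^ n) 0) \<longlonglongrightarrow> \<eta>"
  proof (rule tendsto_sandwich[OF always_eventually always_eventually _ tendsto_const])
    show "(\<lambda>n. \<eta> - \<eta> * \<rho> ^ n) \<longlonglongrightarrow> \<eta>"
      using \<rho> by (auto intro!: tendsto_eq_intros LIMSEQ_realpow_zero)
    show "\<forall>n. \<eta> - \<eta> * \<rho> ^ n \<le> (pgf ^^ n) 0" using bounds by (simp add: algebra_simps)
  qed (use bounds in auto)
  moreover have "prob {\<omega> \<in> space M. Z n \<omega> = 0} = (pgf ^^ n) 0" for n
  proof -
    have "prob {\<omega> \<in> space M. Z n \<omega> = 0} = expectation (indicator {\<omega> \<in> space M. Z n \<omega> = 0})"
      by (auto intro!: arg_cong[where f = prob])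
    also have "\<dots> = expectation (\<lambda>\<omega>. 0 ^ card (alive X (gen n) \<omega>))"
      by (intro Bochner_Integration.integral_cong) (auto simp: power_0_left indicator_def)
    finally show ?thesis using Z_pgf[of 0 n] by simp
  qed
  ultimately show ?thesis by (simp add: \<eta>_def)
qed

lemma AE_dead_child: "AE \<omega> in M. X i \<omega> = None \<longrightarrow> X (i @ [\<delta>]) \<omega> = None"
proof -
  define g :: "'a option \<times> 'a option \<times> 'a option \<Rightarrow> real"
    where "g u = (if fst u = None then ext (\<lambda>_. 1) (daughter \<delta> u) else 0)" for u
  have g [measurable]: "g \<in> borel_measurable bar3" unfolding g_def by measurable
  have e: "0 \<le> ext (\<lambda>_. 1) y" "ext (\<lambda>_. 1) y \<le> (1::real)" for y :: "'a option" by (cases y; simp)+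
  have b: "0 \<le> g u" "g u \<le> 1" for u using e by (auto simp: g_def)
  have k: "kapp K g y = 0" for y
  proof (cases y)
    case None
    then show ?thesis by (simp add: kapp_eq triple_kernel_None) (simp add: g_def daughter_def)
  next
    case (Some x)
    have "(\<integral>u. g u \<partial>triple_kernel K y) = (\<integral>u. 0 \<partial>triple_kernel K y)"
      using AE_triple_kernel_fst[of y] Some by (intro integral_cong_AE) (auto simp: g_def)
    then show ?thesis by (simp add: kapp_eq)
  qed
  have "expectation (\<lambda>\<omega>. g (triple X i \<omega>)) = 0"
    using expectation_single_bounded[OF g, of i] b by (simp add: k bounded_iff) (metis abs_of_nonneg)
  moreover have "integrable M (\<lambda>\<omega>. g (triple X i \<omega>))"
    by (rule integrable_const_bound[of _ 1]) (use b in auto)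
  ultimately have "AE \<omega> in M. g (triple X i \<omega>) = 0"
    using b by (subst (asm) integral_nonneg_eq_0_iff_AE) auto
  then show ?thesis
  proof eventually_elim
    case (elim \<omega>)
    show ?case
      using elim by (cases "X (i @ [\<delta>]) \<omega>") (auto simp: g_def daughter_triple fst_triple split: if_splits)
  qed
qed

lemma AE_extinct_W: "AE \<omega> in M. Z n \<omega> = 0 \<longrightarrow> W \<omega> = 0"
proof -
  have "AE \<omega> in M. \<forall>i \<delta>. X i \<omega> = None \<longrightarrow> X (i @ [\<delta>]) \<omega> = None"
    unfolding AE_all_countable using AE_dead_child by blast
  then show ?thesis
    using W_AE
  proof eventually_elim
    case (elim \<omega>)
    show ?case
    proof
      assume "Z n \<omega> = 0"
      have "alive X (gen (n + k)) \<omega> = {}" for k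
      proof (induction k)
        case 0
        have "finite (alive X (gen n) \<omega>)" by (rule finite_subset[OF _ finite_gen[of n]]) (auto simp: alive_def)
        then show ?case using \<open>Z n \<omega> = 0\<close> by simp
      next
        case (Suc k)
        have "X j \<omega> = None" if "j \<in> gen (Suc (n + k))" for j
        proof -
          have "length j = Suc (n + k)" using that by (simp add: gen_def)
          then obtain i \<delta> where j: "j = i @ [\<delta>]" "i \<in> gen (n + k)"
            by (cases j rule: rev_cases) (auto simp: gen_def)
          then have "X i \<omega> = None" using Suc by (auto simp: alive_def)
          then show ?thesis using elim(1) j by auto
        qed
        then show ?case by (auto simp: alive_def)
      qed
      then have "(\<lambda>k. Z (k + n) \<omega> / m ^ (k + n)) \<longlonglongrightarrow> 0" by (simp add: add.commute)
      then show "W \<omega> = 0"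
        using LIMSEQ_unique LIMSEQ_ignore_initial_segment[OF elim(2), of n] by blast
    qed
  qed
qed

lemma prob_survive_W_zero: "(\<lambda>n. prob {\<omega> \<in> space M. Z n \<omega> > 0 \<and> W \<omega> = 0}) \<longlonglongrightarrow> 0"
proof -
  have "prob {\<omega> \<in> space M. Z n \<omega> > 0 \<and> W \<omega> = 0} =
      prob {\<omega> \<in> space M. W \<omega> = 0} - prob {\<omega> \<in> space M. Z n \<omega> = 0}" for n
  proof -
    have e1: "prob {\<omega> \<in> space M. Z n \<omega> = 0} = prob {\<omega> \<in> space M. W \<omega> = 0 \<and> Z n \<omega> = 0}"
      using AE_extinct_W[of n] by (intro finite_measure_eq_AE) (auto simp del: of_nat_eq_0_iff)
    have e2: "{\<omega> \<in> space M. Z n \<omega> > 0 \<and> W \<omega> = 0} =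
        {\<omega> \<in> space M. W \<omega> = 0} - {\<omega> \<in> space M. W \<omega> = 0 \<and> Z n \<omega> = 0}" by auto
    have e3: "prob ({\<omega> \<in> space M. W \<omega> = 0} - {\<omega> \<in> space M. W \<omega> = 0 \<and> Z n \<omega> = 0}) =
        prob {\<omega> \<in> space M. W \<omega> = 0} - prob {\<omega> \<in> space M. W \<omega> = 0 \<and> Z n \<omega> = 0}"
    proof (rule finite_measure_Diff)
      show "{\<omega> \<in> space M. W \<omega> = 0} \<in> events" by measurable
      show "{\<omega> \<in> space M. W \<omega> = 0 \<and> Z n \<omega> = 0} \<in> events" by measurable
    qed auto
    show ?thesis unfolding e2 e3 e1 ..
  qed
  moreover have "(\<lambda>n. prob {\<omega> \<in> space M. W \<omega> = 0} - prob {\<omega> \<in> space M. Z n \<omega> = 0}) \<longlonglongrightarrow> p_none / p10 - p_none / p10"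
    unfolding prob_W_zero by (intro tendsto_intros prob_extinct_tendsto)
  ultimately show ?thesis by simp
qed

lemma tree_card_eq: "real (card (alive X (tree_upto r) \<omega>)) = (\<Sum>q\<le>r. Z q \<omega>)"
  by (simp add: card_alive sum_tree_upto)

lemma tree_card_expectation: "expectation (\<lambda>\<omega>. real (card (alive X (tree_upto r) \<omega>))) = (\<Sum>q\<le>r. m ^ q)"
proof -
  have "integrable M (Z q)" for q unfolding Z_eq_popsum by (rule popsum_integrable[OF F_const])
  then show ?thesis unfolding tree_card_eq by (simp add: Z_expectation)
qed

lemma tree_card_L2:
  "converges_L2 M (\<lambda>r \<omega>. real (card (alive X (tree_upto r) \<omega>)) / (\<Sum>q\<le>r. m ^ q)) W"
  using converges_L2_geometric_average[OF W_L2 m_gt_1] m_gt_1 by (simp add: tree_card_eq)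

lemma survival_quotient:
  assumes "converges_L2 M U (\<lambda>\<omega>. c * W \<omega>)" "converges_L2 M V W"
  shows "converges_prob M (\<lambda>n \<omega>. if Z n \<omega> > 0 then U n \<omega> / V n \<omega> else 0) (\<lambda>\<omega>. c * (if W \<omega> \<noteq> 0 then 1 else 0))"
proof (rule converges_prob_quotient[OF prob_space_axioms assms _ prob_survive_W_zero])
  show "Measurable.pred M (\<lambda>\<omega>. Z n \<omega> > 0)" for n by measurable
  show "AE \<omega> in M. \<not> Z n \<omega> > 0 \<longrightarrow> W \<omega> = 0" for n
    using AE_extinct_W[of n] by eventually_elim simp
qed

end

theorem theorem3p4:
  fixes M :: "'w measure" and K :: "('a::metric_space) bkernel" and \<nu> \<mu> :: "'a measure"
    and X :: "node \<Rightarrow> 'w \<Rightarrow> 'a option" and p10 p0 p1 m :: real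
    and N :: "'a \<Rightarrow> 'c measure" and Y :: "nat \<Rightarrow> 'c \<Rightarrow> 'a"
    and F :: "('a \<Rightarrow> real) set" and f :: "'a option \<times> 'a option \<times> 'a option \<Rightarrow> real"
    and W :: "'w \<Rightarrow> real" and Gcard Tcard :: "nat \<Rightarrow> 'w \<Rightarrow> real"
    and Gsum Tsum :: "nat \<Rightarrow> 'w \<Rightarrow> real" and c :: real
  defines "m \<equiv> mean_daughters p10 p0 p1"
    and "W \<equiv> gw_limit m X"
    and "Gcard \<equiv> \<lambda>q \<omega>. real (card (alive X (gen q) \<omega>))"
    and "Tcard \<equiv> \<lambda>r \<omega>. real (card (alive X (tree_upto r) \<omega>))"
    and "Gsum \<equiv> \<lambda>q \<omega>. \<Sum>i\<in>alive X (gen q) \<omega>. f (triple X i \<omega>)"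
    and "Tsum \<equiv> \<lambda>r \<omega>. \<Sum>i\<in>alive X (tree_upto r) \<omega>. f (triple X i \<omega>)"
    and "c \<equiv> \<integral>x. kapp K f (Some x) \<partial>\<mu>"
  assumes "cemetery_kernel K"
    and "BMC M K \<nu> X"
    and "spatially_homogeneous K p10 p0 p1"
    and "m > 1"
    and "\<And>x. markov_chain (N x) (aux_kernel K m) (return borel x) Y"
    and "admissible_class K m \<nu> N Y \<mu> F"
    and "f \<in> borel_measurable bar3"
    and "kapp_exists K f" and "in_class (kapp K f) F"
    and "kapp_exists K (\<lambda>u. (f u)\<^sup>2)" and "in_class (kapp K (\<lambda>u. (f u)\<^sup>2)) F"
  shows "(AE \<omega> in M. (\<lambda>q. Gcard q \<omega> / m ^ q) \<longlonglongrightarrow> W \<omega>) \<and>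
    converges_L2 M (\<lambda>q \<omega>. Gcard q \<omega> / m ^ q) W \<and>
    converges_L2 M (\<lambda>q \<omega>. 1 / (\<integral>\<omega>'. Gcard q \<omega>' \<partial>M) * Gsum q \<omega>) (\<lambda>\<omega>. c * W \<omega>) \<and>
    converges_L2 M (\<lambda>r \<omega>. 1 / (\<integral>\<omega>'. Tcard r \<omega>' \<partial>M) * Tsum r \<omega>) (\<lambda>\<omega>. c * W \<omega>) \<and>
    converges_prob M (\<lambda>q \<omega>. if Gcard q \<omega> > 0 then 1 / Gcard q \<omega> * Gsum q \<omega> else 0)
      (\<lambda>\<omega>. c * (if W \<omega> \<noteq> 0 then 1 else 0)) \<and>
    converges_prob M (\<lambda>r \<omega>. if Gcard r \<omega> > 0 then 1 / Tcard r \<omega> * Tsum r \<omega> else 0)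
      (\<lambda>\<omega>. c * (if W \<omega> \<noteq> 0 then 1 else 0))"
proof -
  interpret bmc_observable K p10 p0 p1 m M \<nu> X \<mu> F N Y f
    by unfold_locales (use assms in \<open>simp_all add: m_def\<close>)
  have m: "m > 0" using m_gt_1 by simp
  have c: "c = bmc_observable.c K \<mu> f"
    unfolding assms(7) c_def h_def ..
  have G: "1 / (\<integral>\<omega>'. Gcard q \<omega>' \<partial>M) * Gsum q \<omega> = gen_avg q \<omega>" for q \<omega>
    unfolding Gcard_def Gsum_def gen_avg_def Z_expectation by simp
  have T: "1 / (\<integral>\<omega>'. Tcard r \<omega>' \<partial>M) * Tsum r \<omega> = tree_avg r \<omega>" for r \<omega>
    unfolding Tcard_def Tsum_def tree_avg_def tree_card_expectation by simp
  have Gq: "1 / Gcard q \<omega> * Gsum q \<omega> = gen_avg q \<omega> / (Z q \<omega> / m ^ q)" for q \<omega>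
    using m by (simp add: Gcard_def Gsum_def gen_avg_def)
  have "(\<Sum>q\<le>r. m ^ q) > 0" for r using m by (intro sum_pos) auto
  then have Tq: "1 / Tcard r \<omega> * Tsum r \<omega> =
      tree_avg r \<omega> / (real (card (alive X (tree_upto r) \<omega>)) / (\<Sum>q\<le>r. m ^ q))" for r \<omega>
    by (simp add: Tcard_def Tsum_def tree_avg_def less_imp_neq[symmetric])
  show ?thesis
    unfolding G T Gq Tq c W_def
    using W_AE W_L2 gen_avg_L2 tree_avg_L2 survival_quotient[OF gen_avg_L2 W_L2]
      survival_quotient[OF tree_avg_L2 tree_card_L2]
    by (simp add: Gcard_def)
qed

end
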